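(* Let $a:\mathbb{R}\to\mathbb{R}$ be a continuous function and $g:\Omega\times\mathbb{R}^N\to\mathbb{R}$ a Carathéodory function, and let $L(x,t,\xi)=a(t)g(x,\xi)$ for every $(x,t,\xi)\in\Omega\times\mathbb{R}\times\mathbb{R}^N$. Assume that at least one of the following assumptions holds: (i) $g(\cdot,0)\in L^\infty(\Omega)$ and there exists $\alpha>0$ such that $|g(x,\xi)|\geq\alpha$ for a.e. $x\in\Omega$ and every $\xi\in\mathbb{R}^N$; (ii) there exists $\xi_0\in\mathbb{R}^N$ such that $g(x,\xi_0)=0$ for a.e. $x\in\Omega$; (iii) $a\equiv1$ and there exists $b\in W^{1,p}(\Omega)\cap L^\infty(\Omega)$ such that $g(\cdot,\nabla b)\in L^1(\Omega)$; (iv) $g(\cdot,0)\in L^1(\Omega)$ and there exists $c>0$ such that for a.e. $x\in\Omega$ and every $\xi\in\mathbb{R}^N$, $|g(x,-\xi)|\leq c|g(x,\xi)|$. Then $\mathcal L$ is $L^\infty(\Omega)$-regular at every $u\in\mathcal A$.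
   Context: Let $N\ge 1$, let $\Omega\subset\mathbb{R}^N$ be a bounded open set, $1\leq p\leq N$, and $\varphi\in W^{1,p}(\mathbb{R}^N)\cap L^\infty(\mathbb{R}^N)$. $W^{1,p}_0(\Omega)$ is the closure in $W^{1,p}(\Omega)$ of the $C^1$ functions with compact support in $\Omega$, and $W^{1,p}_\varphi(\Omega)=\varphi+W^{1,p}_0(\Omega)$. A function $g:\Omega\times\mathbb{R}^N\to\mathbb{R}$ is Carathéodory if $g(\cdot,\xi)$ is measurable for every $\xi$ and $g(x,\cdot)$ is continuous for a.e. $x$. Given $L:\Omega\times\mathbb{R}\times\mathbb{R}^N\to\mathbb{R}$, set $\mathcal L(u)=\int_\Omega L(x,u(x),\nabla u(x))\,dx$, and let $\mathcal A=\{u\in W^{1,p}_\varphi(\Omega): L(x,u,\nabla u)\in L^1(\Omega)\}$. The functional $\mathcal L$ is said to be $L^\infty(\Omega)$-regular at $u\in\mathcal A$ if there exists a sequence $(u_k)_{k\ge1}\subset\mathcal A\cap L^\infty(\Omega)$ such that $u_k\to u$ in $W^{1,p}(\Omega)$ and $L(x,u_k,\nabla u_k)\to L(x,u,\nabla u)$ in $L^1(\Omega)$. *)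

theory Defs
  imports "HOL-Analysis.Analysis"
begin

text \<open>
  Elements of the function spaces below are represented by everywhere defined functions; their
  values outside \<open>\<Omega>\<close> are irrelevant, and all the spaces (except the \<open>C\<^sup>1\<close> functions) are closed
  under changing a function on a null subset of \<open>\<Omega>\<close>.
\<close>

definition Lp_space :: "real \<Rightarrow> 'a::euclidean_space set \<Rightarrow> ('a \<Rightarrow> 'b::euclidean_space) set" where
  "Lp_space p \<Omega> = {f. f \<in> borel_measurable (lebesgue_on \<Omega>) \<and>
     integrable (lebesgue_on \<Omega>) (\<lambda>x. norm (f x) powr p)}"

definition Lp_norm :: "real \<Rightarrow> 'a::euclidean_space set \<Rightarrow> ('a \<Rightarrow> 'b::euclidean_space) \<Rightarrow> real" where
  "Lp_norm p \<Omega> f = (LINT x|lebesgue_on \<Omega>. norm (f x) powr p) powr (1 / p)"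

definition Linfty_space :: "'a::euclidean_space set \<Rightarrow> ('a \<Rightarrow> real) set" where
  "Linfty_space \<Omega> = {f. f \<in> borel_measurable (lebesgue_on \<Omega>) \<and>
     (\<exists>C. AE x in lebesgue_on \<Omega>. \<bar>f x\<bar> \<le> C)}"

text \<open>\<open>C\<^sup>1\<close> functions with compact support in \<open>\<Omega>\<close>, extended by zero to the whole space.\<close>

definition C1_compact_support :: "'a::euclidean_space set \<Rightarrow> ('a \<Rightarrow> real) set" where
  "C1_compact_support \<Omega> = {\<psi>.
     (\<exists>\<psi>'. continuous_on UNIV \<psi>' \<and> (\<forall>x. GDERIV \<psi> x :> \<psi>' x)) \<and>
     (\<exists>K. compact K \<and> K \<subseteq> \<Omega> \<and> (\<forall>x. x \<notin> K \<longrightarrow> \<psi> x = 0))}"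

text \<open>
  The weak gradient, by integration by parts against \<open>C\<^sup>1\<close> test functions with compact support
  (by mollification, smooth test functions give the same notion on open sets). The vector-valued
  identity combines the identities for the individual partial derivatives.
\<close>

definition has_weak_gradient ::
  "'a::euclidean_space set \<Rightarrow> ('a \<Rightarrow> real) \<Rightarrow> ('a \<Rightarrow> 'a) \<Rightarrow> bool" where
  "has_weak_gradient \<Omega> u G \<longleftrightarrow>
     (\<forall>K. compact K \<and> K \<subseteq> \<Omega> \<longrightarrow> set_integrable lebesgue K u \<and> set_integrable lebesgue K G) \<and>
     (\<forall>\<psi> \<psi>'. \<psi> \<in> C1_compact_support \<Omega> \<and> (\<forall>x. GDERIV \<psi> x :> \<psi>' x) \<longrightarrow>
        (LINT x|lebesgue_on \<Omega>. u x *\<^sub>R \<psi>' x) = - (LINT x|lebesgue_on \<Omega>. \<psi> x *\<^sub>R G x))"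

text \<open>A weak gradient on an open set is unique up to null sets; we fix one representative.\<close>

definition weak_grad :: "'a::euclidean_space set \<Rightarrow> ('a \<Rightarrow> real) \<Rightarrow> 'a \<Rightarrow> 'a" where
  "weak_grad \<Omega> u = (SOME G. has_weak_gradient \<Omega> u G)"

definition W1p :: "real \<Rightarrow> 'a::euclidean_space set \<Rightarrow> ('a \<Rightarrow> real) set" where
  "W1p p \<Omega> = {u. u \<in> Lp_space p \<Omega> \<and> (\<exists>G. has_weak_gradient \<Omega> u G \<and> G \<in> Lp_space p \<Omega>)}"

definition W1p_norm :: "real \<Rightarrow> 'a::euclidean_space set \<Rightarrow> ('a \<Rightarrow> real) \<Rightarrow> real" where
  "W1p_norm p \<Omega> u = Lp_norm p \<Omega> u + Lp_norm p \<Omega> (weak_grad \<Omega> u)"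

definition W1p_zero :: "real \<Rightarrow> 'a::euclidean_space set \<Rightarrow> ('a \<Rightarrow> real) set" where
  "W1p_zero p \<Omega> = {u \<in> W1p p \<Omega>.
     \<forall>\<epsilon>>0. \<exists>\<psi>\<in>C1_compact_support \<Omega>. W1p_norm p \<Omega> (\<lambda>x. u x - \<psi> x) < \<epsilon>}"

definition W1p_boundary ::
  "real \<Rightarrow> 'a::euclidean_space set \<Rightarrow> ('a \<Rightarrow> real) \<Rightarrow> ('a \<Rightarrow> real) set" where
  "W1p_boundary p \<Omega> \<phi> = {(\<lambda>x. \<phi> x + v x) | v. v \<in> W1p_zero p \<Omega>}"

definition Caratheodory :: "'a::euclidean_space set \<Rightarrow> ('a \<Rightarrow> 'a \<Rightarrow> real) \<Rightarrow> bool" where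
  "Caratheodory \<Omega> g \<longleftrightarrow>
     (\<forall>\<xi>. (\<lambda>x. g x \<xi>) \<in> borel_measurable (lebesgue_on \<Omega>)) \<and>
     (AE x in lebesgue_on \<Omega>. continuous_on UNIV (g x))"

definition along ::
  "'a::euclidean_space set \<Rightarrow> ('a \<Rightarrow> real \<Rightarrow> 'a \<Rightarrow> real) \<Rightarrow> ('a \<Rightarrow> real) \<Rightarrow> 'a \<Rightarrow> real" where
  "along \<Omega> L u x = L x (u x) (weak_grad \<Omega> u x)"

definition admissible ::
  "real \<Rightarrow> 'a::euclidean_space set \<Rightarrow> ('a \<Rightarrow> real) \<Rightarrow> ('a \<Rightarrow> real \<Rightarrow> 'a \<Rightarrow> real) \<Rightarrow> ('a \<Rightarrow> real) set"
  where
  "admissible p \<Omega> \<phi> L = {u \<in> W1p_boundary p \<Omega> \<phi>. integrable (lebesgue_on \<Omega>) (along \<Omega> L u)}"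

text \<open>
  Regularity of the functional \<open>u \<mapsto> \<integral>\<^sub>\<Omega> L(x, u(x), \<nabla>u(x)) dx\<close> at a point \<open>u\<close> of the admissible
  class. It only depends on the integrand \<open>L\<close> and not on the values of the functional.
\<close>

definition Linfty_regular_at ::
  "real \<Rightarrow> 'a::euclidean_space set \<Rightarrow> ('a \<Rightarrow> real) \<Rightarrow> ('a \<Rightarrow> real \<Rightarrow> 'a \<Rightarrow> real) \<Rightarrow> ('a \<Rightarrow> real) \<Rightarrow> bool"
  where
  "Linfty_regular_at p \<Omega> \<phi> L u \<longleftrightarrow>
     (\<exists>w :: nat \<Rightarrow> 'a \<Rightarrow> real.
        (\<forall>k. w k \<in> admissible p \<Omega> \<phi> L \<inter> Linfty_space \<Omega>) \<and>
        (\<lambda>k. W1p_norm p \<Omega> (\<lambda>x. w k x - u x)) \<longlonglongrightarrow> 0 \<and>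
        (\<lambda>k. LINT x|lebesgue_on \<Omega>. \<bar>along \<Omega> L (w k) x - along \<Omega> L u x\<bar>) \<longlonglongrightarrow> 0)"

end

theory Submission
  imports Defs
begin

text \<open>
  The approximations are \<open>w = F(u - b) + b\<close>, where \<open>b\<close> is bounded and \<open>F\<close> is 1-Lipschitz, bounded
  above, and the identity below a high level \<open>t\<close>. Then \<open>w\<close> and \<open>u\<close> agree where \<open>u - b < t\<close>, so it
  suffices to dominate \<open>L(x,w,\<nabla>w)\<close> on \<open>{u - b \<ge> t}\<close> by an integrable function not depending on \<open>t\<close>.
  Under (i) truncate (\<open>b = 0\<close>) at a level \<open>t\<close> that nearly minimises \<open>\<bar>a\<bar>\<close> on a half-line; under (ii)
  take \<open>b(x) = \<xi>\<^sub>0 \<bullet> x\<close>; under (iii) take the given \<open>b\<close>. Under (iv) truncate (\<open>b = 0\<close>) at levels where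
  \<open>\<bar>a\<bar>\<close> stays bounded, if there are arbitrarily high ones; otherwise let \<open>F\<close> zigzag, above \<open>t\<close>, in a
  short interval near a level that almost minimises \<open>\<bar>a\<bar>\<close>, so that \<open>\<nabla>w = \<plusminus>\<nabla>u\<close> and
  \<open>\<bar>a(w)\<bar> \<le> 3\<bar>a(u)\<bar>\<close>. This bounds \<open>w\<close> from above; the same construction for \<open>-w\<close>, with \<open>a(-t)\<close> and
  \<open>g(x,-\<xi>)\<close>, bounds it from below.
\<close>

section \<open>Translation continuity in \<open>L\<^sup>p\<close> and mollification\<close>

text \<open>Truncation replaces \<open>a(u) g(x,\<nabla>u)\<close> by
  \<open>a(t + b) g(x,\<nabla>b)\<close> on the tail, and a continuous \<open>a\<close> may be
  arbitrarily large near the level; the difficulty is to find levels, or a substitute for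
  truncation, that control this. If \<open>|a|\<close> tends to infinity under (iv), truncation
  offers no domination: \<open>g(x,0)\<close> is not comparable with \<open>g(x,\<nabla>u)\<close>,
  so the gradient must survive on the tail. The symmetry of \<open>g\<close> up to the factor
  \<open>c\<close> tolerates \<open>\<nabla>w = \<plusminus>\<nabla>u\<close>, and a function with
  slopes 1 and -1 can still be confined to an interval as short as the continuity of
  \<open>a\<close> demands. Domination suffices because the tails shrink to the empty set, while
  \<open>|w - u| \<le> |u - b|\<close> and
  \<open>|\<nabla>w - \<nabla>u| \<le> 2 |\<nabla>(u - b)|\<close>. Boundary values survive because
  \<open>F\<close> fixes the bounded function \<open>\<phi> - b\<close> once \<open>t\<close> is
  large. The pass for the lower bound keeps the upper bound already reached because \<open>F\<close>
  is nonnegative above \<open>t\<close>.\<close>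

abbreviation Lp_mass :: "real \<Rightarrow> 'c measure \<Rightarrow> ('c \<Rightarrow> 'b::real_normed_vector) \<Rightarrow> ennreal" where
  "Lp_mass p M f \<equiv> \<integral>\<^sup>+x. ennreal (norm (f x) powr p) \<partial>M"

text \<open>The sum is at most three times its largest term. This needs no convexity and so covers
  every exponent; its constant \<open>3 powr p\<close> is the one in all later quasi-triangle
  inequalities.\<close>

lemma powr_add3_le:
  fixes a b c p :: real
  assumes "0 \<le> a" "0 \<le> b" "0 \<le> c" "0 \<le> p"
  shows "(a + b + c) powr p \<le> 3 powr p * (a powr p + b powr p + c powr p)"
proof -
  define m where "m = max a (max b c)"
  have m: "a + b + c \<le> 3 * m" "0 \<le> m" using assms by (auto simp: m_def)
  have "(a + b + c) powr p \<le> (3 * m) powr p" using assms m by (intro powr_mono2) auto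
  also have "\<dots> = 3 powr p * m powr p" using m by (simp add: powr_mult)
  also have "m powr p \<le> a powr p + b powr p + c powr p"
    by (auto simp: m_def max_def)
  finally show ?thesis by (simp add: mult_left_mono)
qed

lemma powr_add_le:
  fixes a b p :: real
  assumes "0 \<le> a" "0 \<le> b" "0 \<le> p"
  shows "(a + b) powr p \<le> 3 powr p * (a powr p + b powr p)"
  using powr_add3_le[of a b 0 p] assms by simp

lemma tendsto_norm_powr_zero:
  fixes f :: "'c \<Rightarrow> 'b::real_normed_vector"
  assumes "(f \<longlongrightarrow> 0) F" "0 < p"
  shows "((\<lambda>n. norm (f n) powr p) \<longlongrightarrow> 0) F"
  by (rule tendsto_zero_powrI[OF tendsto_norm_zero[OF assms(1)] tendsto_const]) (use assms in auto)

text \<open>Two dominated convergences. Restricting \<open>f\<close> to a ball and to bounded values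
  leaves a small error, dominated by \<open>norm (f x) powr q\<close>. The restriction is an a.e.
  limit of continuous functions, which are then forced to be bounded with support in a fixed ball,
  so that a constant on that ball dominates.\<close>

lemma Lp_density_Cc:
  fixes f :: "'a::euclidean_space \<Rightarrow> 'b::euclidean_space"
  assumes f[measurable]: "f \<in> borel_measurable borel"
    and int: "integrable lborel (\<lambda>x. norm (f x) powr q)" and q: "0 < q" and e: "0 < (e::real)"
  shows "\<exists>h R. continuous_on UNIV h \<and> (\<forall>x. R < norm x \<longrightarrow> h x = 0) \<and>
    Lp_mass q lborel (\<lambda>x. f x - h x) \<le> ennreal e"
proof -
  \<comment> \<open>Two errors, each multiplied by \<open>3 powr q\<close>, must add up to at most
    \<open>e\<close>.\<close>
  define c where "c = e / (2 * 3 powr q)"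
  have c: "0 < c" using e by (simp add: c_def)
  define F where "F k x = (if norm x \<le> real (Suc k) \<and> norm (f x) \<le> real (Suc k) then f x else 0)" for k x
  have [measurable]: "F k \<in> borel_measurable borel" for k unfolding F_def by measurable
  have intF: "integrable lborel (\<lambda>x. norm (f x - F k x) powr q)" for k
    by (rule Bochner_Integration.integrable_bound[OF int]) (auto simp: F_def)
  have limF: "(\<lambda>k. LINT x|lborel. norm (f x - F k x) powr q) \<longlonglongrightarrow> (LINT x|(lborel::'a measure). 0)"
  proof (rule integral_dominated_convergence[where w = "\<lambda>x. norm (f x) powr q"])
    show "AE x in lborel. (\<lambda>k. norm (f x - F k x) powr q) \<longlonglongrightarrow> 0"
    proof (intro AE_I2)
      fix x
      have "eventually (\<lambda>k. f x - F k x = 0) sequentially"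
      proof -
        obtain m where m: "norm x + norm (f x) \<le> real m" using real_arch_simple by blast
        show ?thesis
          unfolding eventually_sequentially
        proof (intro exI allI impI)
          fix k assume "m \<le> k"
          then have "norm x + norm (f x) \<le> real (Suc k)" using m by simp
          then have "norm x \<le> real (Suc k)" "norm (f x) \<le> real (Suc k)"
            using norm_ge_zero[of x] norm_ge_zero[of "f x"] by linarith+
          then show "f x - F k x = 0" by (simp add: F_def)
        qed
      qed
      then have "eventually (\<lambda>k. norm (f x - F k x) powr q = 0) sequentially" by eventually_elim simp
      then show "(\<lambda>k. norm (f x - F k x) powr q) \<longlonglongrightarrow> 0" by (rule tendsto_eventually)
    qed
  qed (use int in \<open>auto simp: F_def\<close>)
  then have "eventually (\<lambda>k. (LINT x|lborel. norm (f x - F k x) powr q) < c) sequentially"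
    using order_tendstoD(2)[OF _ c] by simp
  then obtain k where k: "(LINT x|lborel. norm (f x - F k x) powr q) < c"
    by (auto simp: eventually_sequentially)
  define r where "r = real (Suc k)"
  have r: "0 < r" by (simp add: r_def)
  have Fr: "norm (F k x) \<le> r" "r < norm x \<Longrightarrow> F k x = 0" for x by (auto simp: F_def r_def)
  have "F k measurable_on UNIV"
    by (rule lebesgue_measurable_imp_measurable_on) (auto intro: measurable_completion)
  then obtain N g where N: "negligible N" and g: "\<And>n. continuous_on UNIV (g n)"
    and lim: "\<And>x. x \<notin> N \<Longrightarrow> (\<lambda>n. g n x) \<longlonglongrightarrow> F k x"
    unfolding measurable_on_def by auto
  \<comment> \<open>The first factor is 1 on the ball of radius \<open>r\<close> and 0 outside
    radius \<open>r + 1\<close>; the second one projects \<open>g n x\<close> radially onto the ball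
    of radius \<open>r\<close>. Neither changes the limit, since \<open>F k\<close> has values of
    norm at most \<open>r\<close> and vanishes for \<open>norm x > r\<close>.\<close>
  define h where "h n x = max 0 (1 - max 0 (norm x - r)) *\<^sub>R ((r / max r (norm (g n x))) *\<^sub>R g n x)" for n x
  have hcont: "continuous_on UNIV (h n)" for n
    unfolding h_def using r by (intro continuous_intros g) auto
  then have [measurable]: "h n \<in> borel_measurable borel" for n by (rule borel_measurable_continuous_onI)
  have hsupp: "r + 1 < norm x \<Longrightarrow> h n x = 0" for x n by (simp add: h_def)
  have hb: "norm (h n x) \<le> r" for n x
  proof -
    have "norm ((r / max r (norm (g n x))) *\<^sub>R g n x) \<le> r"
      using r by (simp add: field_simps max_def)
    moreover have "\<bar>max 0 (1 - max 0 (norm x - r))\<bar> \<le> 1" by auto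
    ultimately show ?thesis
      unfolding h_def using r by (subst norm_scaleR) (meson mult_left_le_one_le norm_ge_zero order_trans abs_ge_zero)
  qed
  have hlim: "(\<lambda>n. h n x) \<longlonglongrightarrow> F k x" if "x \<notin> N" for x
  proof -
    have "(\<lambda>n. h n x) \<longlonglongrightarrow> max 0 (1 - max 0 (norm x - r)) *\<^sub>R ((r / max r (norm (F k x))) *\<^sub>R F k x)"
      unfolding h_def using r lim[OF that] by (intro tendsto_intros) auto
    also have "max 0 (1 - max 0 (norm x - r)) *\<^sub>R ((r / max r (norm (F k x))) *\<^sub>R F k x) = F k x"
      using r Fr[of x] by (cases "r < norm x") (auto simp: max_def)
    finally show ?thesis .
  qed
  have "AE x in lebesgue. x \<notin> N"
    using N by (intro AE_not_in) (simp add: negligible_iff_null_sets)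
  then have N0: "AE x in lborel. x \<notin> N" by (simp add: AE_completion_iff)
  let ?w = "\<lambda>x::'a. (2 * r) powr q * indicator (cball 0 (r + 1)) x"
  have dom: "norm (norm (F k x - h n x) powr q) \<le> ?w x" for n x
  proof (cases "norm x \<le> r + 1")
    case True
    have "norm (F k x - h n x) \<le> 2 * r" using norm_triangle_ineq4[of "F k x" "h n x"] Fr(1)[of x] hb[of n x] by linarith
    then have "norm (F k x - h n x) powr q \<le> (2 * r) powr q" using q by (intro powr_mono2) auto
    then show ?thesis using True by simp
  next
    case False then show ?thesis using hsupp[of x n] Fr(2)[of x] by simp
  qed
  have wint: "integrable lborel ?w" by (intro integrable_mult_right integrable_real_indicator) (auto simp: emeasure_bounded_finite[unfolded infinity_ennreal_def])
  have intH: "integrable lborel (\<lambda>x. norm (F k x - h n x) powr q)" for n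
    by (rule Bochner_Integration.integrable_bound[OF wint]) (use dom in \<open>auto\<close>)
  have "(\<lambda>n. LINT x|lborel. norm (F k x - h n x) powr q) \<longlonglongrightarrow> (LINT x|(lborel::'a measure). 0)"
  proof (rule integral_dominated_convergence[where w = ?w])
    show "AE x in lborel. (\<lambda>n. norm (F k x - h n x) powr q) \<longlonglongrightarrow> 0"
      using N0
    proof eventually_elim
      case (elim x)
      have "(\<lambda>n. F k x - h n x) \<longlonglongrightarrow> 0" using tendsto_diff[OF tendsto_const hlim[OF elim], of "F k x"] by simp
      then show ?case using tendsto_norm_powr_zero q by blast
    qed
  qed (use dom wint in auto)
  then have "eventually (\<lambda>n. (LINT x|lborel. norm (F k x - h n x) powr q) < c) sequentially"
    using order_tendstoD(2)[OF _ c] by simp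
  then obtain n where n: "(LINT x|lborel. norm (F k x - h n x) powr q) < c"
    by (auto simp: eventually_sequentially)
  let ?B = "\<lambda>x. 3 powr q * (norm (f x - F k x) powr q + norm (F k x - h n x) powr q)"
  have Bint: "integrable lborel ?B" using intF intH by simp
  have "Lp_mass q lborel (\<lambda>x. f x - h n x) \<le> (\<integral>\<^sup>+x. ennreal (?B x) \<partial>lborel)"
  proof (intro nn_integral_mono ennreal_leI)
    fix x
    have "norm (f x - h n x) \<le> norm (f x - F k x) + norm (F k x - h n x)" 
      by (metis diff_add_cancel diff_diff_eq2 norm_triangle_ineq add_diff_eq)
    then have "norm (f x - h n x) powr q \<le> (norm (f x - F k x) + norm (F k x - h n x)) powr q"
      using q by (intro powr_mono2) auto
    also have "\<dots> \<le> ?B x" using q by (intro powr_add_le) auto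
    finally show "norm (f x - h n x) powr q \<le> ?B x" .
  qed
  also have "\<dots> = ennreal (LINT x|lborel. ?B x)"
    by (rule nn_integral_eq_integral[OF Bint]) auto
  also have "(LINT x|lborel. ?B x) \<le> e"
    using k n intF intH by (simp add: c_def field_simps)
  finally have "Lp_mass q lborel (\<lambda>x. f x - h n x) \<le> ennreal e" by (simp add: ennreal_leI)
  then show ?thesis using hcont hsupp by blast
qed

lemma nn_integral_lborel_translation:
  fixes c :: "'a::euclidean_space"
  assumes [measurable]: "F \<in> borel_measurable borel"
  shows "(\<integral>\<^sup>+x. F (x - c) \<partial>lborel) = (\<integral>\<^sup>+x. F x \<partial>lborel)"
proof -
  have "(\<integral>\<^sup>+x. F x \<partial>lborel) = (\<integral>\<^sup>+x. F x \<partial>distr lborel borel ((+) (- c)))"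
    by (simp add: lborel_distr_plus)
  also have "\<dots> = (\<integral>\<^sup>+x. F (- c + x) \<partial>lborel)" by (subst nn_integral_distr) auto
  finally show ?thesis by simp
qed

text \<open>With \<open>h\<close> continuous of compact support, the difference splits into
  \<open>f - h\<close> translated, \<open>h\<close> translated minus \<open>h\<close>, and
  \<open>h - f\<close>. The outer two have equal mass by translation invariance; the middle one is
  small by uniform continuity of \<open>h\<close>.\<close>

lemma Lp_translation_continuous:
  fixes f :: "'a::euclidean_space \<Rightarrow> 'b::euclidean_space"
  assumes f[measurable]: "f \<in> borel_measurable borel"
    and int: "integrable lborel (\<lambda>x. norm (f x) powr q)" and q: "0 < q" and e: "0 < (e::real)"
  shows "\<exists>d>0. \<forall>y. norm y < d \<longrightarrow>
    Lp_mass q lborel (\<lambda>x. f (x - y) - f x) \<le> ennreal e"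
proof -
  define c where "c = e / (3 * 3 powr q)"
  have c: "0 < c" using e by (simp add: c_def)
  obtain h R where h: "continuous_on UNIV h" and R: "\<And>x. R < norm x \<Longrightarrow> h x = 0"
    and fh: "Lp_mass q lborel (\<lambda>x. f x - h x) \<le> ennreal c"
    using Lp_density_Cc[OF f int q c] by blast
  have [measurable]: "h \<in> borel_measurable borel" using h by (rule borel_measurable_continuous_onI)
  define V where "V = measure lborel (cball (0::'a) (R + 1))"
  \<comment> \<open>Chosen so that \<open>s powr q\<close> times the volume of the ball of radius
    \<open>R + 1\<close> is at most \<open>c\<close>; the summand 1 excludes a zero
    denominator.\<close>
  define s where "s = (c / (V + 1)) powr (1 / q)"
  have V: "0 \<le> V" by (simp add: V_def)
  have s: "0 < s" using c V by (simp add: s_def)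
  have sq: "s powr q * V \<le> c"
  proof -
    have "s powr q = c / (V + 1)" using c V q by (simp add: s_def powr_powr)
    then have "s powr q * (V + 1) = c" using V by simp
    then show ?thesis using powr_ge_zero[of s q] unfolding distrib_left mult_1_right by linarith
  qed
  \<comment> \<open>Radius \<open>R + 2\<close> because \<open>x\<close> ranges up to
    \<open>R + 1\<close> and the shift is shorter than 1.\<close>
  have "uniformly_continuous_on (cball 0 (R + 2)) h"
    by (intro compact_uniformly_continuous continuous_on_subset[OF h]) auto
  then obtain d where d: "0 < d" "\<And>x x'. x \<in> cball 0 (R + 2) \<Longrightarrow> x' \<in> cball 0 (R + 2) \<Longrightarrow> dist x' x < d \<Longrightarrow> dist (h x') (h x) < s"
    unfolding uniformly_continuous_on_def using s by meson
  have hdiff: "norm (h (x - y) - h x) powr q \<le> s powr q * indicator (cball 0 (R + 1)) x" if y: "norm y < min d 1" for x y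
  proof (cases "norm x \<le> R + 1")
    case True
    have "norm (x - y) \<le> R + 2" using norm_triangle_ineq4[of x y] y True by linarith
    then have "dist (h (x - y)) (h x) < s" using True y by (intro d) (auto simp: dist_norm norm_minus_commute)
    then show ?thesis using True q by (auto simp: dist_norm intro!: powr_mono2)
  next
    case False
    have "norm (x - y) > R" using norm_triangle_ineq2[of x y] y False by linarith
    then show ?thesis using False R[of x] R[of "x - y"] by auto
  qed
  show ?thesis
  proof (intro exI[of _ "min d 1"] conjI allI impI)
    show "0 < min d 1" using d by simp
    fix y :: 'a assume y: "norm y < min d 1"
    let ?a = "\<lambda>x. norm (f x - h x) powr q"
    have "Lp_mass q lborel (\<lambda>x. f (x - y) - f x) \<le>
      (\<integral>\<^sup>+x. ennreal (3 powr q) * (ennreal (?a (x - y)) + ennreal (s powr q) * indicator (cball 0 (R + 1)) x + ennreal (?a x)) \<partial>lborel)"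
    proof (rule nn_integral_mono)
      fix x
      have "norm (f (x - y) - f x) = norm ((f (x - y) - h (x - y)) + (h (x - y) - h x) + (h x - f x))" by simp
      also have "\<dots> \<le> norm (f (x - y) - h (x - y)) + norm (h (x - y) - h x) + norm (f x - h x)"
        by (metis norm_triangle_mono norm_triangle_ineq norm_minus_commute order_refl)
      finally have "norm (f (x - y) - f x) powr q \<le> (norm (f (x - y) - h (x - y)) + norm (h (x - y) - h x) + norm (f x - h x)) powr q"
        using q by (intro powr_mono2) auto
      also have "\<dots> \<le> 3 powr q * (?a (x - y) + norm (h (x - y) - h x) powr q + ?a x)"
        using q by (intro powr_add3_le) auto
      also have "\<dots> \<le> 3 powr q * (?a (x - y) + s powr q * indicator (cball 0 (R + 1)) x + ?a x)"
        using hdiff[OF y, of x] by (intro mult_left_mono add_mono) auto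
      finally have "ennreal (norm (f (x - y) - f x) powr q) \<le> ennreal (3 powr q * (?a (x - y) + s powr q * indicator (cball 0 (R + 1)) x + ?a x))"
        by (rule ennreal_leI)
      also have "\<dots> = ennreal (3 powr q) * (ennreal (?a (x - y)) + ennreal (s powr q) * indicator (cball 0 (R + 1)) x + ennreal (?a x))"
        by (simp add: ennreal_mult' ennreal_plus[symmetric] indicator_def del: ennreal_plus)
      finally show "ennreal (norm (f (x - y) - f x) powr q) \<le> \<dots>" .
    qed
    also have "\<dots> = ennreal (3 powr q) * ((\<integral>\<^sup>+x. ennreal (?a x) \<partial>lborel) + ennreal (s powr q) * emeasure lborel (cball (0::'a) (R + 1)) + (\<integral>\<^sup>+x. ennreal (?a x) \<partial>lborel))"
    proof -
      have "(\<integral>\<^sup>+x. ennreal (?a (x - y)) \<partial>lborel) = (\<integral>\<^sup>+x. ennreal (?a x) \<partial>lborel)"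
        by (rule nn_integral_lborel_translation) measurable
      note t1 = this
      have t2: "(\<integral>\<^sup>+x. ennreal (s powr q) * indicator (cball 0 (R + 1)) x \<partial>(lborel::'a measure))
          = ennreal (s powr q) * emeasure lborel (cball (0::'a) (R + 1))"
        by (rule nn_integral_cmult_indicator) simp
      have [measurable]: "?a \<in> borel_measurable borel" "(\<lambda>x. ?a (x - y)) \<in> borel_measurable borel" by measurable
      have m1: "(\<lambda>x. ennreal (?a x)) \<in> borel_measurable lborel" "(\<lambda>x. ennreal (?a (x - y))) \<in> borel_measurable lborel" by measurable
      have m2: "(\<lambda>x::'a. ennreal (s powr q) * indicator (cball 0 (R + 1)) x) \<in> borel_measurable lborel"
        by (rule borel_measurable_times_ennreal[OF borel_measurable_const borel_measurable_indicator]) simp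
      have "(\<integral>\<^sup>+x. ennreal (?a (x - y)) + ennreal (s powr q) * indicator (cball 0 (R + 1)) x + ennreal (?a x) \<partial>lborel)
        = (\<integral>\<^sup>+x. ennreal (?a (x - y)) + ennreal (s powr q) * indicator (cball 0 (R + 1)) x \<partial>lborel) + (\<integral>\<^sup>+x. ennreal (?a x) \<partial>lborel)"
        by (rule nn_integral_add[OF borel_measurable_add[OF m1(2) m2] m1(1)])
      also have "(\<integral>\<^sup>+x. ennreal (?a (x - y)) + ennreal (s powr q) * indicator (cball 0 (R + 1)) x \<partial>lborel) =
        (\<integral>\<^sup>+x. ennreal (?a (x - y)) \<partial>lborel) + (\<integral>\<^sup>+x. ennreal (s powr q) * indicator (cball 0 (R + 1)) x \<partial>(lborel::'a measure))"
        by (rule nn_integral_add[OF m1(2) m2])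
      finally have t3: "(\<integral>\<^sup>+x. ennreal (?a (x - y)) + ennreal (s powr q) * indicator (cball 0 (R + 1)) x + ennreal (?a x) \<partial>lborel)
        = (\<integral>\<^sup>+x. ennreal (?a x) \<partial>lborel) + ennreal (s powr q) * emeasure lborel (cball (0::'a) (R + 1)) + (\<integral>\<^sup>+x. ennreal (?a x) \<partial>lborel)"
        unfolding t1 t2 .
      show ?thesis
        unfolding t3[symmetric] by (rule nn_integral_cmult[OF borel_measurable_add[OF borel_measurable_add[OF m1(2) m2] m1(1)]])
    qed
    also have "\<dots> \<le> ennreal (3 powr q) * (ennreal c + ennreal c + ennreal c)"
    proof -
      have "ennreal (s powr q) * emeasure lborel (cball (0::'a) (R + 1)) = ennreal (s powr q * V)"
        unfolding V_def using emeasure_bounded_finite[of "cball (0::'a) (R + 1)"]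
          by (subst emeasure_eq_ennreal_measure) (simp_all add: ennreal_mult')
      also have "\<dots> \<le> ennreal c" using sq by (rule ennreal_leI)
      finally show ?thesis using fh by (intro mult_left_mono add_mono) auto
    qed
    also have "\<dots> = ennreal e"
    proof -
      have "ennreal c + ennreal c + ennreal c = ennreal (3 * c)"
        using c by (subst ennreal_plus[symmetric], simp, simp, subst ennreal_plus[symmetric]) auto
      moreover have "ennreal (3 powr q) * ennreal (3 * c) = ennreal (3 powr q * (3 * c))"
        using c by (subst ennreal_mult') auto
      moreover have "3 powr q * (3 * c) = e" by (simp add: c_def)
      ultimately show ?thesis by metis
    qed
    finally show "Lp_mass q lborel (\<lambda>x. f (x - y) - f x) \<le> ennreal e" .
  qed
qed

section \<open>Jensen's inequality and the \<open>L^p\<close> estimate for convolutions\<close>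

lemma powr_above_tangent:
  fixes s t q :: real
  assumes "0 < s" "0 \<le> t" "1 \<le> q"
  shows "s powr q + q * s powr (q - 1) * (t - s) \<le> t powr q"
proof (cases "t = 0")
  case True
  \<comment> \<open>The point 0 is outside the open half-line on which convexity is used below; here
    the left side of the claim equals \<open>(1 - q) * s powr q\<close>.\<close>
  have "s powr (q - 1) * s = s powr q" using assms by (simp add: powr_diff)
  then show ?thesis using True assms by (simp add: algebra_simps)
      
next
  case False
  have "t powr q - s powr q \<ge> q * s powr (q - 1) * (t - s)"
  proof (rule convex_on_imp_above_tangent[OF powr_convex[OF assms(3)]])
    show "((\<lambda>x. x powr q) has_real_derivative q * s powr (q - 1)) (at s within {0<..})"
      using assms by (auto intro!: derivative_eq_intros)
  qed (use assms False in \<open>auto simp: interior_open\<close>)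
  then show ?thesis by simp
qed

text \<open>The tangent inequality at the mean \<open>s\<close> is integrated against the
  probability density \<open>k\<close>, and its linear term has mean zero. A zero mean or an
  infinite right side makes the claim trivial; writing the right side as a nonnegative integral lets
  the infinite case be included.\<close>

lemma Jensen_powr:
  fixes k h :: "'c \<Rightarrow> real"
  assumes k: "integrable M k" "\<And>y. 0 \<le> k y" "(LINT y|M. k y) = 1"
    and h[measurable]: "h \<in> borel_measurable M" "\<And>y. 0 \<le> h y" and kh: "integrable M (\<lambda>y. k y * h y)"
    and q: "1 \<le> q"
  shows "ennreal ((LINT y|M. k y * h y) powr q) \<le> (\<integral>\<^sup>+y. ennreal (k y * h y powr q) \<partial>M)"
proof -
  have [measurable]: "k \<in> borel_measurable M" using k by auto
  define s where "s = (LINT y|M. k y * h y)"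
  have s0: "0 \<le> s" unfolding s_def using k(2) h(2) by (intro Bochner_Integration.integral_nonneg) simp
  show ?thesis
  proof (cases "s = 0 \<or> (\<integral>\<^sup>+y. ennreal (k y * h y powr q) \<partial>M) = \<infinity>")
    case True then show ?thesis unfolding s_def by auto
  next
    case False
    then have s: "0 < s" and fin: "(\<integral>\<^sup>+y. ennreal (k y * h y powr q) \<partial>M) < \<infinity>" using s0 by (auto simp: top.not_eq_extremum)
    have int: "integrable M (\<lambda>y. k y * h y powr q)"
      using fin k(2) by (intro integrableI_nonneg) auto
    let ?d = "q * s powr (q - 1)"
    have "s powr q = (LINT y|M. (s powr q - ?d * s) * k y + ?d * (k y * h y))"
      using k kh by (subst Bochner_Integration.integral_add) (auto simp: s_def[symmetric])
    also have "\<dots> \<le> (LINT y|M. k y * h y powr q)"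
    proof (rule integral_mono)
      show "integrable M (\<lambda>y. (s powr q - ?d * s) * k y + ?d * (k y * h y))" using k kh by auto
      fix y
      have "k y * (s powr q + ?d * (h y - s)) \<le> k y * h y powr q"
        using powr_above_tangent[OF s h(2) q] k(2) by (intro mult_left_mono) auto
      then show "(s powr q - ?d * s) * k y + ?d * (k y * h y) \<le> k y * h y powr q" by (simp add: algebra_simps)
    qed (rule int)
    finally have "ennreal (s powr q) \<le> ennreal (LINT y|M. k y * h y powr q)" by (rule ennreal_leI)
    also have "\<dots> = (\<integral>\<^sup>+y. ennreal (k y * h y powr q) \<partial>M)"
      using int k(2) by (subst nn_integral_eq_integral) auto
    finally show ?thesis unfolding s_def .
  qed
qed

lemma integrable_lborel_reflect:
  fixes f :: "'a::euclidean_space \<Rightarrow> 'b::euclidean_space"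
  assumes f: "integrable lborel f"
  shows "integrable lborel (\<lambda>y. f (x - y))" and "(LINT y|lborel. f (x - y)) = (LINT y|lborel. f y)"
proof -
  have [measurable]: "f \<in> borel_measurable borel" using f by auto
  have eq: "lborel = distr lborel borel (\<lambda>y::'a. x - y)"
    using lborel_affine[of "-1" x] by (simp add: density_1)
  have "integrable (distr lborel borel (\<lambda>y::'a. x - y)) f" using f eq by simp
  then show "integrable lborel (\<lambda>y. f (x - y))" by (subst (asm) integrable_distr_eq) auto
  have "(LINT y|lborel. f y) = (LINT y|distr lborel borel (\<lambda>y::'a. x - y). f y)" using eq by simp
  then show "(LINT y|lborel. f (x - y)) = (LINT y|lborel. f y)" by (subst (asm) integral_distr) auto
qed

text \<open>The convolution minus \<open>f\<close> is the \<open>k\<close>-average of the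
  differences \<open>f (x - y) - f x\<close>. Jensen moves the power inside the average, Fubini puts
  the integral over \<open>x\<close> first, and only shifts with \<open>norm y < d\<close> carry
  weight. The bound \<open>C\<close> makes the products \<open>k y *\<^sub>R f (x - y)\<close>
  integrable.\<close>

lemma convolution_Lp_close:
  fixes f :: "'a::euclidean_space \<Rightarrow> 'b::euclidean_space" and k :: "'a \<Rightarrow> real"
  assumes f: "integrable lborel f"
    and k: "integrable lborel k" "\<And>y. 0 \<le> k y" "\<And>y. k y \<le> C" "(LINT y|lborel. k y) = 1" "\<And>y. d \<le> norm y \<Longrightarrow> k y = 0"
    and d: "\<And>y. norm y < d \<Longrightarrow> Lp_mass q lborel (\<lambda>x. f (x - y) - f x) \<le> ennreal e"
    and q: "1 \<le> q"
  shows "Lp_mass q lborel (\<lambda>x. (LINT y|lborel. k y *\<^sub>R f (x - y)) - f x) \<le> ennreal e"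
proof -
  have [measurable]: "f \<in> borel_measurable borel" "k \<in> borel_measurable borel" using f k by auto
  have ki: "integrable lborel (\<lambda>y. k y *\<^sub>R f (x - y))" for x
  proof (rule Bochner_Integration.integrable_bound[OF integrable_scaleR_right[OF integrable_lborel_reflect(1)[OF f]]])
    show "AE y in lborel. norm (k y *\<^sub>R f (x - y)) \<le> norm (C *\<^sub>R f (x - y))"
    proof (rule AE_I2)
      fix y
      have "\<bar>k y\<bar> \<le> \<bar>C\<bar>" using k(2,3)[of y] by simp
      then show "norm (k y *\<^sub>R f (x - y)) \<le> norm (C *\<^sub>R f (x - y))" by (simp add: mult_right_mono)
    qed
  qed measurable
  have kj: "integrable lborel (\<lambda>y. k y *\<^sub>R (f (x - y) - f x))" for x
    using ki[of x] k(1) by (simp add: scaleR_diff_right)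
  have step: "ennreal (norm ((LINT y|lborel. k y *\<^sub>R f (x - y)) - f x) powr q) \<le>
     (\<integral>\<^sup>+y. ennreal (k y * norm (f (x - y) - f x) powr q) \<partial>lborel)" for x
  proof -
    have "(LINT y|lborel. k y *\<^sub>R f (x - y)) - f x = (LINT y|lborel. k y *\<^sub>R (f (x - y) - f x))"
      using ki[of x] k(1,4) by (simp add: scaleR_diff_right)
    then have "norm ((LINT y|lborel. k y *\<^sub>R f (x - y)) - f x) \<le> (LINT y|lborel. k y * norm (f (x - y) - f x))"
      using integral_norm_bound[of lborel "\<lambda>y. k y *\<^sub>R (f (x - y) - f x)"] k(2) by simp
    then have "ennreal (norm ((LINT y|lborel. k y *\<^sub>R f (x - y)) - f x) powr q) \<le>
        ennreal ((LINT y|lborel. k y * norm (f (x - y) - f x)) powr q)"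
      using q by (intro ennreal_leI powr_mono2) auto
    also have "\<dots> \<le> (\<integral>\<^sup>+y. ennreal (k y * norm (f (x - y) - f x) powr q) \<partial>lborel)"
      using integrable_norm[OF kj[of x]] k q by (intro Jensen_powr) auto
    finally show ?thesis .
  qed
  have "Lp_mass q lborel (\<lambda>x. (LINT y|lborel. k y *\<^sub>R f (x - y)) - f x) \<le>
    (\<integral>\<^sup>+x. (\<integral>\<^sup>+y. ennreal (k y * norm (f (x - y) - f x) powr q) \<partial>lborel) \<partial>lborel)"
    by (intro nn_integral_mono step)
  also have "\<dots> = (\<integral>\<^sup>+y. (\<integral>\<^sup>+x. ennreal (k y * norm (f (x - y) - f x) powr q) \<partial>lborel) \<partial>lborel)"
    by (rule lborel_pair.Fubini'[symmetric]) measurable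
  also have "\<dots> \<le> (\<integral>\<^sup>+y. ennreal (k y) * ennreal e \<partial>lborel)"
  proof (rule nn_integral_mono)
    fix y :: 'a
    have "(\<integral>\<^sup>+x. ennreal (k y * norm (f (x - y) - f x) powr q) \<partial>lborel) = ennreal (k y) * Lp_mass q lborel (\<lambda>x. f (x - y) - f x)"
      using k(2) by (simp add: ennreal_mult' nn_integral_cmult)
    also have "\<dots> \<le> ennreal (k y) * ennreal e"
      using d[of y] k(5)[of y] by (cases "norm y < d") (auto intro: mult_left_mono)
    finally show "(\<integral>\<^sup>+x. ennreal (k y * norm (f (x - y) - f x) powr q) \<partial>lborel) \<le> ennreal (k y) * ennreal e" .
  qed
  also have "\<dots> = ennreal e"
    using k by (simp add: nn_integral_multc nn_integral_eq_integral)
  finally show ?thesis .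
qed

section \<open>A \<open>C^1\<close> kernel with compact support\<close>

definition bump :: "real \<Rightarrow> 'a::euclidean_space \<Rightarrow> real" where
  "bump e z = (max 0 (e\<^sup>2 - z \<bullet> z))\<^sup>2"

definition bump_grad :: "real \<Rightarrow> 'a::euclidean_space \<Rightarrow> 'a" where
  "bump_grad e z = (- 4 * max 0 (e\<^sup>2 - z \<bullet> z)) *\<^sub>R z"

text \<open>The reason for the square in \<open>bump\<close>: the squared positive part has
  derivative \<open>2 * max 0 a\<close>, which is 2-Lipschitz, so its first-order remainder is at
  most \<open>(b - a)^2\<close>. The kernel is therefore \<open>C^1\<close>, which is all that the
  class of test functions asks for.\<close>

lemma square_positive_part_taylor:
  fixes a b :: real
  shows "\<bar>(max 0 b)\<^sup>2 - (max 0 a)\<^sup>2 - 2 * max 0 a * (b - a)\<bar> \<le> (b - a)\<^sup>2"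
proof -
  consider "a \<le> 0" "b \<le> 0" | "a \<le> 0" "0 \<le> b" | "0 \<le> a" "b \<le> 0" | "0 \<le> a" "0 \<le> b" by linarith
  then show ?thesis
  proof cases
    case 2
    then have "b\<^sup>2 \<le> (b - a)\<^sup>2" by (intro power_mono) auto
    then show ?thesis using 2 by (simp add: max_def)
  next
    case 3
    then have "0 \<le> a\<^sup>2 - 2 * (a * b)" using mult_nonneg_nonpos[of a b] zero_le_power2[of a] by linarith
    moreover have "- a\<^sup>2 - 2 * a * (b - a) = a\<^sup>2 - 2 * (a * b)" by algebra
    moreover have "a\<^sup>2 - 2 * (a * b) \<le> (b - a)\<^sup>2" using zero_le_power2[of b] power2_diff[of b a] by (simp only: mult.commute[of b a] mult.assoc)
    moreover have "max 0 a = a" "max 0 b = 0" using 3 by auto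
    ultimately show ?thesis by (simp only: zero_power2 diff_0)
  next
    case 4
    have "b\<^sup>2 - a\<^sup>2 - 2 * a * (b - a) = (b - a)\<^sup>2" by algebra
    then show ?thesis using 4 by (simp add: max_def)
  qed (simp add: max_def)
qed

lemma bump_eq_0: "0 \<le> e \<Longrightarrow> e \<le> norm z \<Longrightarrow> bump e z = 0"
  and bump_grad_eq_0: "0 \<le> e \<Longrightarrow> e \<le> norm z \<Longrightarrow> bump_grad e z = 0"
  using power_mono[of e "norm z" 2] by (auto simp: bump_def bump_grad_def power2_norm_eq_inner)

lemma bump_base_le_1:
  assumes "0 \<le> e" "e \<le> 1"
  shows "max 0 (e\<^sup>2 - z \<bullet> z) \<le> 1"
proof -
  have "e\<^sup>2 - z \<bullet> z \<le> 1" using power_le_one[OF assms, of 2] inner_ge_zero[of z] by linarith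
  then show ?thesis by simp
qed

lemma bump_nonneg: "0 \<le> bump e z"
  by (simp add: bump_def)

lemma bump_le_1: "0 \<le> e \<Longrightarrow> e \<le> 1 \<Longrightarrow> bump e z \<le> 1"
  unfolding bump_def by (intro power_le_one bump_base_le_1) auto

lemma norm_bump_grad_le:
  assumes "0 \<le> e" "e \<le> 1" shows "norm (bump_grad e z) \<le> 4"
proof (cases "norm z \<le> e")
  case True
  have "max 0 (e\<^sup>2 - z \<bullet> z) \<le> 1" using assms by (rule bump_base_le_1)
  then have "max 0 (e\<^sup>2 - z \<bullet> z) * norm z \<le> 1 * 1" using True assms by (intro mult_mono) auto
  then show ?thesis by (simp add: bump_grad_def abs_mult)
qed (use assms bump_grad_eq_0[of e z] in auto)

lemma continuous_on_bump [continuous_intros]: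
  "continuous_on S f \<Longrightarrow> continuous_on S (\<lambda>x. bump e (f x))"
  unfolding bump_def by (intro continuous_intros)

lemma continuous_on_bump_grad [continuous_intros]:
  "continuous_on S f \<Longrightarrow> continuous_on S (\<lambda>x. bump_grad e (f x))"
  unfolding bump_grad_def by (intro continuous_intros)

lemma measurable_bump [measurable]: "bump e \<in> borel_measurable borel" "bump_grad e \<in> borel_measurable borel"
  by (auto intro!: borel_measurable_continuous_onI continuous_intros)

text \<open>For \<open>norm z \<le> 2\<close>, the increment \<open>d\<close> of
  \<open>z \<bullet> z\<close> is at most \<open>5 * norm h\<close> in size. Its square accounts for
  25, and the quadratic part of \<open>d\<close>, absent from the gradient, for the remaining 2. For
  larger \<open>z\<close> both points lie outside the support. Uniformity in \<open>z\<close> is the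
  point: it permits differentiation under the integral.\<close>

lemma bump_taylor:
  fixes z h :: "'a::euclidean_space"
  assumes e: "0 \<le> e" "e \<le> 1" and h: "norm h \<le> 1"
  shows "\<bar>bump e (z + h) - bump e z - h \<bullet> bump_grad e z\<bar> \<le> 27 * (norm h)\<^sup>2"
proof (cases "norm z \<le> 2")
  case True
  define m where "m = max 0 (e\<^sup>2 - z \<bullet> z)"
  have m: "0 \<le> m" "m \<le> 1" using bump_base_le_1[OF e, of z] by (auto simp: m_def)
  define d where "d = 2 * (z \<bullet> h) + h \<bullet> h"
  have zh: "\<bar>z \<bullet> h\<bar> \<le> 2 * norm h"
    using Cauchy_Schwarz_ineq2[of z h] mult_right_mono[OF True norm_ge_zero[of h]] by linarith
  have hh: "h \<bullet> h \<le> norm h" using h mult_right_mono[OF h norm_ge_zero[of h]] by (simp add: power2_norm_eq_inner[symmetric] power2_eq_square)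
  have "\<bar>d\<bar> \<le> 5 * norm h" using zh hh inner_ge_zero[of h] unfolding d_def by linarith
  then have "d\<^sup>2 \<le> (5 * norm h)\<^sup>2" using power_mono[of "\<bar>d\<bar>" "5 * norm h" 2] by simp
  then have d2: "d\<^sup>2 \<le> 25 * (norm h)\<^sup>2" by (simp add: power_mult_distrib)
  have "e\<^sup>2 - (z + h) \<bullet> (z + h) - (e\<^sup>2 - z \<bullet> z) = - d" by (simp add: d_def inner_simps inner_commute)
  then have t: "\<bar>bump e (z + h) - bump e z - 2 * m * (- d)\<bar> \<le> d\<^sup>2"
    using square_positive_part_taylor[of "e\<^sup>2 - (z + h) \<bullet> (z + h)" "e\<^sup>2 - z \<bullet> z"] unfolding bump_def m_def by simp
  have "h \<bullet> bump_grad e z = 2 * m * (- d) + 2 * m * (h \<bullet> h)"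
    by (simp add: bump_grad_def m_def[symmetric] d_def algebra_simps inner_commute)
  moreover have "0 \<le> 2 * m * (h \<bullet> h)" using m by simp
  moreover have "2 * m * (h \<bullet> h) \<le> 2 * (norm h)\<^sup>2" using m by (simp add: power2_norm_eq_inner mult_left_le_one_le)
  ultimately show ?thesis using t d2 by linarith
next
  case False
  then have "norm (z + h) \<ge> 1" using norm_triangle_ineq2[of z "- h"] h by simp
  then show ?thesis using False e by (simp add: bump_eq_0 bump_grad_eq_0)
qed

lemma GDERIV_quadratic_bound:
  fixes f :: "'a::real_inner \<Rightarrow> real"
  assumes "\<And>h. norm h \<le> 1 \<Longrightarrow> \<bar>f (x + h) - f x - h \<bullet> D\<bar> \<le> C * (norm h)\<^sup>2"
  shows "GDERIV f x :> D"
  unfolding gderiv_def has_derivative_at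
proof
  show "bounded_linear (\<lambda>h. h \<bullet> D)" by (rule bounded_linear_inner_left)
  show "((\<lambda>h. norm (f (x + h) - f x - h \<bullet> D) / norm h) \<longlongrightarrow> 0) (at 0)"
  proof (rule Lim_null_comparison)
    have "eventually (\<lambda>h::'a. h \<noteq> 0 \<and> norm h \<le> 1) (at 0)"
      unfolding eventually_at by (intro exI[of _ 1]) auto
    then show "eventually (\<lambda>h. norm (norm (f (x + h) - f x - h \<bullet> D) / norm h) \<le> C * norm h) (at 0)"
    proof eventually_elim
      case (elim h) then show ?case using assms[of h] by (simp add: field_simps power2_eq_square)
    qed
    have "((\<lambda>h::'a. C * norm h) \<longlongrightarrow> C * norm (0::'a)) (at 0)" by (intro tendsto_intros)
    then show "((\<lambda>h::'a. C * norm h) \<longlongrightarrow> 0) (at 0)" by simp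
  qed
qed

lemma GDERIV_bump:
  assumes "0 \<le> e" "e \<le> 1" shows "GDERIV (bump e) x :> bump_grad e x"
  by (rule GDERIV_quadratic_bound[OF bump_taylor[OF assms]])

lemma integrable_bump_conv:
  fixes U :: "'a::euclidean_space \<Rightarrow> 'b::euclidean_space"
  assumes U: "integrable lborel U" and e: "0 \<le> e" "e \<le> 1"
  shows "integrable lborel (\<lambda>y. bump e (x - y) *\<^sub>R U y)"
proof (rule Bochner_Integration.integrable_bound[OF U])
  have [measurable]: "U \<in> borel_measurable borel" using U by auto
  show "(\<lambda>y. bump e (x - y) *\<^sub>R U y) \<in> borel_measurable lborel" by measurable
  show "AE y in lborel. norm (bump e (x - y) *\<^sub>R U y) \<le> norm (U y)"
  proof (rule AE_I2)
    fix y show "norm (bump e (x - y) *\<^sub>R U y) \<le> norm (U y)"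
      using bump_le_1[OF e, of "x - y"] bump_nonneg[of e "x - y"] by (simp add: mult_left_le_one_le)
  qed
qed

lemma integrable_bump_grad_conv:
  fixes U :: "'a::euclidean_space \<Rightarrow> real"
  assumes U: "integrable lborel U" and e: "0 \<le> e" "e \<le> 1"
  shows "integrable lborel (\<lambda>y. U y *\<^sub>R bump_grad e (x - y))"
proof (rule Bochner_Integration.integrable_bound[OF integrable_mult_right[OF U, of 4]])
  have [measurable]: "U \<in> borel_measurable borel" using U by auto
  show "(\<lambda>y. U y *\<^sub>R bump_grad e (x - y)) \<in> borel_measurable lborel" by measurable
  show "AE y in lborel. norm (U y *\<^sub>R bump_grad e (x - y)) \<le> norm (4 * U y)"
  proof (rule AE_I2)
    fix y show "norm (U y *\<^sub>R bump_grad e (x - y)) \<le> norm (4 * U y)"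
      using mult_left_mono[OF norm_bump_grad_le[OF e, of "x - y"], of "\<bar>U y\<bar>"] by (simp add: abs_mult mult.commute)
  qed
qed

text \<open>The remainder of the kernel is bounded by \<open>27 * (norm h)^2\<close> uniformly in
  \<open>y\<close>, so it integrates against \<open>\<bar>U y\<bar>\<close> to a quadratic
  remainder; \<open>U\<close> enters only in the constant.\<close>

lemma GDERIV_bump_conv:
  fixes U :: "'a::euclidean_space \<Rightarrow> real"
  assumes U: "integrable lborel U" and e: "0 \<le> e" "e \<le> 1"
  shows "GDERIV (\<lambda>x. LINT y|lborel. bump e (x - y) *\<^sub>R U y) x :> (LINT y|lborel. U y *\<^sub>R bump_grad e (x - y))"
proof (rule GDERIV_quadratic_bound)
  fix h :: 'a assume h: "norm h \<le> 1"
  note I = integrable_bump_conv[OF U e] integrable_bump_grad_conv[OF U e]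
  have I3: "integrable lborel (\<lambda>y. h \<bullet> (U y *\<^sub>R bump_grad e (x - y)))"
    using I(2) by (intro integrable_inner_right) auto
  let ?t = "\<lambda>y. bump e (x + h - y) *\<^sub>R U y - bump e (x - y) *\<^sub>R U y - h \<bullet> (U y *\<^sub>R bump_grad e (x - y))"
  have t: "\<bar>?t y\<bar> \<le> 27 * (norm h)\<^sup>2 * \<bar>U y\<bar>" for y
  proof -
    have "?t y = (bump e ((x - y) + h) - bump e (x - y) - h \<bullet> bump_grad e (x - y)) * U y"
      by (simp add: algebra_simps)
    then show ?thesis using bump_taylor[OF e h, of "x - y"] by (simp add: abs_mult mult_right_mono)
  qed
  have it: "integrable lborel ?t" using I I3 by (intro Bochner_Integration.integrable_diff) auto
  have "(LINT y|lborel. bump e (x + h - y) *\<^sub>R U y) - (LINT y|lborel. bump e (x - y) *\<^sub>R U y) - h \<bullet> (LINT y|lborel. U y *\<^sub>R bump_grad e (x - y))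
     = (LINT y|lborel. ?t y)"
  proof -
    have "(LINT y|lborel. ?t y) = (LINT y|lborel. bump e (x + h - y) *\<^sub>R U y - bump e (x - y) *\<^sub>R U y) - (LINT y|lborel. h \<bullet> (U y *\<^sub>R bump_grad e (x - y)))"
      by (rule Bochner_Integration.integral_diff[OF Bochner_Integration.integrable_diff[OF I(1) I(1)] I3])
    moreover have "(LINT y|lborel. bump e (x + h - y) *\<^sub>R U y - bump e (x - y) *\<^sub>R U y) = (LINT y|lborel. bump e (x + h - y) *\<^sub>R U y) - (LINT y|lborel. bump e (x - y) *\<^sub>R U y)"
      by (rule Bochner_Integration.integral_diff[OF I(1) I(1)])
    moreover have "(LINT y|lborel. h \<bullet> (U y *\<^sub>R bump_grad e (x - y))) = h \<bullet> (LINT y|lborel. U y *\<^sub>R bump_grad e (x - y))"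
      by (rule integral_inner_right[OF I(2)])
    ultimately show ?thesis by linarith
  qed
  moreover have "\<bar>LINT y|lborel. ?t y\<bar> \<le> (LINT y|lborel. 27 * (norm h)\<^sup>2 * \<bar>U y\<bar>)"
    by (rule integral_abs_bound_integral[OF it integrable_mult_right[OF integrable_abs[OF U]] t])
  moreover have "(LINT y|lborel. 27 * (norm h)\<^sup>2 * \<bar>U y\<bar>) = 27 * (LINT y|lborel. \<bar>U y\<bar>) * (norm h)\<^sup>2" by simp
  ultimately show "\<bar>(LINT y|lborel. bump e (x + h - y) *\<^sub>R U y) - (LINT y|lborel. bump e (x - y) *\<^sub>R U y) - h \<bullet> (LINT y|lborel. U y *\<^sub>R bump_grad e (x - y))\<bar>
    \<le> 27 * (LINT y|lborel. \<bar>U y\<bar>) * (norm h)\<^sup>2" by linarith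
qed

lemma continuous_bump_grad_conv:
  fixes U :: "'a::euclidean_space \<Rightarrow> real"
  assumes U: "integrable lborel U" and e: "0 \<le> e" "e \<le> 1"
  shows "continuous_on UNIV (\<lambda>x. LINT y|lborel. U y *\<^sub>R bump_grad e (x - y))"
  unfolding continuous_on_sequentially
proof (safe, unfold o_def)
  fix X :: "nat \<Rightarrow> 'a" and a assume X: "X \<longlonglongrightarrow> a"
  show "(\<lambda>n. LINT y|lborel. U y *\<^sub>R bump_grad e (X n - y)) \<longlonglongrightarrow> (LINT y|lborel. U y *\<^sub>R bump_grad e (a - y))"
  proof (rule integral_dominated_convergence[where w = "\<lambda>y. 4 * \<bar>U y\<bar>"])
    have [measurable]: "U \<in> borel_measurable borel" using U by auto
    show "(\<lambda>y. U y *\<^sub>R bump_grad e (a - y)) \<in> borel_measurable lborel" by measurable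
    show "(\<lambda>y. U y *\<^sub>R bump_grad e (X i - y)) \<in> borel_measurable lborel" for i by measurable
    show "integrable lborel (\<lambda>y. 4 * \<bar>U y\<bar>)" using U by auto
    show "AE y in lborel. (\<lambda>n. U y *\<^sub>R bump_grad e (X n - y)) \<longlonglongrightarrow> U y *\<^sub>R bump_grad e (a - y)"
    proof (rule AE_I2)
      fix y
      have c: "isCont (bump_grad e) (a - y)"
        using continuous_on_bump_grad[OF continuous_on_id, of UNIV e] continuous_on_eq_continuous_at[OF open_UNIV] by blast
      have "(\<lambda>n. X n - y) \<longlonglongrightarrow> a - y" by (intro tendsto_intros X)
      from isCont_tendsto_compose[OF c this]
      show "(\<lambda>n. U y *\<^sub>R bump_grad e (X n - y)) \<longlonglongrightarrow> U y *\<^sub>R bump_grad e (a - y)" by (intro tendsto_intros)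
    qed
    show "AE y in lborel. norm (U y *\<^sub>R bump_grad e (X n - y)) \<le> 4 * \<bar>U y\<bar>" for n
    proof (rule AE_I2)
      fix y show "norm (U y *\<^sub>R bump_grad e (X n - y)) \<le> 4 * \<bar>U y\<bar>"
        using mult_left_mono[OF norm_bump_grad_le[OF e, of "X n - y"], of "\<bar>U y\<bar>"] by (simp add: abs_mult mult.commute)
    qed
  qed
qed

section \<open>Mollification and its convergence\<close>

definition mollify :: "real \<Rightarrow> ('a::euclidean_space \<Rightarrow> 'b::euclidean_space) \<Rightarrow> 'a \<Rightarrow> 'b" where
  "mollify e f x = inverse (LINT y|(lborel::'a measure). bump e y) *\<^sub>R (LINT y|lborel. bump e (x - y) *\<^sub>R f y)"

lemma integrable_bump:
  assumes e: "0 \<le> e" "e \<le> 1"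
  shows "integrable lborel (bump e :: 'a::euclidean_space \<Rightarrow> real)"
proof (rule Bochner_Integration.integrable_bound)
  show "integrable lborel (indicator (cball (0::'a) 1) :: 'a \<Rightarrow> real)"
    using emeasure_bounded_finite[of "cball (0::'a) 1"] by (intro integrable_real_indicator) (auto simp: top.not_eq_extremum)
  show "AE x in lborel. norm (bump e x) \<le> norm (indicator (cball (0::'a) 1) x :: real)"
  proof (rule AE_I2)
    fix x :: 'a
    show "norm (bump e x) \<le> norm (indicator (cball (0::'a) 1) x :: real)"
      using bump_nonneg[of e x] bump_le_1[OF e, of x] bump_eq_0[OF e(1), of x] e by (auto simp: indicator_def)
  qed
qed auto

text \<open>On the ball of radius \<open>e/2\<close> the kernel is at least the positive constant
  \<open>?c\<close>, and that ball has positive volume.\<close>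

lemma integral_bump_pos:
  assumes e: "0 < e" "e \<le> 1"
  shows "0 < (LINT y|(lborel::'a::euclidean_space measure). bump e y)"
proof -
  let ?c = "(e\<^sup>2 - (e/2)\<^sup>2)\<^sup>2"
  have c: "0 < ?c" using e by (simp add: power2_eq_square)
  have fin: "emeasure lborel (ball (0::'a) (e/2)) < \<infinity>" by (rule emeasure_bounded_finite) auto
  have "0 < ?c * measure lborel (ball (0::'a) (e/2))" using content_ball_pos[of "e/2" "0::'a"] e c by auto
  also have "\<dots> = (LINT y|lborel. ?c * indicator (ball (0::'a) (e/2)) y)" using fin by simp
  also have "\<dots> \<le> (LINT y|(lborel::'a measure). bump e y)"
  proof (rule integral_mono)
    show "integrable lborel (\<lambda>y. ?c * indicator (ball (0::'a) (e/2)) y)"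
      using fin by (intro integrable_mult_right integrable_real_indicator) auto
    show "integrable lborel (bump e :: 'a \<Rightarrow> real)" using e by (intro integrable_bump) auto
    fix y :: 'a
    show "?c * indicator (ball (0::'a) (e/2)) y \<le> bump e y"
    proof (cases "norm y < e/2")
      case True
      then have "y \<bullet> y \<le> (e/2)\<^sup>2" using power_mono[of "norm y" "e/2" 2] by (simp add: power2_norm_eq_inner)
      moreover have "(e/2)\<^sup>2 \<le> e\<^sup>2" using e by (intro power_mono) auto
      ultimately have "?c \<le> bump e y" unfolding bump_def by (intro power_mono) auto
      then show ?thesis using True by simp
    qed (simp add: bump_nonneg)
  qed
  finally show ?thesis .
qed

lemma mollify_eq_convolution:
  fixes f :: "'a::euclidean_space \<Rightarrow> 'b::euclidean_space"
  assumes f: "integrable lborel f" and e: "0 \<le> e" "e \<le> 1"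
  shows "mollify e f x = (LINT y|lborel. (bump e y / (LINT y|(lborel::'a measure). bump e y)) *\<^sub>R f (x - y))"
proof -
  have "(LINT y|lborel. bump e y *\<^sub>R f (x - y)) = (LINT y|lborel. bump e (x - y) *\<^sub>R f y)"
    using integrable_lborel_reflect(2)[OF integrable_bump_conv[OF f e, of x], of x] by simp
  then show ?thesis unfolding mollify_def divide_inverse
    by (simp add: mult.commute[of _ "inverse _"] scaleR_scaleR[symmetric] del: scaleR_scaleR)
qed

text \<open>The normalised kernel of radius \<open>e\<close> weighs only shifts shorter than
  \<open>e\<close>, so continuity of translations feeds the convolution estimate. The bound is
  claimed for every small radius so that a function and its gradient can be mollified with the same
  one.\<close>

lemma mollify_Lp_tendsto:
  fixes f :: "'a::euclidean_space \<Rightarrow> 'b::euclidean_space"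
  assumes f: "integrable lborel f" and fq: "integrable lborel (\<lambda>x. norm (f x) powr q)" and q: "1 \<le> q" and \<epsilon>: "0 < \<epsilon>"
  shows "\<exists>d>0. \<forall>e. 0 < e \<longrightarrow> e < d \<longrightarrow> Lp_mass q lborel (\<lambda>x. mollify e f x - f x) \<le> ennreal \<epsilon>"
proof -
  have [measurable]: "f \<in> borel_measurable borel" using f by auto
  obtain d where d: "0 < d" "\<And>y. norm y < d \<Longrightarrow> Lp_mass q lborel (\<lambda>x. f (x - y) - f x) \<le> ennreal \<epsilon>"
    using Lp_translation_continuous[OF _ fq _ \<epsilon>] q by auto
  show ?thesis
  proof (intro exI[of _ "min d 1"] conjI allI impI)
    fix e :: real assume e: "0 < e" "e < min d 1"
    let ?c = "LINT y|(lborel::'a measure). bump e y"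
    have c: "0 < ?c" using e by (intro integral_bump_pos) auto
    have "Lp_mass q lborel (\<lambda>x. (LINT y|lborel. (bump e y / ?c) *\<^sub>R f (x - y)) - f x) \<le> ennreal \<epsilon>"
    proof (rule convolution_Lp_close[where C = "1 / ?c" and d = e])
      show "integrable lborel (\<lambda>y::'a. bump e y / ?c)" using e by (intro integrable_divide integrable_bump) auto
      show "0 \<le> bump e y / ?c" for y using c by (simp add: bump_nonneg)
      show "bump e y / ?c \<le> 1 / ?c" for y using c bump_le_1[of e y] e by (simp add: divide_right_mono)
      show "(LINT y|lborel. bump e (y::'a) / ?c) = 1" using c by simp
      show "bump e y / ?c = 0" if "e \<le> norm y" for y using bump_eq_0[OF _ that] e by simp
      show "Lp_mass q lborel (\<lambda>x. f (x - y) - f x) \<le> ennreal \<epsilon>" if "norm y < e" for y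
        using d(2)[of y] that e by auto
    qed (use f q in auto)
    then show "Lp_mass q lborel (\<lambda>x. mollify e f x - f x) \<le> ennreal \<epsilon>"
      using e by (simp add: mollify_eq_convolution[OF f])
  qed (use d in auto)
qed

lemma mollify_eq_0:
  fixes f :: "'a::euclidean_space \<Rightarrow> 'b::euclidean_space"
  assumes "AE y in lborel. y \<notin> K \<longrightarrow> f y = 0" "\<And>y. y \<in> K \<Longrightarrow> e \<le> dist x y" "0 \<le> e"
  shows "mollify e f x = 0"
proof -
  have "AE y in lborel. bump e (x - y) *\<^sub>R f y = 0"
    using assms(1)
  proof eventually_elim
    case (elim y)
    then show ?case using assms(2)[of y] bump_eq_0[OF assms(3), of "x - y"] by (cases "y \<in> K") (auto simp: dist_norm)
  qed
  then show ?thesis unfolding mollify_def by (simp add: integral_eq_zero_AE)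
qed

lemma GDERIV_mollify:
  fixes U :: "'a::euclidean_space \<Rightarrow> real"
  assumes U: "integrable lborel U" and e: "0 < e" "e \<le> 1"
  obtains W where "continuous_on UNIV W" "\<And>x. GDERIV (mollify e U) x :> W x"
    "\<And>x. W x = inverse (LINT y|(lborel::'a measure). bump e y) *\<^sub>R (LINT y|lborel. U y *\<^sub>R bump_grad e (x - y))"
proof
  let ?c = "inverse (LINT y|(lborel::'a measure). bump e y)"
  let ?W = "\<lambda>x. ?c *\<^sub>R (LINT y|lborel. U y *\<^sub>R bump_grad e (x - y))"
  show "continuous_on UNIV ?W" using e by (intro continuous_intros continuous_bump_grad_conv U) auto
  show "GDERIV (mollify e U) x :> ?W x" for x
  proof -
    have "GDERIV (\<lambda>x. ?c * (LINT y|lborel. bump e (x - y) *\<^sub>R U y)) x :> ?c *\<^sub>R (LINT y|lborel. U y *\<^sub>R bump_grad e (x - y)) + (LINT y|lborel. bump e (x - y) *\<^sub>R U y) *\<^sub>R 0"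
      using e by (intro GDERIV_mult GDERIV_const GDERIV_bump_conv U) auto
    then show ?thesis unfolding mollify_def by simp
  qed
qed simp

section \<open>Convergence in \<open>L\<^sup>p\<close>\<close>

text \<open>
  Stated with the nonnegative integral of the \<open>p\<close>-th power: no integrability has to be assumed, and the
  quasi-triangle inequality with constant \<open>3\<^sup>p\<close> replaces Minkowski's inequality.
\<close>

definition Lp_lim :: "real \<Rightarrow> 'c measure \<Rightarrow> (nat \<Rightarrow> 'c \<Rightarrow> 'b::euclidean_space) \<Rightarrow> ('c \<Rightarrow> 'b) \<Rightarrow> bool" where
  "Lp_lim p M X f \<longleftrightarrow> (\<lambda>n. Lp_mass p M (\<lambda>x. X n x - f x)) \<longlonglongrightarrow> 0"

lemma Lp_lim_le:
  assumes "(\<lambda>n. B n) \<longlonglongrightarrow> 0" "\<And>n. Lp_mass p M (\<lambda>x. X n x - f x) \<le> B n"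
  shows "Lp_lim p M X f"
  unfolding Lp_lim_def
  by (rule tendsto_sandwich[OF always_eventually always_eventually tendsto_const assms(1)]) (use assms in auto)

lemma Lp_lim_subseq:
  assumes "Lp_lim p M X f" "strict_mono r" shows "Lp_lim p M (\<lambda>n. X (r n)) f"
  using LIMSEQ_subseq_LIMSEQ[OF assms(1)[unfolded Lp_lim_def] assms(2)] by (simp add: Lp_lim_def o_def)

lemma Lp_lim_comparison:
  assumes Y: "Lp_lim p M Y g" and [measurable]: "\<And>n. Y n \<in> borel_measurable M" "g \<in> borel_measurable M"
    and C: "0 \<le> C" and p: "0 < p" and le: "\<And>n. AE x in M. norm (X n x - f x) \<le> C * norm (Y n x - g x)"
  shows "Lp_lim p M X f"
proof (rule Lp_lim_le)
  have "(\<lambda>n. ennreal (C powr p) * Lp_mass p M (\<lambda>x. Y n x - g x)) \<longlonglongrightarrow> ennreal (C powr p) * 0"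
    using Y unfolding Lp_lim_def by (intro ennreal_tendsto_cmult) auto
  then show "(\<lambda>n. ennreal (C powr p) * Lp_mass p M (\<lambda>x. Y n x - g x)) \<longlonglongrightarrow> 0" by simp
  fix n
  have "Lp_mass p M (\<lambda>x. X n x - f x) \<le> (\<integral>\<^sup>+x. ennreal (C powr p) * ennreal (norm (Y n x - g x) powr p) \<partial>M)"
  proof (rule nn_integral_mono_AE)
    show "AE x in M. ennreal (norm (X n x - f x) powr p) \<le> ennreal (C powr p) * ennreal (norm (Y n x - g x) powr p)"
      using le[of n]
    proof eventually_elim
      case (elim x)
      have "norm (X n x - f x) powr p \<le> (C * norm (Y n x - g x)) powr p" using elim p by (intro powr_mono2) auto
      also have "\<dots> = C powr p * norm (Y n x - g x) powr p" using C by (simp add: powr_mult)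
      finally show ?case by (simp add: ennreal_mult'[symmetric] ennreal_leI)
    qed
  qed
  also have "\<dots> = ennreal (C powr p) * Lp_mass p M (\<lambda>x. Y n x - g x)"
    by (rule nn_integral_cmult) measurable
  finally show "Lp_mass p M (\<lambda>x. X n x - f x) \<le> ennreal (C powr p) * Lp_mass p M (\<lambda>x. Y n x - g x)" .
qed

lemma nn_integral_norm_powr_add_le:
  fixes f g h :: "'c \<Rightarrow> 'b::euclidean_space"
  assumes [measurable]: "f \<in> borel_measurable M" "g \<in> borel_measurable M" and p: "0 < p"
    and h: "\<And>x. norm (h x) \<le> norm (f x) + norm (g x)"
  shows "Lp_mass p M h \<le>
    ennreal (3 powr p) * (Lp_mass p M f + Lp_mass p M g)"
proof -
  have "Lp_mass p M h \<le>
    (\<integral>\<^sup>+x. ennreal (3 powr p) * (ennreal (norm (f x) powr p) + ennreal (norm (g x) powr p)) \<partial>M)"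
  proof (rule nn_integral_mono)
    fix x
    have "norm (h x) powr p \<le> (norm (f x) + norm (g x)) powr p" using h[of x] p by (intro powr_mono2) auto
    also have "\<dots> \<le> 3 powr p * (norm (f x) powr p + norm (g x) powr p)" using p by (intro powr_add_le) auto
    finally have "ennreal (norm (h x) powr p) \<le> ennreal (3 powr p * (norm (f x) powr p + norm (g x) powr p))" by (rule ennreal_leI)
    also have "\<dots> = ennreal (3 powr p) * (ennreal (norm (f x) powr p) + ennreal (norm (g x) powr p))"
      by (subst ennreal_mult') auto
    finally show "ennreal (norm (h x) powr p) \<le> ennreal (3 powr p) * (ennreal (norm (f x) powr p) + ennreal (norm (g x) powr p))" .
  qed
  also have "\<dots> = ennreal (3 powr p) * (Lp_mass p M f + Lp_mass p M g)"
    by (subst nn_integral_cmult, measurable, subst nn_integral_add, measurable)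
  finally show ?thesis .
qed

lemma Lp_lim_add:
  fixes X Y :: "nat \<Rightarrow> 'c \<Rightarrow> 'b::euclidean_space"
  assumes X: "Lp_lim p M X f" and Y: "Lp_lim p M Y g" and p: "0 < p"
    and [measurable]: "\<And>n. X n \<in> borel_measurable M" "f \<in> borel_measurable M" "\<And>n. Y n \<in> borel_measurable M" "g \<in> borel_measurable M"
  shows "Lp_lim p M (\<lambda>n x. X n x + Y n x) (\<lambda>x. f x + g x)"
proof (rule Lp_lim_le)
  let ?B = "\<lambda>n. ennreal (3 powr p) * (Lp_mass p M (\<lambda>x. X n x - f x) + Lp_mass p M (\<lambda>x. Y n x - g x))"
  have "?B \<longlonglongrightarrow> ennreal (3 powr p) * (0 + 0)"
    using X Y unfolding Lp_lim_def by (intro ennreal_tendsto_cmult tendsto_add) auto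
  then show "?B \<longlonglongrightarrow> 0" by simp
  show "Lp_mass p M (\<lambda>x. X n x + Y n x - (f x + g x)) \<le> ?B n" for n
  proof (rule nn_integral_norm_powr_add_le[OF _ _ p])
    show "norm (X n x + Y n x - (f x + g x)) \<le> norm (X n x - f x) + norm (Y n x - g x)" for x
      by (simp add: norm_diff_triangle_ineq)
  qed measurable
qed

lemma Lp_lim_dominated:
  assumes [measurable]: "\<And>n. X n \<in> borel_measurable M" "f \<in> borel_measurable M" "w \<in> borel_measurable M"
    and p: "0 < p" and le: "\<And>n. AE x in M. norm (X n x - f x) \<le> w x"
    and w: "(\<integral>\<^sup>+x. ennreal (w x powr p) \<partial>M) < \<infinity>" and lim: "AE x in M. (\<lambda>n. X n x) \<longlonglongrightarrow> f x"
  shows "Lp_lim p M X f"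
proof -
  have "(\<lambda>n. Lp_mass p M (\<lambda>x. X n x - f x)) \<longlonglongrightarrow> (\<integral>\<^sup>+x. 0 \<partial>M)"
  proof (rule nn_integral_dominated_convergence[where w = "\<lambda>x. ennreal (w x powr p)"])
    show "AE x in M. ennreal (norm (X j x - f x) powr p) \<le> ennreal (w x powr p)" for j
      using le[of j] by eventually_elim (use p in \<open>auto intro!: ennreal_leI powr_mono2\<close>)
    show "AE x in M. (\<lambda>i. ennreal (norm (X i x - f x) powr p)) \<longlonglongrightarrow> 0"
      using lim
    proof eventually_elim
      case (elim x)
      have "(\<lambda>i. X i x - f x) \<longlonglongrightarrow> 0" using elim by (simp add: LIM_zero_iff)
      then have "(\<lambda>i. ennreal (norm (X i x - f x) powr p)) \<longlonglongrightarrow> ennreal 0"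
        by (intro tendsto_ennrealI tendsto_norm_powr_zero p)
      then show ?case by simp
    qed
  qed (use w in auto)
  then show ?thesis by (simp add: Lp_lim_def)
qed

text \<open>The \<open>p\<close>-th powers of the differences tend to 0 in \<open>L^1\<close>, hence
  a.e. along a subsequence; taking \<open>p\<close>-th roots gives the claim.\<close>

lemma Lp_lim_AE_subseq:
  fixes X :: "nat \<Rightarrow> 'c \<Rightarrow> 'b::euclidean_space"
  assumes X: "Lp_lim p M X f" and p: "0 < p"
    and [measurable]: "\<And>n. X n \<in> borel_measurable M" "f \<in> borel_measurable M"
  shows "\<exists>r. strict_mono r \<and> (AE x in M. (\<lambda>n. X (r n) x) \<longlonglongrightarrow> f x)"
proof -
  let ?I = "\<lambda>n. Lp_mass p M (\<lambda>x. X n x - f x)"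
  have "eventually (\<lambda>n. ?I n < 1) sequentially"
    using order_tendstoD(2)[OF X[unfolded Lp_lim_def], of 1] by simp
  \<comment> \<open>Nothing bounds the mass of the early terms. From \<open>N\<close> on it is below
    1, so the powers are integrable there and Bochner integrals may be used.\<close>
  then obtain N where N: "\<And>n. N \<le> n \<Longrightarrow> ?I n < 1" by (auto simp: eventually_sequentially)
  let ?u = "\<lambda>n x. norm (X (n + N) x - f x) powr p"
  have fin: "?I (n + N) < \<infinity>" for n
    using N[of "n + N"] by (metis le_add2 order_less_trans ennreal_one_less_top infinity_ennreal_def)
  have int: "integrable M (?u n)" for n
    using fin[of n] by (intro integrableI_nonneg) auto
  have "?I (n + N) = ennreal (LINT x|M. ?u n x)" for n
    by (rule nn_integral_eq_integral[OF int]) auto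
  then have "(\<lambda>n. ennreal (LINT x|M. ?u n x)) \<longlonglongrightarrow> ennreal 0"
    using LIMSEQ_ignore_initial_segment[OF X[unfolded Lp_lim_def], of N] by simp
  then have "(\<lambda>n. LINT x|M. norm (?u n x)) \<longlonglongrightarrow> 0"
    by (subst (asm) tendsto_ennreal_iff) (auto intro!: always_eventually)
  from tendsto_L1_AE_subseq[OF int this] obtain r where r: "strict_mono r" "AE x in M. (\<lambda>n. ?u (r n) x) \<longlonglongrightarrow> 0" by blast
  show ?thesis
  proof (intro exI[of _ "\<lambda>n. r n + N"] conjI)
    show "strict_mono (\<lambda>n. r n + N)" using r(1) by (simp add: strict_mono_def)
    show "AE x in M. (\<lambda>n. X (r n + N) x) \<longlonglongrightarrow> f x"
      using r(2)
    proof eventually_elim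
      case (elim x)
      have "(\<lambda>n. ?u (r n) x powr (1 / p)) \<longlonglongrightarrow> 0"
        by (rule tendsto_zero_powrI[OF elim tendsto_const]) (use p in auto)
      then have "(\<lambda>n. norm (X (r n + N) x - f x)) \<longlonglongrightarrow> 0" using p by (simp add: powr_powr)
      then show ?case by (simp add: tendsto_norm_zero_iff LIM_zero_iff)
    qed
  qed
qed

text \<open>The product is split into \<open>F (y n)\<close> times \<open>g n - g0\<close>, harmless
  since \<open>F\<close> is bounded, and \<open>F (y n)\<close> times \<open>g0\<close>, which
  converges by domination once \<open>y n\<close> converges a.e. The latter holds along a
  subsequence, hence the \<open>r\<close>. This carries gradients of the form
  \<open>F' (u) \<nabla>u\<close> to the limit in the \<open>C^1\<close> chain rules.\<close>

lemma Lp_lim_scaleR_continuous: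
  fixes y :: "nat \<Rightarrow> 'c \<Rightarrow> real" and g :: "nat \<Rightarrow> 'c \<Rightarrow> 'b::euclidean_space"
  assumes y: "Lp_lim p M y y0" and g: "Lp_lim p M g g0" and p: "0 < p"
    and [measurable]: "\<And>n. y n \<in> borel_measurable M" "y0 \<in> borel_measurable M" "\<And>n. g n \<in> borel_measurable M" "g0 \<in> borel_measurable M"
    and g0: "Lp_mass p M (\<lambda>x. g0 x) < \<infinity>"
    and F: "continuous_on UNIV F" "\<And>t. \<bar>F t\<bar> \<le> B"
  shows "\<exists>r. strict_mono r \<and> Lp_lim p M (\<lambda>n x. F (y (r n) x) *\<^sub>R g (r n) x) (\<lambda>x. F (y0 x) *\<^sub>R g0 x)"
proof -
  have [measurable]: "F \<in> borel_measurable borel" using F by (intro borel_measurable_continuous_onI)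
  obtain r where r: "strict_mono r" "AE x in M. (\<lambda>n. y (r n) x) \<longlonglongrightarrow> y0 x"
    using Lp_lim_AE_subseq[OF y p] by auto
  have B: "0 \<le> B" using F(2)[of 0] by linarith
  have "Lp_lim p M (\<lambda>n x. F (y (r n) x) *\<^sub>R (g (r n) x - g0 x)) (\<lambda>x. 0)"
  proof (rule Lp_lim_comparison[OF Lp_lim_subseq[OF g r(1)] _ _ B p])
    show "AE x in M. norm (F (y (r n) x) *\<^sub>R (g (r n) x - g0 x) - 0) \<le> B * norm (g (r n) x - g0 x)" for n
      using F(2) by (auto intro!: AE_I2 mult_right_mono)
  qed measurable
  moreover have "Lp_lim p M (\<lambda>n x. F (y (r n) x) *\<^sub>R g0 x) (\<lambda>x. F (y0 x) *\<^sub>R g0 x)"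
  proof (rule Lp_lim_dominated[where w = "\<lambda>x. (2 * B) * norm (g0 x)"])
    show "AE x in M. norm (F (y (r n) x) *\<^sub>R g0 x - F (y0 x) *\<^sub>R g0 x) \<le> (2 * B) * norm (g0 x)" for n
    proof (rule AE_I2)
      fix x
      have "\<bar>F (y (r n) x) - F (y0 x)\<bar> \<le> 2 * B" using F(2)[of "y (r n) x"] F(2)[of "y0 x"] by linarith
      then show "norm (F (y (r n) x) *\<^sub>R g0 x - F (y0 x) *\<^sub>R g0 x) \<le> (2 * B) * norm (g0 x)"
        by (simp add: scaleR_diff_left[symmetric] mult_right_mono)
    qed
    have "(\<integral>\<^sup>+x. ennreal ((2 * B * norm (g0 x)) powr p) \<partial>M) = ennreal ((2 * B) powr p) * Lp_mass p M (\<lambda>x. g0 x)"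
      using B by (subst nn_integral_cmult[symmetric]) (auto simp: powr_mult ennreal_mult')
    also have "\<dots> < \<infinity>" using g0 by (simp add: ennreal_mult_less_top)
    finally show "(\<integral>\<^sup>+x. ennreal ((2 * B * norm (g0 x)) powr p) \<partial>M) < \<infinity>" .
    show "AE x in M. (\<lambda>n. F (y (r n) x) *\<^sub>R g0 x) \<longlonglongrightarrow> F (y0 x) *\<^sub>R g0 x"
      using r(2)
    proof eventually_elim
      case (elim x)
      have "isCont F (y0 x)" using F(1) continuous_on_eq_continuous_at[OF open_UNIV] by blast
      from isCont_tendsto_compose[OF this elim] show ?case by (intro tendsto_intros)
    qed
  qed (use p in auto)
  ultimately have "Lp_lim p M (\<lambda>n x. F (y (r n) x) *\<^sub>R (g (r n) x - g0 x) + F (y (r n) x) *\<^sub>R g0 x) (\<lambda>x. 0 + F (y0 x) *\<^sub>R g0 x)"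
    by (rule Lp_lim_add[OF _ _ p]) measurable
  then have "Lp_lim p M (\<lambda>n x. F (y (r n) x) *\<^sub>R g (r n) x) (\<lambda>x. F (y0 x) *\<^sub>R g0 x)"
    by (simp add: scaleR_diff_right)
  with r(1) show ?thesis by blast
qed

lemma Lp_lim_1_integral:
  fixes X :: "nat \<Rightarrow> 'c \<Rightarrow> 'b::euclidean_space"
  assumes X: "Lp_lim 1 M X f" and int: "\<And>n. integrable M (X n)" "integrable M f"
  shows "(\<lambda>n. LINT x|M. X n x) \<longlonglongrightarrow> (LINT x|M. f x)"
proof -
  have "(\<lambda>n. norm ((LINT x|M. X n x) - (LINT x|M. f x))) \<longlonglongrightarrow> 0"
  proof (rule tendsto_sandwich[OF _ _ tendsto_const])
    have I: "Lp_mass 1 M (\<lambda>x. X n x - f x) = ennreal (LINT x|M. norm (X n x - f x))" for n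
      using int by (subst nn_integral_eq_integral[symmetric]) auto
    have "(\<lambda>n. ennreal (LINT x|M. norm (X n x - f x))) \<longlonglongrightarrow> ennreal 0"
      using X unfolding Lp_lim_def I by simp
    then show "(\<lambda>n. LINT x|M. norm (X n x - f x)) \<longlonglongrightarrow> 0"
      by (subst (asm) tendsto_ennreal_iff) (auto intro!: always_eventually)
    show "eventually (\<lambda>n. norm ((LINT x|M. X n x) - (LINT x|M. f x)) \<le> (LINT x|M. norm (X n x - f x))) sequentially"
    proof (intro always_eventually allI)
      fix n
      have "(LINT x|M. X n x) - (LINT x|M. f x) = (LINT x|M. X n x - f x)"
        using int by (simp add: Bochner_Integration.integral_diff)
      then show "norm ((LINT x|M. X n x) - (LINT x|M. f x)) \<le> (LINT x|M. norm (X n x - f x))" by simp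
    qed
  qed auto
  then show ?thesis by (simp add: tendsto_norm_zero_iff LIM_zero_iff)
qed

text \<open>Weak gradients live on the completed measure, while translations and Fubini are used for
  Borel functions; this is the passage between them, made coordinate by coordinate.\<close>

lemma lebesgue_ex_borel:
  fixes f :: "'a::euclidean_space \<Rightarrow> 'b::euclidean_space"
  assumes f: "f \<in> borel_measurable lebesgue"
  shows "\<exists>f'\<in>borel_measurable borel. AE x in lebesgue. f x = f' x"
proof -
  have "\<exists>h\<in>borel_measurable borel. AE x in lebesgue. f x \<bullet> i = h x" for i
  proof -
    have "(\<lambda>x. f x \<bullet> i) \<in> borel_measurable lebesgue" using f by measurable
    from completion_ex_borel_measurable_real[OF this] show ?thesis by (simp add: AE_completion_iff)
  qed
  then obtain h where h: "\<And>i. h i \<in> borel_measurable borel" "\<And>i. AE x in lebesgue. f x \<bullet> i = h i x" by metis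
  show ?thesis
  proof
    show "(\<lambda>x. \<Sum>i\<in>Basis. h i x *\<^sub>R i) \<in> borel_measurable borel" using h(1) by measurable
    have "AE x in lebesgue. \<forall>i\<in>Basis. f x \<bullet> i = h i x"
      by (rule AE_finite_allI) (use h in auto)
    then show "AE x in lebesgue. f x = (\<Sum>i\<in>Basis. h i x *\<^sub>R i)"
      by eventually_elim (metis (mono_tags, lifting) euclidean_representation sum.cong)
  qed
qed

section \<open>Classical and weak gradients\<close>

definition C1_grad :: "('a::euclidean_space \<Rightarrow> real) \<Rightarrow> ('a \<Rightarrow> 'a) \<Rightarrow> bool" where
  "C1_grad f f' \<longleftrightarrow> continuous_on UNIV f' \<and> (\<forall>x. GDERIV f x :> f' x)"

lemma GDERIV_unique:
  assumes "GDERIV f x :> D" "GDERIV f x :> D'" shows "D = D'"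
proof -
  have "(\<lambda>h. h \<bullet> D) = (\<lambda>h. h \<bullet> D')" using assms unfolding gderiv_def by (rule has_derivative_unique)
  then have "h \<bullet> D = h \<bullet> D'" for h by metis
  then show ?thesis using vector_eq_ldot by blast
qed

lemma GDERIV_locally_zero:
  assumes "closed K" "\<And>x. x \<notin> K \<Longrightarrow> f x = 0" "GDERIV f x :> D" "x \<notin> K"
  shows "D = 0"
proof -
  have "GDERIV f x :> 0"
    unfolding gderiv_def
  proof (rule has_derivative_transform_within_open)
    show "((\<lambda>x. 0) has_derivative (\<lambda>h. h \<bullet> 0)) (at x)" by simp
    show "open (- K)" "x \<in> - K" using assms by auto
    show "\<And>y. y \<in> - K \<Longrightarrow> 0 = f y" using assms by auto
  qed
  then show ?thesis using GDERIV_unique assms(3) by blast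
qed

lemma C1_grad_continuous: "C1_grad f f' \<Longrightarrow> continuous_on S f" "C1_grad f f' \<Longrightarrow> continuous_on S f'"
proof -
  assume f: "C1_grad f f'"
  then show "continuous_on S f'" unfolding C1_grad_def by (meson continuous_on_subset subset_UNIV)
  have "isCont f x" for x using f unfolding C1_grad_def gderiv_def by (meson has_derivative_continuous)
  then show "continuous_on S f" by (simp add: continuous_at_imp_continuous_on)
qed

lemma C1_grad_borel [measurable_dest]: 
  assumes "C1_grad f f'" shows "f \<in> borel_measurable borel" "f' \<in> borel_measurable borel"
  using C1_grad_continuous[OF assms] by (auto intro: borel_measurable_continuous_onI)

text \<open>The complement of a compact set is open, so a function vanishing off \<open>K\<close>
  has zero gradient there too; both can be taken to be supported in the same
  \<open>K\<close>.\<close>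

lemma C1_compact_support_iff:
  "\<psi> \<in> C1_compact_support \<Omega> \<longleftrightarrow>
    (\<exists>\<psi>' K. C1_grad \<psi> \<psi>' \<and> compact K \<and> K \<subseteq> \<Omega> \<and> (\<forall>x. x \<notin> K \<longrightarrow> \<psi> x = 0 \<and> \<psi>' x = 0))"
proof
  assume "\<psi> \<in> C1_compact_support \<Omega>"
  then obtain \<psi>' K where *: "C1_grad \<psi> \<psi>'" "compact K" "K \<subseteq> \<Omega>" "\<And>x. x \<notin> K \<Longrightarrow> \<psi> x = 0"
    unfolding C1_compact_support_def C1_grad_def by blast
  have "\<psi>' x = 0" if "x \<notin> K" for x
  proof (rule GDERIV_locally_zero[OF compact_imp_closed[OF *(2)] *(4)])
    show "GDERIV \<psi> x :> \<psi>' x" using *(1) by (simp add: C1_grad_def)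
  qed (use that in auto)
  then show "\<exists>\<psi>' K. C1_grad \<psi> \<psi>' \<and> compact K \<and> K \<subseteq> \<Omega> \<and> (\<forall>x. x \<notin> K \<longrightarrow> \<psi> x = 0 \<and> \<psi>' x = 0)" using * by blast
qed (unfold C1_compact_support_def C1_grad_def, blast)

lemma C1_grad_mult:
  assumes "C1_grad f f'" "C1_grad g g'"
  shows "C1_grad (\<lambda>x. f x * g x) (\<lambda>x. f x *\<^sub>R g' x + g x *\<^sub>R f' x)"
proof -
  note c = C1_grad_continuous[OF assms(1)] C1_grad_continuous[OF assms(2)]
  have "continuous_on UNIV (\<lambda>x. f x *\<^sub>R g' x + g x *\<^sub>R f' x)" by (intro continuous_intros c)
  then show ?thesis using assms unfolding C1_grad_def by (auto intro: GDERIV_mult)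
qed

lemma C1_grad_compose:
  assumes f: "C1_grad f f'" and F: "\<And>t. (F has_real_derivative F' t) (at t)" "continuous_on UNIV F'"
  shows "C1_grad (\<lambda>x. F (f x)) (\<lambda>x. F' (f x) *\<^sub>R f' x)"
  unfolding C1_grad_def
proof (intro conjI allI)
  show "continuous_on UNIV (\<lambda>x. F' (f x) *\<^sub>R f' x)"
    by (intro continuous_intros continuous_on_compose2[OF F(2)] C1_grad_continuous[OF f]) auto
  show "GDERIV (\<lambda>x. F (f x)) x :> F' (f x) *\<^sub>R f' x" for x
    using f F(1) by (intro GDERIV_DERIV_compose) (auto simp: C1_grad_def)
qed

section \<open>Integration by parts for \<open>C^1\<close> functions\<close>

lemma integrable_lborel_compact_support:
  fixes f :: "'a::euclidean_space \<Rightarrow> 'b::euclidean_space"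
  assumes "continuous_on UNIV f" "compact K" "\<And>x. x \<notin> K \<Longrightarrow> f x = 0"
  shows "integrable lborel f"
proof -
  have "integrable lborel (\<lambda>x. indicator K x *\<^sub>R f x)"
    using assms by (intro borel_integrable_compact) (auto intro: continuous_on_subset)
  moreover have "(\<lambda>x. indicator K x *\<^sub>R f x) = f" using assms(3) by (auto simp: indicator_def)
  ultimately show ?thesis by simp
qed

lemma compact_support_bounded:
  fixes f :: "'a::euclidean_space \<Rightarrow> 'b::euclidean_space"
  assumes "continuous_on UNIV f" "compact K" "\<And>x. x \<notin> K \<Longrightarrow> f x = 0"
  obtains B where "0 \<le> B" "\<And>x. norm (f x) \<le> B"
proof -
  have "compact (f ` K)" using assms by (intro compact_continuous_image) (auto intro: continuous_on_subset)
  then obtain B where B: "\<And>y. y \<in> f ` K \<Longrightarrow> norm y \<le> B" using compact_imp_bounded bounded_iff by metis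
  show ?thesis
  proof (rule that[of "max 0 B"])
    show "norm (f x) \<le> max 0 B" for x using B[of "f x"] assms(3)[of x] by (cases "x \<in> K") auto
  qed auto
qed

text \<open>The neighbourhood is the Minkowski sum of \<open>K\<close> and a closed ball.\<close>

lemma compact_UN_cball:
  fixes K :: "'a::euclidean_space set"
  assumes "compact K" shows "compact (\<Union>x\<in>K. cball x r)"
proof -
  have "(\<Union>x\<in>K. cball x r) = {x + y |x y. x \<in> K \<and> y \<in> cball 0 r}"
  proof (intro set_eqI iffI)
    fix z assume "z \<in> (\<Union>x\<in>K. cball x r)"
    then obtain x where "x \<in> K" "dist x z \<le> r" by auto
    then have "z = x + (z - x)" "z - x \<in> cball 0 r" by (auto simp: dist_norm norm_minus_commute)
    with \<open>x \<in> K\<close> show "z \<in> {x + y |x y. x \<in> K \<and> y \<in> cball 0 r}" by blast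
  next
    fix z assume "z \<in> {x + y |x y. x \<in> K \<and> y \<in> cball 0 r}"
    then obtain x y where "x \<in> K" "norm y \<le> r" "z = x + y" by auto
    then show "z \<in> (\<Union>x\<in>K. cball x r)" by (intro UN_I[of x]) (auto simp: dist_norm)
  qed
  then show ?thesis using compact_sums[OF assms compact_cball[of 0 r]] by simp
qed

text \<open>Difference quotients in a coordinate direction have integral zero by translation
  invariance. They are bounded by the Lipschitz constant and converge to the partial derivative, so
  dominated convergence gives it integral zero too. No iterated integration is involved.\<close>

lemma integral_gradient_zero:
  fixes \<theta> :: "'a::euclidean_space \<Rightarrow> real"
  assumes \<theta>: "C1_grad \<theta> \<theta>'" and K: "compact K" "\<And>x. x \<notin> K \<Longrightarrow> \<theta> x = 0" "\<And>x. x \<notin> K \<Longrightarrow> \<theta>' x = 0"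
  shows "(LINT x|lborel. \<theta>' x) = 0"
proof -
  note c = C1_grad_continuous[OF \<theta>, of UNIV]
  note [measurable] = C1_grad_borel[OF \<theta>]
  obtain B where B: "0 \<le> B" "\<And>x. norm (\<theta>' x) \<le> B" using compact_support_bounded[OF c(2) K(1,3)] by blast
  have int: "integrable lborel \<theta>" "integrable lborel \<theta>'"
    using integrable_lborel_compact_support c K by blast+
  have lip: "\<bar>\<theta> (x + h) - \<theta> x\<bar> \<le> B * norm h" for x h
  proof -
    have "norm (\<theta> (x + h) - \<theta> x) \<le> B * norm (x + h - x)"
    proof (rule differentiable_bound[where S = UNIV and f' = "\<lambda>x h. h \<bullet> \<theta>' x"])
      show "(\<theta> has_derivative (\<lambda>h. h \<bullet> \<theta>' y)) (at y within UNIV)" for y using \<theta> by (simp add: C1_grad_def gderiv_def)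
      show "onorm (\<lambda>h. h \<bullet> \<theta>' y) \<le> B" for y
      proof (rule onorm_le)
        fix h
        have "\<bar>h \<bullet> \<theta>' y\<bar> \<le> norm h * norm (\<theta>' y)" by (rule Cauchy_Schwarz_ineq2)
        also have "\<dots> \<le> norm h * B" by (rule mult_left_mono[OF B(2)]) simp
        finally show "norm (h \<bullet> \<theta>' y) \<le> B * norm h" by (simp add: mult.commute)
      qed
    qed auto
    then show ?thesis by simp
  qed
  have "(LINT x|lborel. \<theta>' x) \<bullet> b = 0" if b: "b \<in> Basis" for b
  proof -
    let ?t = "\<lambda>n. inverse (real (Suc n))"
    let ?s = "\<lambda>n x. (\<theta> (x + ?t n *\<^sub>R b) - \<theta> x) / ?t n"
    \<comment> \<open>The steps \<open>?t n\<close> are at most 1, so all difference quotients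
      vanish outside this one compact set.\<close>
    let ?K = "\<Union>x\<in>K. cball x 1"
    have "(\<lambda>n. LINT x|lborel. ?s n x) \<longlonglongrightarrow> (LINT x|lborel. b \<bullet> \<theta>' x)"
    proof (rule integral_dominated_convergence[where w = "\<lambda>x. B * indicator ?K x"])
      have "emeasure lborel ?K < \<infinity>" using compact_UN_cball[OF K(1)] by (intro emeasure_bounded_finite compact_imp_bounded)
      moreover have "?K \<in> sets borel" using compact_UN_cball[OF K(1)] by (intro borel_closed compact_imp_closed)
      ultimately show "integrable lborel (\<lambda>x. B * indicator ?K x)" by (intro integrable_mult_right integrable_real_indicator) auto
      show "AE x in lborel. (\<lambda>n. ?s n x) \<longlonglongrightarrow> b \<bullet> \<theta>' x"
      proof (rule AE_I2)
        fix x
        have d: "(\<theta> has_derivative (\<lambda>h. h \<bullet> \<theta>' x)) (at x)" using \<theta> by (simp add: C1_grad_def gderiv_def)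
        have "((\<lambda>s. \<theta> (x + s *\<^sub>R b)) has_derivative (\<lambda>s. (s *\<^sub>R b) \<bullet> \<theta>' x)) (at 0)"
          by (rule has_derivative_compose[where f = "\<lambda>s. x + s *\<^sub>R b" and g = \<theta> and f' = "\<lambda>s. s *\<^sub>R b"])
             (use d in \<open>auto intro!: derivative_eq_intros\<close>)
        then have "((\<lambda>s. \<theta> (x + s *\<^sub>R b)) has_real_derivative (b \<bullet> \<theta>' x)) (at 0)"
          unfolding has_field_derivative_def by (rule has_derivative_eq_rhs) (auto simp: fun_eq_iff)
        then have "((\<lambda>s. (\<theta> (x + s *\<^sub>R b) - \<theta> x) / s) \<longlongrightarrow> b \<bullet> \<theta>' x) (at 0)"
          by (simp add: has_field_derivative_iff)
        moreover have "filterlim ?t (at 0) sequentially"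
          unfolding filterlim_at using LIMSEQ_inverse_real_of_nat by simp
        ultimately show "(\<lambda>n. ?s n x) \<longlonglongrightarrow> b \<bullet> \<theta>' x" by (rule filterlim_compose)
      qed
      show "AE x in lborel. norm (?s n x) \<le> B * indicator ?K x" for n
      proof (rule AE_I2)
        fix x
        have t: "0 < ?t n" "?t n \<le> 1" by (auto simp: inverse_eq_divide)
        show "norm (?s n x) \<le> B * indicator ?K x"
        proof (cases "x \<in> ?K")
          case True
          have "\<bar>\<theta> (x + ?t n *\<^sub>R b) - \<theta> x\<bar> \<le> B * ?t n" using lip[of x "?t n *\<^sub>R b"] b t by simp
          then have "\<bar>\<theta> (x + ?t n *\<^sub>R b) - \<theta> x\<bar> / ?t n \<le> B" using t(1) by (subst pos_divide_le_eq)
          then show ?thesis using True t(1) by (simp only: real_norm_def abs_divide abs_of_pos indicator_simps mult_1_right)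
        next
          case False
          have "x \<notin> K" using False by auto
          moreover have "x + ?t n *\<^sub>R b \<notin> K"
          proof
            assume "x + ?t n *\<^sub>R b \<in> K"
            moreover have "x \<in> cball (x + ?t n *\<^sub>R b) 1" using b t by (simp add: dist_norm)
            ultimately show False using False by blast
          qed
          ultimately show ?thesis using False K(2) by simp
        qed
      qed
    qed measurable
    moreover have "(LINT x|lborel. ?s n x) = 0" for n
    proof -
      let ?c = "?t n *\<^sub>R b"
      have "integrable lborel (\<lambda>x. \<theta> (x + ?c))" "(LINT x|lborel. \<theta> (x + ?c)) = (LINT x|lborel. \<theta> x)"
      proof -
        have i: "integrable (distr lborel borel ((+) ?c)) \<theta>" using int(1) by (simp add: lborel_distr_plus)
        show "integrable lborel (\<lambda>x. \<theta> (x + ?c))" using i by (subst (asm) integrable_distr_eq) (auto simp: add.commute)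
        have "(LINT x|lborel. \<theta> x) = (LINT x|distr lborel borel ((+) ?c). \<theta> x)" by (simp add: lborel_distr_plus)
        also have "\<dots> = (LINT x|lborel. \<theta> (?c + x))" by (subst integral_distr) auto
        finally show "(LINT x|lborel. \<theta> (x + ?c)) = (LINT x|lborel. \<theta> x)" by (simp add: add.commute)
      qed
      then show ?thesis using int(1) by (simp add: Bochner_Integration.integral_diff)
    qed
    ultimately have "(LINT x|lborel. b \<bullet> \<theta>' x) = 0" by (simp add: LIMSEQ_const_iff)
    then show ?thesis using int(2) by (simp add: inner_commute)
  qed
  then show ?thesis using euclidean_eq_iff[of "LINT x|lborel. \<theta>' x" 0] by simp
qed

lemma C1_integration_by_parts:
  fixes f g :: "'a::euclidean_space \<Rightarrow> real"
  assumes f: "C1_grad f f'" and g: "C1_grad g g'" and K: "compact K" "\<And>x. x \<notin> K \<Longrightarrow> g x = 0" "\<And>x. x \<notin> K \<Longrightarrow> g' x = 0"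
  shows "(LINT x|lebesgue. f x *\<^sub>R g' x) = - (LINT x|lebesgue. g x *\<^sub>R f' x)"
proof -
  note c = C1_grad_continuous[OF f, of UNIV] C1_grad_continuous[OF g, of UNIV]
  have i: "integrable lborel (\<lambda>x. f x *\<^sub>R g' x)" "integrable lborel (\<lambda>x. g x *\<^sub>R f' x)"
    using K by (auto intro!: integrable_lborel_compact_support[of _ K] continuous_intros c)
  have "(LINT x|lborel. f x *\<^sub>R g' x + g x *\<^sub>R f' x) = 0"
    using K by (intro integral_gradient_zero[OF C1_grad_mult[OF f g] K(1)]) auto
  then have "(LINT x|lborel. f x *\<^sub>R g' x) = - (LINT x|lborel. g x *\<^sub>R f' x)"
    using i by (simp add: eq_neg_iff_add_eq_0)
  moreover have "(\<lambda>x. f x *\<^sub>R g' x) \<in> borel_measurable borel" "(\<lambda>x. g x *\<^sub>R f' x) \<in> borel_measurable borel"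
    using i by auto
  ultimately show ?thesis by (simp add: integral_completion)
qed

lemma borel_imp_lebesgue: "f \<in> borel_measurable borel \<Longrightarrow> f \<in> borel_measurable lebesgue"
  by (rule measurable_completion) simp

lemma supported_lebesgue_on:
  fixes f :: "'a::euclidean_space \<Rightarrow> 'b::euclidean_space"
  assumes S: "\<Omega> \<in> sets lebesgue" and "\<And>x. x \<notin> \<Omega> \<Longrightarrow> f x = 0"
  shows "integrable (lebesgue_on \<Omega>) f \<longleftrightarrow> integrable lebesgue f"
    and "(LINT x|lebesgue_on \<Omega>. f x) = (LINT x|lebesgue. f x)"
proof -
  have "(\<lambda>x. if x \<in> \<Omega> then f x else 0) = f" using assms(2) by auto
  then show "integrable (lebesgue_on \<Omega>) f \<longleftrightarrow> integrable lebesgue f" "(LINT x|lebesgue_on \<Omega>. f x) = (LINT x|lebesgue. f x)"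
    using Lebesgue_Measure.integrable_restrict_UNIV[OF S, of f] Lebesgue_Measure.integral_restrict_UNIV[OF S, of f] by simp_all
qed

section \<open>Weak gradients and their elementary calculus\<close>

definition loc_integrable :: "'a::euclidean_space set \<Rightarrow> ('a \<Rightarrow> 'b::euclidean_space) \<Rightarrow> bool" where
  "loc_integrable \<Omega> f \<longleftrightarrow> (\<forall>K. compact K \<and> K \<subseteq> \<Omega> \<longrightarrow> set_integrable lebesgue K f)"

text \<open>Support and gradient are parameters, so that a test function can be integrated over
  \<open>K\<close>, over \<Omega> or over the whole space while the set on which its partners must
  be integrable stays visible.\<close>

definition C1_supported_in :: "'a::euclidean_space set \<Rightarrow> ('a \<Rightarrow> real) \<Rightarrow> ('a \<Rightarrow> 'a) \<Rightarrow> bool" where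
  "C1_supported_in K \<psi> \<psi>' \<longleftrightarrow> C1_grad \<psi> \<psi>' \<and> compact K \<and> (\<forall>x. x \<notin> K \<longrightarrow> \<psi> x = 0 \<and> \<psi>' x = 0)"

text \<open>Test functions vanish outside a compact subset of \<Omega>, which turns the integrals of
  the definition into integrals over the whole space. Uniqueness of the classical gradient
  identifies an arbitrary pointwise gradient of \<psi> with the continuous, compactly supported
  one.\<close>

lemma has_weak_gradient_iff:
  assumes "open \<Omega>"
  shows "has_weak_gradient \<Omega> u G \<longleftrightarrow> loc_integrable \<Omega> u \<and> loc_integrable \<Omega> G \<and>
    (\<forall>K \<psi> \<psi>'. C1_supported_in K \<psi> \<psi>' \<and> K \<subseteq> \<Omega> \<longrightarrow> (LINT x|lebesgue. u x *\<^sub>R \<psi>' x) = - (LINT x|lebesgue. \<psi> x *\<^sub>R G x))"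
    (is "_ \<longleftrightarrow> _ \<and> _ \<and> ?R")
proof -
  have S: "\<Omega> \<in> sets lebesgue" using assms by auto
  have eq: "(LINT x|lebesgue_on \<Omega>. u x *\<^sub>R \<psi>' x) = (LINT x|lebesgue. u x *\<^sub>R \<psi>' x)"
    "(LINT x|lebesgue_on \<Omega>. \<psi> x *\<^sub>R G x) = (LINT x|lebesgue. \<psi> x *\<^sub>R G x)"
    if "C1_supported_in K \<psi> \<psi>'" "K \<subseteq> \<Omega>" for K \<psi> \<psi>'
    using that by (auto intro!: supported_lebesgue_on(2)[OF S] simp: C1_supported_in_def subset_iff)
  have "(\<forall>\<psi> \<psi>'. \<psi> \<in> C1_compact_support \<Omega> \<and> (\<forall>x. GDERIV \<psi> x :> \<psi>' x) \<longrightarrow>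
        (LINT x|lebesgue_on \<Omega>. u x *\<^sub>R \<psi>' x) = - (LINT x|lebesgue_on \<Omega>. \<psi> x *\<^sub>R G x)) \<longleftrightarrow> ?R" (is "?L \<longleftrightarrow> ?R")
  proof
    assume L: ?L
    show ?R
    proof (intro allI impI, elim conjE)
      fix K \<psi> \<psi>' assume s: "C1_supported_in K \<psi> \<psi>'" "K \<subseteq> \<Omega>"
      then have "\<psi> \<in> C1_compact_support \<Omega>" "\<forall>x. GDERIV \<psi> x :> \<psi>' x"
        unfolding C1_compact_support_iff C1_supported_in_def by (blast, simp add: C1_grad_def)
      with L have "(LINT x|lebesgue_on \<Omega>. u x *\<^sub>R \<psi>' x) = - (LINT x|lebesgue_on \<Omega>. \<psi> x *\<^sub>R G x)" by blast
      then show "(LINT x|lebesgue. u x *\<^sub>R \<psi>' x) = - (LINT x|lebesgue. \<psi> x *\<^sub>R G x)" by (simp add: eq[OF s])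
    qed
  next
    assume R: ?R
    show ?L
    proof (intro allI impI, elim conjE)
      fix \<psi> \<psi>' assume a: "\<psi> \<in> C1_compact_support \<Omega>" "\<forall>x. GDERIV \<psi> x :> \<psi>' x"
      then obtain \<psi>'' K where s: "C1_supported_in K \<psi> \<psi>''" "K \<subseteq> \<Omega>"
        unfolding C1_compact_support_iff C1_supported_in_def by blast
      have "\<psi>'' x = \<psi>' x" for x
        using a(2) s(1) by (auto simp: C1_supported_in_def C1_grad_def intro: GDERIV_unique)
      then have "\<psi>'' = \<psi>'" by auto
      then show "(LINT x|lebesgue_on \<Omega>. u x *\<^sub>R \<psi>' x) = - (LINT x|lebesgue_on \<Omega>. \<psi> x *\<^sub>R G x)"
        using R s eq[OF s] by auto
    qed
  qed
  then show ?thesis unfolding has_weak_gradient_def loc_integrable_def by blast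
qed

lemma integrable_lebesgue_bounded_scaleR:
  fixes h :: "'a::euclidean_space \<Rightarrow> real" and u :: "'a \<Rightarrow> 'b::euclidean_space"
  assumes u: "set_integrable lebesgue K u" and h: "h \<in> borel_measurable lebesgue" "\<And>x. \<bar>h x\<bar> \<le> B" "\<And>x. x \<notin> K \<Longrightarrow> h x = 0"
  shows "integrable lebesgue (\<lambda>x. h x *\<^sub>R u x)"
proof -
  have i: "integrable lebesgue (\<lambda>x. B *\<^sub>R (indicator K x *\<^sub>R u x))"
    using u unfolding set_integrable_def by (rule integrable_scaleR_right)
  have "integrable lebesgue (\<lambda>x. h x *\<^sub>R (indicator K x *\<^sub>R u x))"
  proof (rule Bochner_Integration.integrable_bound[OF i])
    show "(\<lambda>x. h x *\<^sub>R (indicator K x *\<^sub>R u x)) \<in> borel_measurable lebesgue"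
      by (rule borel_measurable_scaleR[OF h(1) borel_measurable_integrable[OF u[unfolded set_integrable_def]]])
    show "AE x in lebesgue. norm (h x *\<^sub>R (indicator K x *\<^sub>R u x)) \<le> norm (B *\<^sub>R (indicator K x *\<^sub>R u x))"
    proof (rule AE_I2)
      fix x
      have "\<bar>h x\<bar> \<le> \<bar>B\<bar>" using h(2)[of x] by linarith
      then show "norm (h x *\<^sub>R (indicator K x *\<^sub>R u x)) \<le> norm (B *\<^sub>R (indicator K x *\<^sub>R u x))"
        by (auto simp: indicator_def intro: mult_right_mono)
    qed
  qed
  moreover have "(\<lambda>x. h x *\<^sub>R (indicator K x *\<^sub>R u x)) = (\<lambda>x. h x *\<^sub>R u x)"
    using h(3) by (auto simp: indicator_def fun_eq_iff)
  ultimately show ?thesis by simp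
qed

lemma integrable_lebesgue_scaleR_bounded:
  fixes h :: "'a::euclidean_space \<Rightarrow> 'b::euclidean_space" and u :: "'a \<Rightarrow> real"
  assumes u: "set_integrable lebesgue K u" and h: "h \<in> borel_measurable lebesgue" "\<And>x. norm (h x) \<le> B" "\<And>x. x \<notin> K \<Longrightarrow> h x = 0"
  shows "integrable lebesgue (\<lambda>x. u x *\<^sub>R h x)"
proof -
  have i: "integrable lebesgue (\<lambda>x. B * (indicator K x *\<^sub>R u x))"
    using u unfolding set_integrable_def by (rule integrable_mult_right)
  have "integrable lebesgue (\<lambda>x. (indicator K x *\<^sub>R u x) *\<^sub>R h x)"
  proof (rule Bochner_Integration.integrable_bound[OF i])
    show "(\<lambda>x. (indicator K x *\<^sub>R u x) *\<^sub>R h x) \<in> borel_measurable lebesgue"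
      by (rule borel_measurable_scaleR[OF borel_measurable_integrable[OF u[unfolded set_integrable_def]] h(1)])
    show "AE x in lebesgue. norm ((indicator K x *\<^sub>R u x) *\<^sub>R h x) \<le> norm (B * (indicator K x *\<^sub>R u x))"
    proof (rule AE_I2)
      fix x
      have "norm (h x) \<le> \<bar>B\<bar>" using h(2)[of x] by linarith
      then show "norm ((indicator K x *\<^sub>R u x) *\<^sub>R h x) \<le> norm (B * (indicator K x *\<^sub>R u x))"
        using mult_left_mono[of "norm (h x)" "\<bar>B\<bar>" "\<bar>u x\<bar>"] by (simp add: indicator_def abs_mult mult.commute[of "\<bar>B\<bar>"])
    qed
  qed
  moreover have "(\<lambda>x. (indicator K x *\<^sub>R u x) *\<^sub>R h x) = (\<lambda>x. u x *\<^sub>R h x)"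
    using h(3) by (auto simp: indicator_def fun_eq_iff)
  ultimately show ?thesis by simp
qed

lemma C1_supported_inD:
  assumes "C1_supported_in K \<psi> \<psi>'"
  shows "C1_grad \<psi> \<psi>'" "compact K" "\<And>x. x \<notin> K \<Longrightarrow> \<psi> x = 0" "\<And>x. x \<notin> K \<Longrightarrow> \<psi>' x = 0"
    "\<psi> \<in> borel_measurable lebesgue" "\<psi>' \<in> borel_measurable lebesgue"
    "\<exists>B\<ge>0. (\<forall>x. \<bar>\<psi> x\<bar> \<le> B) \<and> (\<forall>x. norm (\<psi>' x) \<le> B)"
proof -
  show 1: "C1_grad \<psi> \<psi>'" "compact K" and 2: "\<And>x. x \<notin> K \<Longrightarrow> \<psi> x = 0" "\<And>x. x \<notin> K \<Longrightarrow> \<psi>' x = 0"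
    using assms by (auto simp: C1_supported_in_def)
  show "\<psi> \<in> borel_measurable lebesgue" "\<psi>' \<in> borel_measurable lebesgue"
    using C1_grad_borel[OF 1(1)] by (auto intro: measurable_completion)
  obtain B where "0 \<le> B" "\<And>x. norm (\<psi> x) \<le> B" using compact_support_bounded[OF C1_grad_continuous(1)[OF 1(1)] 1(2) 2(1)] by blast
  moreover obtain B' where "0 \<le> B'" "\<And>x. norm (\<psi>' x) \<le> B'" using compact_support_bounded[OF C1_grad_continuous(2)[OF 1(1)] 1(2) 2(2)] by blast
  ultimately show "\<exists>B\<ge>0. (\<forall>x. \<bar>\<psi> x\<bar> \<le> B) \<and> (\<forall>x. norm (\<psi>' x) \<le> B)"
    by (intro exI[of _ "max B B'"]) (auto simp: le_max_iff_disj)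
qed

lemma integrable_test_pair:
  fixes u :: "'a::euclidean_space \<Rightarrow> real" and G :: "'a \<Rightarrow> 'a"
  assumes "C1_supported_in K \<psi> \<psi>'"
  shows "set_integrable lebesgue K u \<Longrightarrow> integrable lebesgue (\<lambda>x. u x *\<^sub>R \<psi>' x)"
    and "set_integrable lebesgue K G \<Longrightarrow> integrable lebesgue (\<lambda>x. \<psi> x *\<^sub>R G x)"
proof -
  note s = C1_supported_inD[OF assms]
  obtain B where B: "\<forall>x. \<bar>\<psi> x\<bar> \<le> B" "\<forall>x. norm (\<psi>' x) \<le> B" using s(7) by blast
  show "set_integrable lebesgue K u \<Longrightarrow> integrable lebesgue (\<lambda>x. u x *\<^sub>R \<psi>' x)"
    using integrable_lebesgue_scaleR_bounded[OF _ s(6) _ s(4)] B by blast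
  show "set_integrable lebesgue K G \<Longrightarrow> integrable lebesgue (\<lambda>x. \<psi> x *\<^sub>R G x)"
    using integrable_lebesgue_bounded_scaleR[OF _ s(5) _ s(3)] B by blast
qed

lemma loc_integrableD: "loc_integrable \<Omega> f \<Longrightarrow> compact K \<Longrightarrow> K \<subseteq> \<Omega> \<Longrightarrow> set_integrable lebesgue K f"
  by (simp add: loc_integrable_def)

lemma has_weak_gradientD:
  assumes "open \<Omega>" "has_weak_gradient \<Omega> u G"
  shows "loc_integrable \<Omega> u" "loc_integrable \<Omega> G"
    "\<And>K \<psi> \<psi>'. C1_supported_in K \<psi> \<psi>' \<Longrightarrow> K \<subseteq> \<Omega> \<Longrightarrow> (LINT x|lebesgue. u x *\<^sub>R \<psi>' x) = - (LINT x|lebesgue. \<psi> x *\<^sub>R G x)"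
  using assms(2) unfolding has_weak_gradient_iff[OF assms(1)] by blast+

lemma loc_integrable_linear:
  fixes f g :: "'a::euclidean_space \<Rightarrow> 'b::euclidean_space"
  assumes "loc_integrable \<Omega> f" "loc_integrable \<Omega> g"
  shows "loc_integrable \<Omega> (\<lambda>x. a *\<^sub>R f x + b *\<^sub>R g x)"
  unfolding loc_integrable_def
proof (intro allI impI)
  fix K assume "compact K \<and> K \<subseteq> \<Omega>"
  then have "set_integrable lebesgue K f" "set_integrable lebesgue K g" using assms by (auto simp: loc_integrable_def)
  then have "integrable lebesgue (\<lambda>x. a *\<^sub>R (indicator K x *\<^sub>R f x) + b *\<^sub>R (indicator K x *\<^sub>R g x))"
    unfolding set_integrable_def by (intro Bochner_Integration.integrable_add integrable_scaleR_right)
  then show "set_integrable lebesgue K (\<lambda>x. a *\<^sub>R f x + b *\<^sub>R g x)"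
    unfolding set_integrable_def by (simp add: scaleR_add_right mult.commute)
qed

lemma has_weak_gradient_linear:
  assumes O: "open \<Omega>" and u: "has_weak_gradient \<Omega> u G" and v: "has_weak_gradient \<Omega> v H"
  shows "has_weak_gradient \<Omega> (\<lambda>x. a * u x + b * v x) (\<lambda>x. a *\<^sub>R G x + b *\<^sub>R H x)"
  unfolding has_weak_gradient_iff[OF O]
proof (intro conjI allI impI)
  note u' = has_weak_gradientD[OF O u] and v' = has_weak_gradientD[OF O v]
  show "loc_integrable \<Omega> (\<lambda>x. a * u x + b * v x)" using loc_integrable_linear[of \<Omega> u v a b] u' v' by simp
  show "loc_integrable \<Omega> (\<lambda>x. a *\<^sub>R G x + b *\<^sub>R H x)" using loc_integrable_linear[of \<Omega> G H a b] u' v' by simp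
  fix K \<psi> \<psi>' assume K: "C1_supported_in K \<psi> \<psi>' \<and> K \<subseteq> \<Omega>"
  then have si: "set_integrable lebesgue K u" "set_integrable lebesgue K v" "set_integrable lebesgue K G" "set_integrable lebesgue K H"
    using loc_integrableD[OF _ C1_supported_inD(2)] u'(1,2) v'(1,2) by blast+
  note i = integrable_test_pair(1)[OF conjunct1[OF K] si(1)] integrable_test_pair(1)[OF conjunct1[OF K] si(2)]
    integrable_test_pair(2)[OF conjunct1[OF K] si(3)] integrable_test_pair(2)[OF conjunct1[OF K] si(4)]
  have "(LINT x|lebesgue. (a * u x + b * v x) *\<^sub>R \<psi>' x) = (LINT x|lebesgue. a *\<^sub>R (u x *\<^sub>R \<psi>' x) + b *\<^sub>R (v x *\<^sub>R \<psi>' x))"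
    by (simp add: scaleR_add_left)
  also have "\<dots> = a *\<^sub>R (LINT x|lebesgue. u x *\<^sub>R \<psi>' x) + b *\<^sub>R (LINT x|lebesgue. v x *\<^sub>R \<psi>' x)"
    using i by (subst Bochner_Integration.integral_add) (simp_all only: integrable_scaleR_right integral_scaleR_right)
  also have "\<dots> = - (a *\<^sub>R (LINT x|lebesgue. \<psi> x *\<^sub>R G x) + b *\<^sub>R (LINT x|lebesgue. \<psi> x *\<^sub>R H x))"
    using u'(3)[of K \<psi> \<psi>'] v'(3)[of K \<psi> \<psi>'] K by simp
  also have "a *\<^sub>R (LINT x|lebesgue. \<psi> x *\<^sub>R G x) + b *\<^sub>R (LINT x|lebesgue. \<psi> x *\<^sub>R H x) =
      (LINT x|lebesgue. a *\<^sub>R (\<psi> x *\<^sub>R G x) + b *\<^sub>R (\<psi> x *\<^sub>R H x))"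
    using i by (subst Bochner_Integration.integral_add) (simp_all only: integrable_scaleR_right integral_scaleR_right)
  also have "\<dots> = (LINT x|lebesgue. \<psi> x *\<^sub>R (a *\<^sub>R G x + b *\<^sub>R H x))"
    by (simp add: scaleR_add_right mult.commute)
  finally show "(LINT x|lebesgue. (a * u x + b * v x) *\<^sub>R \<psi>' x) = - (LINT x|lebesgue. \<psi> x *\<^sub>R (a *\<^sub>R G x + b *\<^sub>R H x))" .
qed

lemma has_weak_gradient_diff:
  assumes "open \<Omega>" "has_weak_gradient \<Omega> u G" "has_weak_gradient \<Omega> v H"
  shows "has_weak_gradient \<Omega> (\<lambda>x. u x - v x) (\<lambda>x. G x - H x)"
  using has_weak_gradient_linear[OF assms, of 1 "-1"] by simp

lemma has_weak_gradient_add: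
  assumes "open \<Omega>" "has_weak_gradient \<Omega> u G" "has_weak_gradient \<Omega> v H"
  shows "has_weak_gradient \<Omega> (\<lambda>x. u x + v x) (\<lambda>x. G x + H x)"
  using has_weak_gradient_linear[OF assms, of 1 1] by simp

lemma has_weak_gradient_minus:
  assumes "open \<Omega>" "has_weak_gradient \<Omega> u G"
  shows "has_weak_gradient \<Omega> (\<lambda>x. - u x) (\<lambda>x. - G x)"
  using has_weak_gradient_linear[OF assms assms(2), of "-1" 0] by simp

lemma has_weak_gradient_subset:
  assumes "open \<Omega>" "open \<Omega>'" "\<Omega> \<subseteq> \<Omega>'" "has_weak_gradient \<Omega>' u G"
  shows "has_weak_gradient \<Omega> u G"
  using assms(3,4) unfolding has_weak_gradient_iff[OF assms(1)] has_weak_gradient_iff[OF assms(2)] loc_integrable_def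
  by (meson order_trans)

lemma has_weak_gradient_cong:
  assumes O: "open \<Omega>" and u: "has_weak_gradient \<Omega> u G"
    and m: "u' \<in> borel_measurable (lebesgue_on \<Omega>)" "G' \<in> borel_measurable (lebesgue_on \<Omega>)"
    and ae: "AE x in lebesgue_on \<Omega>. u' x = u x" "AE x in lebesgue_on \<Omega>. G' x = G x"
  shows "has_weak_gradient \<Omega> u' G'"
proof -
  have S: "\<Omega> \<in> sets lebesgue" using O by auto
  have ae': "AE x in lebesgue. x \<in> \<Omega> \<longrightarrow> u' x = u x" "AE x in lebesgue. x \<in> \<Omega> \<longrightarrow> G' x = G x"
    using ae S by (auto simp: AE_restrict_space_iff)
  have loc: "loc_integrable \<Omega> f'" if "loc_integrable \<Omega> f" "f' \<in> borel_measurable (lebesgue_on \<Omega>)" "AE x in lebesgue. x \<in> \<Omega> \<longrightarrow> f' x = f x"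
    for f f' :: "'a \<Rightarrow> 'c::euclidean_space"
    unfolding loc_integrable_def
  proof (intro allI impI)
    fix K assume K: "compact K \<and> K \<subseteq> \<Omega>"
    have Km: "K \<in> sets lebesgue" using lmeasurable_compact K by blast
    have "(\<lambda>x. if x \<in> \<Omega> then f' x else 0) \<in> borel_measurable lebesgue" using that(2) S by (simp add: borel_measurable_if)
    then have "(\<lambda>x. indicator K x *\<^sub>R (if x \<in> \<Omega> then f' x else 0)) \<in> borel_measurable lebesgue"
      using Km by (intro borel_measurable_scaleR borel_measurable_indicator)
    moreover have "(\<lambda>x. indicator K x *\<^sub>R (if x \<in> \<Omega> then f' x else 0)) = (\<lambda>x. indicator K x *\<^sub>R f' x)"
      using K by (auto simp: indicator_def fun_eq_iff)
    ultimately have f'm: "(\<lambda>x. indicator K x *\<^sub>R f' x) \<in> borel_measurable lebesgue" by simp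
    have fi: "integrable lebesgue (\<lambda>x. indicator K x *\<^sub>R f x)" using that(1) K by (auto simp: loc_integrable_def set_integrable_def)
    have "AE x in lebesgue. indicator K x *\<^sub>R f x = indicator K x *\<^sub>R f' x"
      using that(3) by eventually_elim (use K in \<open>auto simp: indicator_def\<close>)
    with fi f'm show "set_integrable lebesgue K f'"
      unfolding set_integrable_def using integrable_cong_AE[of "\<lambda>x. indicator K x *\<^sub>R f x" lebesgue "\<lambda>x. indicator K x *\<^sub>R f' x"] by auto
  qed
  note u1 = has_weak_gradientD[OF O u]
  have li: "loc_integrable \<Omega> u'" "loc_integrable \<Omega> G'" using loc[OF u1(1) m(1) ae'(1)] loc[OF u1(2) m(2) ae'(2)] by auto
  show ?thesis
    unfolding has_weak_gradient_iff[OF O]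
  proof (intro conjI li allI impI)
    fix K \<psi> \<psi>' assume K: "C1_supported_in K \<psi> \<psi>' \<and> K \<subseteq> \<Omega>"
    note s = C1_supported_inD[OF conjunct1[OF K]]
    have si: "set_integrable lebesgue K u" "set_integrable lebesgue K G" "set_integrable lebesgue K u'" "set_integrable lebesgue K G'"
      using loc_integrableD[OF _ s(2)] u1(1,2) li K by blast+
    note i = integrable_test_pair(1)[OF conjunct1[OF K] si(1)] integrable_test_pair(2)[OF conjunct1[OF K] si(2)]
      integrable_test_pair(1)[OF conjunct1[OF K] si(3)] integrable_test_pair(2)[OF conjunct1[OF K] si(4)]
    have "(LINT x|lebesgue. u' x *\<^sub>R \<psi>' x) = (LINT x|lebesgue. u x *\<^sub>R \<psi>' x)"
    proof (rule integral_cong_AE)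
      show "AE x in lebesgue. u' x *\<^sub>R \<psi>' x = u x *\<^sub>R \<psi>' x"
        using ae'(1) by eventually_elim (use K s(4) in \<open>metis scaleR_zero_right subsetD\<close>)
    qed (use i in auto)
    moreover have "(LINT x|lebesgue. \<psi> x *\<^sub>R G' x) = (LINT x|lebesgue. \<psi> x *\<^sub>R G x)"
    proof (rule integral_cong_AE)
      show "AE x in lebesgue. \<psi> x *\<^sub>R G' x = \<psi> x *\<^sub>R G x"
        using ae'(2) by eventually_elim (use K s(3) in \<open>metis scaleR_zero_left subsetD\<close>)
    qed (use i in auto)
    ultimately show "(LINT x|lebesgue. u' x *\<^sub>R \<psi>' x) = - (LINT x|lebesgue. \<psi> x *\<^sub>R G' x)" using u1(3)[of K \<psi> \<psi>'] K by auto
  qed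
qed

section \<open>Classical gradients as weak gradients, and mollified weak gradients\<close>

lemma loc_integrable_continuous:
  assumes "continuous_on UNIV f" shows "loc_integrable \<Omega> f"
  unfolding loc_integrable_def set_integrable_def
proof (intro allI impI)
  fix K assume K: "compact K \<and> K \<subseteq> \<Omega>"
  then have "integrable lborel (\<lambda>x. indicator K x *\<^sub>R f x)"
    using assms by (intro borel_integrable_compact) (auto intro: continuous_on_subset)
  then show "integrable lebesgue (\<lambda>x. indicator K x *\<^sub>R f x)"
    by (subst integrable_completion) auto
qed

lemma C1_grad_has_weak_gradient:
  assumes "open \<Omega>" "C1_grad f f'" shows "has_weak_gradient \<Omega> f f'"
  unfolding has_weak_gradient_iff[OF assms(1)]
  using loc_integrable_continuous[OF C1_grad_continuous(1)[OF assms(2)]] loc_integrable_continuous[OF C1_grad_continuous(2)[OF assms(2)]]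
  by (auto simp: C1_supported_in_def intro!: C1_integration_by_parts[OF assms(2)])

text \<open>The function \<open>y \<mapsto> bump e (x - y)\<close> is itself a test function,
  because it vanishes off the ball around \<open>x\<close> contained in \<open>K\<close>. The minus
  sign of integration by parts cancels the one from differentiating in \<open>y\<close>. Up to the
  normalising factor, mollification thus commutes with the gradient.\<close>

lemma weak_gradient_mollify_eq:
  assumes O: "open \<Omega>" and u: "has_weak_gradient \<Omega> u G" and K: "compact K" "K \<subseteq> \<Omega>"
    and U: "U \<in> borel_measurable borel" "AE y in lebesgue. indicator K y *\<^sub>R u y = U y"
    and H: "H \<in> borel_measurable borel" "AE y in lebesgue. indicator K y *\<^sub>R G y = H y"
    and e: "0 < e" "e \<le> 1" and x: "cball x e \<subseteq> K"
  shows "(LINT y|lborel. U y *\<^sub>R bump_grad e (x - y)) = (LINT y|lborel. bump e (x - y) *\<^sub>R H y)"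
proof -
  let ?\<psi> = "\<lambda>y. bump e (x - y)" and ?\<psi>' = "\<lambda>y. - bump_grad e (x - y)"
  have z: "?\<psi> y = 0" "bump_grad e (x - y) = 0" if "y \<notin> K" for y
  proof -
    have "y \<notin> cball x e" using that x by blast
    then have "e \<le> norm (x - y)" by (simp add: dist_norm)
    then show "?\<psi> y = 0" "bump_grad e (x - y) = 0" using e bump_eq_0[of e "x - y"] bump_grad_eq_0[of e "x - y"] by auto
  qed
  have s: "C1_supported_in K ?\<psi> ?\<psi>'"
    unfolding C1_supported_in_def C1_grad_def
  proof (intro conjI allI impI K(1))
    show "continuous_on UNIV ?\<psi>'" by (intro continuous_intros)
    show "GDERIV ?\<psi> y :> ?\<psi>' y" for y
      unfolding gderiv_def
    proof (rule has_derivative_eq_rhs)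
      have b: "(bump e has_derivative (\<lambda>h. h \<bullet> bump_grad e (x - y))) (at (x - y))"
        using GDERIV_bump[of e "x - y"] e by (simp add: gderiv_def)
      show "(?\<psi> has_derivative (\<lambda>h. (- h) \<bullet> bump_grad e (x - y))) (at y)"
        by (rule has_derivative_compose[where f = "\<lambda>y. x - y" and g = "bump e" and f' = "\<lambda>h. - h", OF _ b])
           (auto intro!: derivative_eq_intros)
    qed auto
  qed (use z in auto)
  have "(LINT y|lebesgue. u y *\<^sub>R ?\<psi>' y) = - (LINT y|lebesgue. ?\<psi> y *\<^sub>R G y)"
    by (rule has_weak_gradientD(3)[OF O u s K(2)])
  then have eq: "(LINT y|lebesgue. u y *\<^sub>R bump_grad e (x - y)) = (LINT y|lebesgue. ?\<psi> y *\<^sub>R G y)" by simp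
  have si: "set_integrable lebesgue K u" "set_integrable lebesgue K G"
    using has_weak_gradientD(1,2)[OF O u] loc_integrableD K by blast+
  note i = integrable_test_pair(1)[OF s si(1)] integrable_test_pair(2)[OF s si(2)]
  have m: "(\<lambda>y. U y *\<^sub>R bump_grad e (x - y)) \<in> borel_measurable borel" "(\<lambda>y. bump e (x - y) *\<^sub>R H y) \<in> borel_measurable borel"
    using U(1) H(1) by measurable
  have "(LINT y|lebesgue. u y *\<^sub>R bump_grad e (x - y)) = (LINT y|lebesgue. U y *\<^sub>R bump_grad e (x - y))"
  proof (rule integral_cong_AE)
    show "AE y in lebesgue. u y *\<^sub>R bump_grad e (x - y) = U y *\<^sub>R bump_grad e (x - y)"
      using U(2)
    proof eventually_elim
      case (elim y) then show ?case using z(2)[of y] by (cases "y \<in> K") simp_all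
    qed
    show "(\<lambda>y. u y *\<^sub>R bump_grad e (x - y)) \<in> borel_measurable lebesgue" using borel_measurable_uminus[OF borel_measurable_integrable[OF i(1)]] by simp
    show "(\<lambda>y. U y *\<^sub>R bump_grad e (x - y)) \<in> borel_measurable lebesgue" by (rule borel_imp_lebesgue[OF m(1)])
  qed
  moreover have "(LINT y|lebesgue. ?\<psi> y *\<^sub>R G y) = (LINT y|lebesgue. ?\<psi> y *\<^sub>R H y)"
  proof (rule integral_cong_AE)
    show "AE y in lebesgue. ?\<psi> y *\<^sub>R G y = ?\<psi> y *\<^sub>R H y"
      using H(2)
    proof eventually_elim
      case (elim y) then show ?case using z(1)[of y] by (cases "y \<in> K") simp_all
    qed
    show "(\<lambda>y. ?\<psi> y *\<^sub>R H y) \<in> borel_measurable lebesgue" by (rule borel_imp_lebesgue[OF m(2)])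
    show "(\<lambda>y. ?\<psi> y *\<^sub>R G y) \<in> borel_measurable lebesgue" by (rule borel_measurable_integrable[OF i(2)])
  qed
  ultimately show ?thesis using eq m by (simp add: integral_completion)
qed

text \<open>One radius serves both the function and its gradient. The identity for \<open>W\<close>
  is restricted to points whose \<open>e\<close>-ball lies in \<open>K\<close>: \<open>U\<close> and
  \<open>H\<close> are cut off to zero outside \<open>K\<close>, and \<open>H\<close> does not
  record a jump of \<open>U\<close> at the boundary of \<open>K\<close>.\<close>

lemma weak_gradient_mollify:
  fixes u :: "'a::euclidean_space \<Rightarrow> real"
  assumes O: "open \<Omega>" and u: "has_weak_gradient \<Omega> u G" and K: "compact K" "K \<subseteq> \<Omega>"
    and U: "U \<in> borel_measurable borel" "AE y in lebesgue. indicator K y *\<^sub>R u y = U y"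
    and H: "H \<in> borel_measurable borel" "AE y in lebesgue. indicator K y *\<^sub>R G y = H y"
    and q: "1 \<le> q" "integrable lborel (\<lambda>y. norm (U y) powr q)" "integrable lborel (\<lambda>y. norm (H y) powr q)"
    and \<epsilon>: "0 < \<epsilon>" and r: "0 < r"
  obtains e W where "0 < e" "e \<le> r" "C1_grad (mollify e U) W" "\<And>x. cball x e \<subseteq> K \<Longrightarrow> W x = mollify e H x"
    "Lp_mass q lborel (\<lambda>x. mollify e U x - U x) \<le> ennreal \<epsilon>"
    "Lp_mass q lborel (\<lambda>x. mollify e H x - H x) \<le> ennreal \<epsilon>"
proof -
  have rep: "integrable lborel F'" if "set_integrable lebesgue K F" "AE y in lebesgue. indicator K y *\<^sub>R F y = F' y" "F' \<in> borel_measurable borel"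
    for F F' :: "'a \<Rightarrow> 'c::euclidean_space"
  proof -
    have "integrable lebesgue F'"
      using that(1) integrable_cong_AE[OF _ borel_imp_lebesgue[OF that(3)] that(2)] borel_measurable_integrable
      unfolding set_integrable_def by blast
    then show ?thesis using that(3) by (simp add: integrable_completion)
  qed
  have si: "set_integrable lebesgue K u" "set_integrable lebesgue K G"
    using has_weak_gradientD(1,2)[OF O u] loc_integrableD K by blast+
  have UH: "integrable lborel U" "integrable lborel H" using rep[OF si(1) U(2,1)] rep[OF si(2) H(2,1)] by auto
  obtain d1 where d1: "0 < d1" "\<And>e. 0 < e \<Longrightarrow> e < d1 \<Longrightarrow> Lp_mass q lborel (\<lambda>x. mollify e U x - U x) \<le> ennreal \<epsilon>"
    using mollify_Lp_tendsto[OF UH(1) q(2,1) \<epsilon>] by blast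
  obtain d2 where d2: "0 < d2" "\<And>e. 0 < e \<Longrightarrow> e < d2 \<Longrightarrow> Lp_mass q lborel (\<lambda>x. mollify e H x - H x) \<le> ennreal \<epsilon>"
    using mollify_Lp_tendsto[OF UH(2) q(3,1) \<epsilon>] by blast
  \<comment> \<open>Half of the smaller threshold, because both estimates ask for a radius strictly
    below \<open>d1\<close> and \<open>d2\<close>.\<close>
  define e where "e = min (min 1 r) (min d1 d2 / 2)"
  have e: "0 < e" "e \<le> 1" "e \<le> r" "e < d1" "e < d2" using r d1(1) d2(1) by (auto simp: e_def min_def)
  obtain W where W: "continuous_on UNIV W" "\<And>x. GDERIV (mollify e U) x :> W x"
    "\<And>x. W x = inverse (LINT y|(lborel::'a measure). bump e y) *\<^sub>R (LINT y|lborel. U y *\<^sub>R bump_grad e (x - y))"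
    using GDERIV_mollify[OF UH(1) e(1,2)] by blast
  show ?thesis
  proof (rule that[OF e(1,3)])
    show "C1_grad (mollify e U) W" using W by (simp add: C1_grad_def)
    show "W x = mollify e H x" if "cball x e \<subseteq> K" for x
      unfolding W(3) mollify_def using weak_gradient_mollify_eq[OF O u K U H e(1,2) that] by simp
  qed (use d1 d2 e in auto)
qed

lemma compact_cball_nbhd:
  fixes K :: "'a::euclidean_space set"
  assumes "compact K" "open \<Omega>" "K \<subseteq> \<Omega>"
  obtains r where "0 < r" "compact (\<Union>x\<in>K. cball x r)" "(\<Union>x\<in>K. cball x r) \<subseteq> \<Omega>"
proof -
  obtain r where "0 < r" "(\<Union>x\<in>K. cball x r) \<subseteq> \<Omega>"
    using compact_subset_open_imp_cball_epsilon_subset[OF assms] by blast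
  then show ?thesis using that compact_UN_cball[OF assms(1)] by blast
qed

lemma borel_representative:
  fixes f :: "'a::euclidean_space \<Rightarrow> 'b::euclidean_space"
  assumes "set_integrable lebesgue K f"
  obtains f' where "f' \<in> borel_measurable borel" "AE x in lebesgue. indicator K x *\<^sub>R f x = f' x"
  using lebesgue_ex_borel[OF borel_measurable_integrable[OF assms[unfolded set_integrable_def]]] by blast

lemma representative_integrable_powr:
  fixes f f' :: "'a::euclidean_space \<Rightarrow> 'b::euclidean_space"
  assumes f: "set_integrable lebesgue K (\<lambda>x. norm (f x) powr q)"
    and f': "f' \<in> borel_measurable borel" "AE x in lebesgue. indicator K x *\<^sub>R f x = f' x"
  shows "integrable lborel (\<lambda>x. norm (f' x) powr q)"
proof -
  have m: "(\<lambda>x. norm (f' x) powr q) \<in> borel_measurable borel" using f'(1) by measurable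
  have i: "integrable lebesgue (\<lambda>x. indicator K x *\<^sub>R norm (f x) powr q)" using f by (simp add: set_integrable_def)
  have "AE x in lebesgue. indicator K x *\<^sub>R norm (f x) powr q = norm (f' x) powr q"
    using f'(2)
  proof eventually_elim
    case (elim x) then show ?case by (cases "x \<in> K") auto
  qed
  from integrable_cong_AE[OF borel_measurable_integrable[OF i] borel_imp_lebesgue[OF m] this] i
  have "integrable lebesgue (\<lambda>x. norm (f' x) powr q)" by simp
  then show ?thesis using m by (subst (asm) integrable_completion) auto
qed

lemma set_integrable_norm_powr_1:
  fixes f :: "'a::euclidean_space \<Rightarrow> 'b::euclidean_space"
  assumes "set_integrable lebesgue K f" shows "set_integrable lebesgue K (\<lambda>x. norm (f x) powr 1)"
proof -
  have "integrable lebesgue (\<lambda>x. norm (indicator K x *\<^sub>R f x))" using assms unfolding set_integrable_def by (rule integrable_norm)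
  then show ?thesis by (simp add: set_integrable_def)
qed

lemma nn_integral_lebesgue_on_le:
  assumes S: "S \<in> sets lebesgue" and le: "AE x in lebesgue. x \<in> S \<longrightarrow> f x \<le> g x"
  shows "(\<integral>\<^sup>+x. f x \<partial>lebesgue_on S) \<le> (\<integral>\<^sup>+x. g x \<partial>lborel)"
proof -
  have "(\<integral>\<^sup>+x. f x \<partial>lebesgue_on S) = (\<integral>\<^sup>+x. f x * indicator S x \<partial>lebesgue)"
    using S by (intro nn_integral_restrict_space) auto
  also have "\<dots> \<le> (\<integral>\<^sup>+x. g x \<partial>lebesgue)"
  proof (rule nn_integral_mono_AE)
    show "AE x in lebesgue. f x * indicator S x \<le> g x"
      using le
    proof eventually_elim
      case (elim x) then show ?case by (cases "x \<in> S") auto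
    qed
  qed
  also have "\<dots> = (\<integral>\<^sup>+x. g x \<partial>lborel)" by (rule nn_integral_completion)
  finally show ?thesis .
qed

section \<open>Uniqueness of the weak gradient\<close>

lemma mollify_zero: "mollify e (\<lambda>x. 0) = (\<lambda>x. 0)"
  by (rule ext) (simp add: mollify_def)

text \<open>The mollified zero function is zero, and on \<open>K\<close> its gradient is the
  mollified representative \<open>H\<close> of \<open>G\<close>. As the mollified \<open>H\<close>
  is also close to \<open>H\<close> in \<open>L^1\<close>, the mass of \<open>H\<close> on
  \<open>K\<close> is below every \<epsilon>. The larger compact set \<open>?K\<close> leaves room
  for the balls.\<close>

lemma has_weak_gradient_zero:
  assumes O: "open \<Omega>" and u: "has_weak_gradient \<Omega> u G" and z: "AE x in lebesgue_on \<Omega>. u x = 0"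
  shows "AE x in lebesgue_on \<Omega>. G x = 0"
proof -
  have S: "\<Omega> \<in> sets lebesgue" using O by auto
  have z': "AE x in lebesgue. x \<in> \<Omega> \<longrightarrow> u x = 0" using z S by (auto simp: AE_restrict_space_iff)
  have K0: "AE x in lebesgue. x \<in> K \<longrightarrow> G x = 0" if K: "compact K" "K \<subseteq> \<Omega>" for K
  proof -
    obtain r where r: "0 < r" "compact (\<Union>x\<in>K. cball x r)" "(\<Union>x\<in>K. cball x r) \<subseteq> \<Omega>" using compact_cball_nbhd[OF K(1) O K(2)] .
    let ?K = "\<Union>x\<in>K. cball x r"
    have si: "set_integrable lebesgue ?K G" using has_weak_gradientD(2)[OF O u] loc_integrableD r by blast
    obtain H where H: "H \<in> borel_measurable borel" "AE x in lebesgue. indicator ?K x *\<^sub>R G x = H x" using borel_representative[OF si] .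
    have U: "AE x in lebesgue. indicator ?K x *\<^sub>R u x = 0"
      using z'
    proof eventually_elim
      case (elim x)
      show ?case
      proof (cases "x \<in> ?K")
        case True
        with r(3) have "x \<in> \<Omega>" by (rule subsetD)
        with elim show ?thesis by simp
      qed simp
    qed
    have Km: "K \<in> sets lebesgue" using lmeasurable_compact K(1) by blast
    have "Lp_mass 1 (lebesgue_on K) H \<le> 0 + ennreal \<epsilon>" if "0 < \<epsilon>" for \<epsilon>
    proof -
      obtain e W where e: "0 < e" "e \<le> r" "C1_grad (mollify e (\<lambda>x. 0::real)) W" "\<And>x. cball x e \<subseteq> ?K \<Longrightarrow> W x = mollify e H x"
        "Lp_mass 1 lborel (\<lambda>x. mollify e H x - H x) \<le> ennreal \<epsilon>"
      proof (rule weak_gradient_mollify[OF O u r(2,3) _ U H _ _ representative_integrable_powr[OF set_integrable_norm_powr_1[OF si] H] \<open>0 < \<epsilon>\<close> r(1)])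
      qed (auto intro: that)
      have "mollify e H x = 0" if "x \<in> K" for x
      proof -
        have "W x = 0"
          by (rule GDERIV_unique[OF _ GDERIV_const[of "0::real" x]]) (use e(3) in \<open>simp add: C1_grad_def mollify_zero\<close>)
        moreover have "cball x e \<subseteq> ?K" using that e(2) by (force simp: subset_iff)
        ultimately show ?thesis using e(4) by simp
      qed
      then have "Lp_mass 1 (lebesgue_on K) H \<le> Lp_mass 1 lborel (\<lambda>x. mollify e H x - H x)"
        by (intro nn_integral_lebesgue_on_le[OF Km]) auto
      then show ?thesis using e(5) by simp
    qed
    then have "Lp_mass 1 (lebesgue_on K) H \<le> 0" by (rule ennreal_le_epsilon)
    then have "Lp_mass 1 (lebesgue_on K) H = 0" by simp
    moreover have "(\<lambda>x. ennreal (norm (H x) powr 1)) \<in> borel_measurable (lebesgue_on K)"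
      using borel_imp_lebesgue[OF H(1)] by (intro measurable_restrict_space1) measurable
    ultimately have "AE x in lebesgue_on K. H x = 0"
      by (subst (asm) nn_integral_0_iff_AE) auto
    then have "AE x in lebesgue. x \<in> K \<longrightarrow> H x = 0" using Km by (auto simp: AE_restrict_space_iff)
    with H(2) show ?thesis
    proof eventually_elim
      case (elim x)
      show ?case
      proof
        assume "x \<in> K"
        moreover from this have "x \<in> ?K" using r(1) by force
        ultimately show "G x = 0" using elim by simp
      qed
    qed
  qed
  \<comment> \<open>Countably many compact sets exhaust \<Omega>, so the exceptional null sets can
    be united.\<close>
  obtain C :: "nat \<Rightarrow> 'a set" where C: "\<And>n. compact (C n)" "\<And>n. C n \<subseteq> \<Omega>" "\<Union>(range C) = \<Omega>"
    using open_Union_compact_subsets[OF O] by metis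
  have "AE x in lebesgue. \<forall>n. x \<in> C n \<longrightarrow> G x = 0" using K0 C by (subst AE_all_countable) auto
  then have "AE x in lebesgue. x \<in> \<Omega> \<longrightarrow> G x = 0"
    by eventually_elim (use C(3) in blast)
  then show ?thesis using S by (auto simp: AE_restrict_space_iff)
qed

lemma has_weak_gradient_unique:
  assumes "open \<Omega>" "has_weak_gradient \<Omega> u G" "has_weak_gradient \<Omega> u' G'" "AE x in lebesgue_on \<Omega>. u x = u' x"
  shows "AE x in lebesgue_on \<Omega>. G x = G' x"
proof -
  have "AE x in lebesgue_on \<Omega>. u x - u' x = 0" using assms(4) by eventually_elim simp
  from has_weak_gradient_zero[OF assms(1) has_weak_gradient_diff[OF assms(1-3)] this] show ?thesis by simp
qed

lemma loc_integrable_measurable: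
  fixes f :: "'a::euclidean_space \<Rightarrow> 'b::euclidean_space"
  assumes O: "open \<Omega>" and f: "loc_integrable \<Omega> f"
  shows "f \<in> borel_measurable (lebesgue_on \<Omega>)"
proof -
  obtain C :: "nat \<Rightarrow> 'a set" where C: "\<And>n. compact (C n)" "\<And>n. C n \<subseteq> \<Omega>" "\<And>n. C n \<subseteq> interior (C (Suc n))" "\<Union>(range C) = \<Omega>"
    using open_Union_compact_subsets[OF O] by metis
  have mono: "C m \<subseteq> C n" if "m \<le> n" for m n
    by (rule lift_Suc_mono_le[of C, OF _ that]) (use C(3) interior_subset in blast)
  show ?thesis
  proof (rule borel_measurable_LIMSEQ_metric)
    fix n
    have "(\<lambda>x. indicator (C n) x *\<^sub>R f x) \<in> borel_measurable lebesgue"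
      using loc_integrableD[OF f C(1,2)[of n]] unfolding set_integrable_def by (rule borel_measurable_integrable)
    then show "(\<lambda>x. indicator (C n) x *\<^sub>R f x) \<in> borel_measurable (lebesgue_on \<Omega>)" by (rule measurable_restrict_space1)
  next
    fix x assume "x \<in> space (lebesgue_on \<Omega>)"
    then obtain m where "x \<in> C m" using C(4) by auto
    then have "eventually (\<lambda>n. indicator (C n) x *\<^sub>R f x = f x) sequentially"
      unfolding eventually_sequentially by (intro exI[of _ m]) (use mono in \<open>auto simp: indicator_def\<close>)
    then show "(\<lambda>n. indicator (C n) x *\<^sub>R f x) \<longlonglongrightarrow> f x" by (rule tendsto_eventually)
  qed
qed

section \<open>Local \<open>C^1\<close> approximation and closedness of the weak gradient\<close>

lemma set_integrable_iff_lebesgue_on: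
  fixes f :: "'a::euclidean_space \<Rightarrow> 'b::euclidean_space"
  assumes "compact K" shows "set_integrable lebesgue K f \<longleftrightarrow> integrable (lebesgue_on K) f"
proof -
  have "K \<in> sets lebesgue" using lmeasurable_compact assms by blast
  then show ?thesis unfolding set_integrable_def by (subst integrable_restrict_space) auto
qed

text \<open>The approximation is made on one compact set at a time: the neighbourhood
  \<open>?K\<close> supplies the balls for the gradient identity on \<open>K\<close>, and nothing is
  claimed near the boundary of \<Omega>. The exponent is 1 because a weak gradient is only locally
  integrable by definition.\<close>

lemma weak_gradient_C1_approx:
  fixes u :: "'a::euclidean_space \<Rightarrow> real"
  assumes O: "open \<Omega>" and u: "has_weak_gradient \<Omega> u G" and K: "compact K" "K \<subseteq> \<Omega>"
  obtains v W where "\<And>n::nat. C1_grad (v n) (W n)" "Lp_lim 1 (lebesgue_on K) v u" "Lp_lim 1 (lebesgue_on K) W G"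
proof -
  obtain r where r: "0 < r" "compact (\<Union>x\<in>K. cball x r)" "(\<Union>x\<in>K. cball x r) \<subseteq> \<Omega>" using compact_cball_nbhd[OF K(1) O K(2)] .
  let ?K = "\<Union>x\<in>K. cball x r"
  have si: "set_integrable lebesgue ?K u" "set_integrable lebesgue ?K G" using has_weak_gradientD(1,2)[OF O u] loc_integrableD r by blast+
  obtain U where U: "U \<in> borel_measurable borel" "AE x in lebesgue. indicator ?K x *\<^sub>R u x = U x" using borel_representative[OF si(1)] .
  obtain H where H: "H \<in> borel_measurable borel" "AE x in lebesgue. indicator ?K x *\<^sub>R G x = H x" using borel_representative[OF si(2)] .
  have Km: "K \<in> sets lebesgue" using lmeasurable_compact K(1) by blast
  have KK: "x \<in> ?K" if "x \<in> K" for x using that r(1) by force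
  define P where "P n v W \<longleftrightarrow> C1_grad v W \<and> Lp_mass 1 (lebesgue_on K) (\<lambda>x. v x - u x) \<le> ennreal (inverse (real (Suc n)))
    \<and> Lp_mass 1 (lebesgue_on K) (\<lambda>x. W x - G x) \<le> ennreal (inverse (real (Suc n)))" for n v W
  have "\<exists>v W. P n v W" for n
  proof -
    have p: "0 < inverse (real (Suc n))" by simp
    obtain e W where e: "0 < e" "e \<le> r" "C1_grad (mollify e U) W" "\<And>x. cball x e \<subseteq> ?K \<Longrightarrow> W x = mollify e H x"
      "Lp_mass 1 lborel (\<lambda>x. mollify e U x - U x) \<le> ennreal (inverse (real (Suc n)))"
      "Lp_mass 1 lborel (\<lambda>x. mollify e H x - H x) \<le> ennreal (inverse (real (Suc n)))"
      by (rule weak_gradient_mollify[OF O u r(2,3) U H order_refl representative_integrable_powr[OF set_integrable_norm_powr_1[OF si(1)] U]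
          representative_integrable_powr[OF set_integrable_norm_powr_1[OF si(2)] H] p r(1)]) (rule that)
    have We: "W x = mollify e H x" if "x \<in> K" for x
    proof -
      have "cball x e \<subseteq> ?K" using that e(2) by (force simp: subset_iff)
      then show ?thesis using e(4) by simp
    qed
    have "Lp_mass 1 (lebesgue_on K) (\<lambda>x. mollify e U x - u x) \<le> Lp_mass 1 lborel (\<lambda>x. mollify e U x - U x)"
    proof (rule nn_integral_lebesgue_on_le[OF Km])
      show "AE x in lebesgue. x \<in> K \<longrightarrow> ennreal (norm (mollify e U x - u x) powr 1) \<le> ennreal (norm (mollify e U x - U x) powr 1)"
        using U(2) by eventually_elim (use KK in auto)
    qed
    moreover have "Lp_mass 1 (lebesgue_on K) (\<lambda>x. W x - G x) \<le> Lp_mass 1 lborel (\<lambda>x. mollify e H x - H x)"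
    proof (rule nn_integral_lebesgue_on_le[OF Km])
      show "AE x in lebesgue. x \<in> K \<longrightarrow> ennreal (norm (W x - G x) powr 1) \<le> ennreal (norm (mollify e H x - H x) powr 1)"
        using H(2) by eventually_elim (use KK We in auto)
    qed
    ultimately show ?thesis unfolding P_def
      using e(3) order_trans[OF _ e(5)] order_trans[OF _ e(6)] by (intro exI[of _ "mollify e U"] exI[of _ W] conjI)
  qed
  then obtain v W where "\<And>n. P n (v n) (W n)" by metis
  then have vW: "\<And>n. C1_grad (v n) (W n)"
    "\<And>n. Lp_mass 1 (lebesgue_on K) (\<lambda>x. v n x - u x) \<le> ennreal (inverse (real (Suc n)))"
    "\<And>n. Lp_mass 1 (lebesgue_on K) (\<lambda>x. W n x - G x) \<le> ennreal (inverse (real (Suc n)))" unfolding P_def by blast+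
  have lim: "(\<lambda>n. ennreal (inverse (real (Suc n)))) \<longlonglongrightarrow> 0"
    using tendsto_ennrealI[OF LIMSEQ_inverse_real_of_nat] by simp
  show ?thesis
    by (rule that[OF vW(1) Lp_lim_le[OF lim vW(2)] Lp_lim_le[OF lim vW(3)]])
qed

lemma measurable_lebesgue_on_subset:
  assumes "f \<in> borel_measurable (lebesgue_on \<Omega>)" "K \<subseteq> \<Omega>"
  shows "f \<in> borel_measurable (lebesgue_on K)"
  by (rule measurable_restrict_mono[OF assms])

text \<open>A test function sees only its support, so the approximating sequence may depend on that
  compact set. Both sides of the integration by parts identity are continuous under
  \<open>L^1\<close> convergence there, as test functions and their gradients are bounded.\<close>

lemma has_weak_gradientI_approx:
  assumes O: "open \<Omega>" and li: "loc_integrable \<Omega> u" "loc_integrable \<Omega> G"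
    and approx: "\<And>K. compact K \<Longrightarrow> K \<subseteq> \<Omega> \<Longrightarrow> \<exists>v W. (\<forall>n::nat. has_weak_gradient \<Omega> (v n) (W n)) \<and>
      Lp_lim 1 (lebesgue_on K) v u \<and> Lp_lim 1 (lebesgue_on K) W G"
  shows "has_weak_gradient \<Omega> u G"
  unfolding has_weak_gradient_iff[OF O]
proof (intro conjI li allI impI)
  fix K \<psi> \<psi>' assume "C1_supported_in K \<psi> \<psi>' \<and> K \<subseteq> \<Omega>"
  then have K: "C1_supported_in K \<psi> \<psi>'" "K \<subseteq> \<Omega>" by auto
  note s = C1_supported_inD[OF K(1)]
  have Km: "K \<in> sets lebesgue" using lmeasurable_compact s(2) by blast
  have m\<psi>: "\<psi> \<in> borel_measurable (lebesgue_on K)" "\<psi>' \<in> borel_measurable (lebesgue_on K)" using s(5,6) by (auto intro: measurable_restrict_space1)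
  obtain B where B: "0 \<le> B" "\<And>x. \<bar>\<psi> x\<bar> \<le> B" "\<And>x. norm (\<psi>' x) \<le> B" using s(7) by blast
  obtain v W where vW: "\<And>n::nat. has_weak_gradient \<Omega> (v n) (W n)"
    and lim: "Lp_lim 1 (lebesgue_on K) v u" "Lp_lim 1 (lebesgue_on K) W G" using approx[OF s(2) K(2)] by blast
  have meas: "f \<in> borel_measurable (lebesgue_on K)" if "loc_integrable \<Omega> f" for f :: "'a \<Rightarrow> 'c::euclidean_space"
    by (rule measurable_lebesgue_on_subset[OF loc_integrable_measurable[OF O that] K(2)])
  note vm = meas[OF has_weak_gradientD(1)[OF O vW]] and Wm = meas[OF has_weak_gradientD(2)[OF O vW]]
    and um = meas[OF li(1)] and Gm = meas[OF li(2)]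
  note si = loc_integrableD[OF li(1) s(2) K(2)] loc_integrableD[OF li(2) s(2) K(2)]
  note sin = loc_integrableD[OF has_weak_gradientD(1)[OF O vW] s(2) K(2)] loc_integrableD[OF has_weak_gradientD(2)[OF O vW] s(2) K(2)]
  note i = integrable_test_pair(1)[OF K(1) si(1)] integrable_test_pair(2)[OF K(1) si(2)]
  note iN = integrable_test_pair(1)[OF K(1) sin(1)] integrable_test_pair(2)[OF K(1) sin(2)]
  have r: "integrable (lebesgue_on K) (\<lambda>x. f x *\<^sub>R \<psi>' x) \<longleftrightarrow> integrable lebesgue (\<lambda>x. f x *\<^sub>R \<psi>' x)"
    "(LINT x|lebesgue_on K. f x *\<^sub>R \<psi>' x) = (LINT x|lebesgue. f x *\<^sub>R \<psi>' x)" for f :: "'a \<Rightarrow> real"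
    using supported_lebesgue_on[OF Km, of "\<lambda>x. f x *\<^sub>R \<psi>' x"] s(4) by auto
  have r': "integrable (lebesgue_on K) (\<lambda>x. \<psi> x *\<^sub>R g x) \<longleftrightarrow> integrable lebesgue (\<lambda>x. \<psi> x *\<^sub>R g x)"
    "(LINT x|lebesgue_on K. \<psi> x *\<^sub>R g x) = (LINT x|lebesgue. \<psi> x *\<^sub>R g x)" for g :: "'a \<Rightarrow> 'a"
    using supported_lebesgue_on[OF Km, of "\<lambda>x. \<psi> x *\<^sub>R g x"] s(3) by auto
  have "(\<lambda>n. LINT x|lebesgue_on K. v n x *\<^sub>R \<psi>' x) \<longlonglongrightarrow> (LINT x|lebesgue_on K. u x *\<^sub>R \<psi>' x)"
  proof (rule Lp_lim_1_integral)
    show "Lp_lim 1 (lebesgue_on K) (\<lambda>n x. v n x *\<^sub>R \<psi>' x) (\<lambda>x. u x *\<^sub>R \<psi>' x)"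
    proof (rule Lp_lim_comparison[OF lim(1) vm um B(1)])
      show "AE x in lebesgue_on K. norm (v n x *\<^sub>R \<psi>' x - u x *\<^sub>R \<psi>' x) \<le> B * norm (v n x - u x)" for n
      proof (rule AE_I2)
        fix x show "norm (v n x *\<^sub>R \<psi>' x - u x *\<^sub>R \<psi>' x) \<le> B * norm (v n x - u x)"
          using mult_right_mono[OF B(3)[of x], of "\<bar>v n x - u x\<bar>"] by (simp add: scaleR_diff_left[symmetric] mult.commute)
      qed
    qed simp
    show "integrable (lebesgue_on K) (\<lambda>x. v n x *\<^sub>R \<psi>' x)" for n unfolding r by (rule iN(1))
    show "integrable (lebesgue_on K) (\<lambda>x. u x *\<^sub>R \<psi>' x)" unfolding r by (rule i(1))
  qed
  moreover have "(\<lambda>n. LINT x|lebesgue_on K. \<psi> x *\<^sub>R W n x) \<longlonglongrightarrow> (LINT x|lebesgue_on K. \<psi> x *\<^sub>R G x)"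
  proof (rule Lp_lim_1_integral)
    show "Lp_lim 1 (lebesgue_on K) (\<lambda>n x. \<psi> x *\<^sub>R W n x) (\<lambda>x. \<psi> x *\<^sub>R G x)"
    proof (rule Lp_lim_comparison[OF lim(2) Wm Gm B(1)])
      show "AE x in lebesgue_on K. norm (\<psi> x *\<^sub>R W n x - \<psi> x *\<^sub>R G x) \<le> B * norm (W n x - G x)" for n
      proof (rule AE_I2)
        fix x show "norm (\<psi> x *\<^sub>R W n x - \<psi> x *\<^sub>R G x) \<le> B * norm (W n x - G x)"
          using mult_right_mono[OF B(2)[of x], of "norm (W n x - G x)"] by (simp add: scaleR_diff_right[symmetric])
      qed
    qed simp
    show "integrable (lebesgue_on K) (\<lambda>x. \<psi> x *\<^sub>R W n x)" for n unfolding r' by (rule iN(2))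
    show "integrable (lebesgue_on K) (\<lambda>x. \<psi> x *\<^sub>R G x)" unfolding r' by (rule i(2))
  qed
  moreover have "(LINT x|lebesgue_on K. v n x *\<^sub>R \<psi>' x) = - (LINT x|lebesgue_on K. \<psi> x *\<^sub>R W n x)" for n
    unfolding r r' by (rule has_weak_gradientD(3)[OF O vW K])
  ultimately have "(\<lambda>n. - (LINT x|lebesgue_on K. \<psi> x *\<^sub>R W n x)) \<longlonglongrightarrow> (LINT x|lebesgue_on K. u x *\<^sub>R \<psi>' x)"
    "(\<lambda>n. - (LINT x|lebesgue_on K. \<psi> x *\<^sub>R W n x)) \<longlonglongrightarrow> - (LINT x|lebesgue_on K. \<psi> x *\<^sub>R G x)"
    by (auto intro: tendsto_minus)
  then have "(LINT x|lebesgue_on K. u x *\<^sub>R \<psi>' x) = - (LINT x|lebesgue_on K. \<psi> x *\<^sub>R G x)" by (rule LIMSEQ_unique)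
  then show "(LINT x|lebesgue. u x *\<^sub>R \<psi>' x) = - (LINT x|lebesgue. \<psi> x *\<^sub>R G x)" unfolding r r' .
qed

lemma loc_integrable_bound:
  fixes f :: "'a::euclidean_space \<Rightarrow> 'b::euclidean_space" and g :: "'a \<Rightarrow> 'c::euclidean_space"
  assumes O: "open \<Omega>" and g: "loc_integrable \<Omega> g" and m: "f \<in> borel_measurable (lebesgue_on \<Omega>)"
    and le: "\<And>x. norm (f x) \<le> A + B * norm (g x)"
  shows "loc_integrable \<Omega> f"
  unfolding loc_integrable_def
proof (intro allI impI)
  fix K assume K: "compact K \<and> K \<subseteq> \<Omega>"
  interpret finite_measure "lebesgue_on K" using K lmeasurable_compact by (intro finite_measure_lebesgue_on) auto
  have gi: "integrable (lebesgue_on K) g" using loc_integrableD[OF g, of K] K set_integrable_iff_lebesgue_on[of K g] by auto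
  have "integrable (lebesgue_on K) f"
  proof (rule Bochner_Integration.integrable_bound)
    show "integrable (lebesgue_on K) (\<lambda>x. A + B * norm (g x))" using gi by auto
    show "f \<in> borel_measurable (lebesgue_on K)" using measurable_lebesgue_on_subset[OF m] K by blast
    show "AE x in lebesgue_on K. norm (f x) \<le> norm (A + B * norm (g x))"
      using order_trans[OF le abs_ge_self] by (intro AE_I2) simp
  qed
  then show "set_integrable lebesgue K f" using K set_integrable_iff_lebesgue_on by blast
qed

section \<open>The chain rule\<close>

text \<open>For \<open>C^1\<close> approximations \<open>v n\<close> of \<open>u\<close> the rule is
  classical. The gradients \<open>F' (v n) \<nabla>(v n)\<close> converge along a subsequence
  because \<open>F'\<close> is bounded and continuous, and the values converge because
  \<open>F\<close> is Lipschitz.\<close>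

lemma has_weak_gradient_chain_C1:
  assumes O: "open \<Omega>" and u: "has_weak_gradient \<Omega> u G"
    and F: "\<And>t. (F has_real_derivative F' t) (at t)" "continuous_on UNIV F'" "\<And>t. \<bar>F' t\<bar> \<le> B"
  shows "has_weak_gradient \<Omega> (\<lambda>x. F (u x)) (\<lambda>x. F' (u x) *\<^sub>R G x)"
proof -
  have B: "0 \<le> B" using F(3)[of 0] by linarith
  have lip: "\<bar>F s - F t\<bar> \<le> B * \<bar>s - t\<bar>" for s t
    using field_differentiable_bound[of UNIV F F' B s t] F(1,3) by (auto intro: has_field_derivative_at_within)
  have "continuous_on UNIV F" using F(1) by (meson DERIV_isCont continuous_at_imp_continuous_on)
  then have [measurable]: "F \<in> borel_measurable borel" "F' \<in> borel_measurable borel" using F(2) by (auto intro: borel_measurable_continuous_onI)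
  note li = has_weak_gradientD(1,2)[OF O u]
  note m = loc_integrable_measurable[OF O li(1)] loc_integrable_measurable[OF O li(2)]
  show ?thesis
  proof (rule has_weak_gradientI_approx[OF O])
    show "loc_integrable \<Omega> (\<lambda>x. F (u x))"
    proof (rule loc_integrable_bound[OF O li(1)])
      show "norm (F (u x)) \<le> \<bar>F 0\<bar> + B * norm (u x)" for x using lip[of "u x" 0] by simp
    qed (use m in measurable)
    show "loc_integrable \<Omega> (\<lambda>x. F' (u x) *\<^sub>R G x)"
    proof (rule loc_integrable_bound[OF O li(2)])
      show "norm (F' (u x) *\<^sub>R G x) \<le> 0 + B * norm (G x)" for x using F(3)[of "u x"] by (simp add: mult_right_mono)
    qed (use m in measurable)
    fix K assume K: "compact K" "K \<subseteq> \<Omega>"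
    obtain v W where vW: "\<And>n::nat. C1_grad (v n) (W n)" "Lp_lim 1 (lebesgue_on K) v u" "Lp_lim 1 (lebesgue_on K) W G"
      by (rule weak_gradient_C1_approx[OF O u K]) (rule that)
    have mv: "v n \<in> borel_measurable (lebesgue_on K)" "W n \<in> borel_measurable (lebesgue_on K)" for n
      using C1_grad_borel[OF vW(1)[of n]] by (auto intro!: measurable_restrict_space1 borel_imp_lebesgue)
    note mK = measurable_lebesgue_on_subset[OF m(1) K(2)] measurable_lebesgue_on_subset[OF m(2) K(2)]
    have "integrable (lebesgue_on K) G" using loc_integrableD[OF li(2) K] set_integrable_iff_lebesgue_on[OF K(1)] by blast
    then have fin: "Lp_mass 1 (lebesgue_on K) G < \<infinity>"
      by (simp add: integrable_iff_bounded)
    obtain r where r: "strict_mono r" "Lp_lim 1 (lebesgue_on K) (\<lambda>n x. F' (v (r n) x) *\<^sub>R W (r n) x) (\<lambda>x. F' (u x) *\<^sub>R G x)"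
      using Lp_lim_scaleR_continuous[OF vW(2,3) _ mv(1) mK(1) mv(2) mK(2) fin F(2,3)] by auto
    show "\<exists>v W. (\<forall>n::nat. has_weak_gradient \<Omega> (v n) (W n)) \<and> Lp_lim 1 (lebesgue_on K) v (\<lambda>x. F (u x)) \<and> Lp_lim 1 (lebesgue_on K) W (\<lambda>x. F' (u x) *\<^sub>R G x)"
    proof (rule exI[of _ "\<lambda>n x. F (v (r n) x)"], rule exI[of _ "\<lambda>n x. F' (v (r n) x) *\<^sub>R W (r n) x"], intro conjI allI)
      show "Lp_lim 1 (lebesgue_on K) (\<lambda>n x. F' (v (r n) x) *\<^sub>R W (r n) x) (\<lambda>x. F' (u x) *\<^sub>R G x)" by (rule r(2))
      show "has_weak_gradient \<Omega> (\<lambda>x. F (v (r n) x)) (\<lambda>x. F' (v (r n) x) *\<^sub>R W (r n) x)" for n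
        by (rule C1_grad_has_weak_gradient[OF O C1_grad_compose[OF vW(1) F(1,2)]])
      show "Lp_lim 1 (lebesgue_on K) (\<lambda>n x. F (v (r n) x)) (\<lambda>x. F (u x))"
        by (rule Lp_lim_comparison[OF Lp_lim_subseq[OF vW(2) r(1)] mv(1) mK(1) B]) (use lip in auto)
    qed
  qed
qed

text \<open>
  With right derivatives \<open>f\<close> defined everywhere, \<open>f\<close> is the pointwise limit of continuous difference
  quotients, so the chain rule holds without discussing \<open>\<nabla>u\<close> on the level sets at the kinks of \<open>F\<close>.
\<close>

lemma lipschitz_C1_approx:
  fixes F :: "real \<Rightarrow> real"
  assumes lip: "\<And>s t. \<bar>F s - F t\<bar> \<le> \<bar>s - t\<bar>" and f: "\<And>t. (F has_real_derivative f t) (at_right t)"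
  obtains Fm fm :: "nat \<Rightarrow> real \<Rightarrow> real" where "\<And>m t. (Fm m has_real_derivative fm m t) (at t)"
    "\<And>m. continuous_on UNIV (fm m)" "\<And>m t. \<bar>fm m t\<bar> \<le> 1" "\<And>m t. \<bar>Fm m t - F t\<bar> \<le> inverse (real (Suc m))"
    "\<And>t. (\<lambda>m. fm m t) \<longlonglongrightarrow> f t"
proof -
  have cF: "continuous_on UNIV F"
    unfolding continuous_on_iff dist_real_def using lip by (meson order_le_less_trans)
  then have "isCont F x" for x by (simp add: continuous_on_eq_continuous_at)
  then obtain I where I: "\<And>x. (I has_vector_derivative F x) (at x)"
    using einterval_antiderivative[of "-\<infinity>" \<infinity> F] by auto
  then have I: "(I has_real_derivative F x) (at x)" for x by (simp add: has_real_derivative_iff_has_vector_derivative)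
  let ?h = "\<lambda>m. inverse (real (Suc m))"
  have h: "0 < ?h m" for m by simp
  \<comment> \<open>\<open>?Fm\<close> is the mean of \<open>F\<close> over the interval of length
    \<open>?h m\<close> to the right of \<open>t\<close>; its derivative is the difference quotient
    of \<open>F\<close>, which is continuous and bounded by the Lipschitz constant.\<close>
  let ?Fm = "\<lambda>m t. (I (t + ?h m) - I t) / ?h m" and ?fm = "\<lambda>m t. (F (t + ?h m) - F t) / ?h m"
  show ?thesis
  proof (rule that[of ?Fm ?fm])
    show "(?Fm m has_real_derivative ?fm m t) (at t)" for m t
      by (rule DERIV_cdivide) (intro DERIV_diff I DERIV_shift[THEN iffD1, OF I])
    show "continuous_on UNIV (?fm m)" for m
      using h[of m] by (intro continuous_intros continuous_on_compose2[OF cF]) auto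
    show "\<bar>?fm m t\<bar> \<le> 1" for m t
      using lip[of "t + ?h m" t] h[of m] by (simp only: abs_divide) (simp add: pos_divide_le_eq)
    show "\<bar>?Fm m t - F t\<bar> \<le> ?h m" for m t
    proof -
      obtain z where z: "t < z" "z < t + ?h m" "I (t + ?h m) - I t = (t + ?h m - t) * F z"
        using MVT2[of t "t + ?h m" I F] I h[of m] by auto
      then have "?Fm m t = F z" using h[of m] by simp
      then show ?thesis using lip[of z t] z(1,2) by simp
    qed
    show "(\<lambda>m. ?fm m t) \<longlonglongrightarrow> f t" for t
    proof -
      have "((\<lambda>s. (F s - F t) / (s - t)) \<longlongrightarrow> f t) (at_right t)"
        using f[of t] by (simp add: has_field_derivative_iff)
      moreover have "filterlim (\<lambda>m. t + ?h m) (at_right t) sequentially"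
      proof -
        have "(\<lambda>m. t + ?h m) \<longlonglongrightarrow> t + 0" by (intro tendsto_intros LIMSEQ_inverse_real_of_nat)
        then show ?thesis unfolding filterlim_at using h by auto
      qed
      ultimately have "(\<lambda>m. (F (t + ?h m) - F t) / (t + ?h m - t)) \<longlonglongrightarrow> f t" by (rule filterlim_compose)
      then show ?thesis by simp
    qed
  qed
qed

text \<open>Domination by the constant 1 on a finite measure for the values, and by
  \<open>2 * norm (G x)\<close> for the gradients. Measure and exponent are general because the
  lemma serves twice: with \<open>L^1\<close> on compact sets for weak gradients, and with
  \<open>L^p\<close> on \<Omega> for the functions vanishing on the boundary.\<close>

lemma Lp_lim_lipschitz_approx:
  fixes u :: "'c \<Rightarrow> real" and G :: "'c \<Rightarrow> 'b::euclidean_space"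
  assumes M: "finite_measure M" and p: "0 < p"
    and [measurable]: "u \<in> borel_measurable M" "G \<in> borel_measurable M" and fin: "Lp_mass p M G < \<infinity>"
    and Fm: "\<And>m t. (Fm m has_real_derivative fm m t) (at t)" "\<And>m. continuous_on UNIV (fm m)" "\<And>m t. \<bar>fm m t\<bar> \<le> 1"
      "\<And>m t. \<bar>Fm m t - F t\<bar> \<le> inverse (real (Suc m))" "\<And>t. (\<lambda>m. fm m t) \<longlonglongrightarrow> f t"
  shows "Lp_lim p M (\<lambda>m x. Fm m (u x)) (\<lambda>x. F (u x))"
    and "Lp_lim p M (\<lambda>m x. fm m (u x) *\<^sub>R G x) (\<lambda>x. f (u x) *\<^sub>R G x)"
    and "f \<in> borel_measurable borel"
proof -
  interpret finite_measure M by (rule M)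
  have fb: "\<bar>f t\<bar> \<le> 1" for t
    by (rule LIMSEQ_le_const2[OF tendsto_rabs[OF Fm(5)]]) (use Fm(3) in auto)
  have [measurable]: "fm m \<in> borel_measurable borel" for m using Fm(2) by (rule borel_measurable_continuous_onI)
  show fM[measurable]: "f \<in> borel_measurable borel" by (rule borel_measurable_LIMSEQ_metric[OF _ Fm(5)]) measurable
  have "isCont (Fm m) t" for m t using Fm(1) DERIV_isCont by blast
  then have [measurable]: "Fm m \<in> borel_measurable borel" for m by (simp add: borel_measurable_continuous_onI continuous_at_imp_continuous_on)
  have Flim: "(\<lambda>n. Fm n t) \<longlonglongrightarrow> F t" for t
  proof -
    have "(\<lambda>n. Fm n t - F t) \<longlonglongrightarrow> 0"
      by (rule Lim_null_comparison[OF _ LIMSEQ_inverse_real_of_nat]) (use Fm(4) in auto)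
    then show ?thesis by (simp add: LIM_zero_iff)
  qed
  have [measurable]: "F \<in> borel_measurable borel" by (rule borel_measurable_LIMSEQ_metric[OF _ Flim]) measurable
  show "Lp_lim p M (\<lambda>m x. Fm m (u x)) (\<lambda>x. F (u x))"
  proof (rule Lp_lim_dominated[where w = "\<lambda>x. 1", OF _ _ _ p])
    show "AE x in M. norm (Fm n (u x) - F (u x)) \<le> 1" for n
    proof (rule AE_I2)
      fix x
      have "inverse (real (Suc n)) \<le> 1" by (simp add: inverse_le_1_iff)
      then show "norm (Fm n (u x) - F (u x)) \<le> 1" using Fm(4)[of n "u x"] by simp
    qed
    show "(\<integral>\<^sup>+x. ennreal (1 powr p) \<partial>M) < \<infinity>"
      using emeasure_finite[of "space M"] by (simp add: top.not_eq_extremum del: emeasure_finite)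
    show "AE x in M. (\<lambda>n. Fm n (u x)) \<longlonglongrightarrow> F (u x)" by (intro AE_I2 Flim)
  qed measurable
  show "Lp_lim p M (\<lambda>m x. fm m (u x) *\<^sub>R G x) (\<lambda>x. f (u x) *\<^sub>R G x)"
  proof (rule Lp_lim_dominated[where w = "\<lambda>x. 2 * norm (G x)", OF _ _ _ p])
    show "AE x in M. norm (fm n (u x) *\<^sub>R G x - f (u x) *\<^sub>R G x) \<le> 2 * norm (G x)" for n
    proof (rule AE_I2)
      fix x
      have "\<bar>fm n (u x) - f (u x)\<bar> \<le> 2" using Fm(3)[of n "u x"] fb[of "u x"] by linarith
      then show "norm (fm n (u x) *\<^sub>R G x - f (u x) *\<^sub>R G x) \<le> 2 * norm (G x)"
        by (simp add: scaleR_diff_left[symmetric] mult_right_mono)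
    qed
    have "(\<integral>\<^sup>+x. ennreal ((2 * norm (G x)) powr p) \<partial>M) = ennreal (2 powr p) * Lp_mass p M G"
      by (subst nn_integral_cmult[symmetric]) (auto simp: powr_mult ennreal_mult')
    also have "\<dots> < \<infinity>" using fin by (simp add: ennreal_mult_less_top)
    finally show "(\<integral>\<^sup>+x. ennreal ((2 * norm (G x)) powr p) \<partial>M) < \<infinity>" .
    show "AE x in M. (\<lambda>n. fm n (u x) *\<^sub>R G x) \<longlonglongrightarrow> f (u x) *\<^sub>R G x"
      by (intro AE_I2 tendsto_intros Fm(5))
  qed measurable
qed

text \<open>Here \<open>u\<close> is kept and \<open>F\<close> is approximated, the opposite of the
  \<open>C^1\<close> case: \<open>f\<close> may jump, so \<open>f (v n)\<close> need not converge to
  \<open>f (u)\<close> for approximations \<open>v n\<close> of \<open>u\<close>, whereas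
  \<open>fm m (u x)\<close> converges to \<open>f (u x)\<close> at every point.\<close>

lemma has_weak_gradient_chain:
  assumes O: "open \<Omega>" and u: "has_weak_gradient \<Omega> u G"
    and lip: "\<And>s t. \<bar>F s - F t\<bar> \<le> \<bar>s - t\<bar>" and f: "\<And>t. (F has_real_derivative f t) (at_right t)"
  shows "has_weak_gradient \<Omega> (\<lambda>x. F (u x)) (\<lambda>x. f (u x) *\<^sub>R G x)"
proof -
  obtain Fm fm :: "nat \<Rightarrow> real \<Rightarrow> real" where Fm: "\<And>m t. (Fm m has_real_derivative fm m t) (at t)"
    "\<And>m. continuous_on UNIV (fm m)" "\<And>m t. \<bar>fm m t\<bar> \<le> 1" "\<And>m t. \<bar>Fm m t - F t\<bar> \<le> inverse (real (Suc m))"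
    "\<And>t. (\<lambda>m. fm m t) \<longlonglongrightarrow> f t" using lipschitz_C1_approx[OF lip f] by blast
  have fb: "\<bar>f t\<bar> \<le> 1" for t
    by (rule LIMSEQ_le_const2[OF tendsto_rabs[OF Fm(5)]]) (use Fm(3) in auto)
  have [measurable]: "fm m \<in> borel_measurable borel" for m using Fm(2) by (rule borel_measurable_continuous_onI)
  have [measurable]: "f \<in> borel_measurable borel" by (rule borel_measurable_LIMSEQ_metric[OF _ Fm(5)]) measurable
  have "continuous_on UNIV F"
    unfolding continuous_on_iff dist_real_def using lip by (meson order_le_less_trans)
  then have [measurable]: "F \<in> borel_measurable borel" by (rule borel_measurable_continuous_onI)
  have "isCont (Fm m) t" for m t using Fm(1) DERIV_isCont by blast
  then have [measurable]: "Fm m \<in> borel_measurable borel" for m by (simp add: borel_measurable_continuous_onI continuous_at_imp_continuous_on)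
  note li = has_weak_gradientD(1,2)[OF O u]
  note m = loc_integrable_measurable[OF O li(1)] loc_integrable_measurable[OF O li(2)]
  show ?thesis
  proof (rule has_weak_gradientI_approx[OF O])
    show "loc_integrable \<Omega> (\<lambda>x. F (u x))"
    proof (rule loc_integrable_bound[OF O li(1)])
      show "norm (F (u x)) \<le> \<bar>F 0\<bar> + 1 * norm (u x)" for x using lip[of "u x" 0] by simp
    qed (use m in measurable)
    show "loc_integrable \<Omega> (\<lambda>x. f (u x) *\<^sub>R G x)"
    proof (rule loc_integrable_bound[OF O li(2)])
      show "norm (f (u x) *\<^sub>R G x) \<le> 0 + 1 * norm (G x)" for x using mult_right_mono[OF fb[of "u x"], of "norm (G x)"] by simp
    qed (use m in measurable)
    fix K assume K: "compact K" "K \<subseteq> \<Omega>"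
    have M: "finite_measure (lebesgue_on K)" using K lmeasurable_compact by (intro finite_measure_lebesgue_on) auto
    note mK = measurable_lebesgue_on_subset[OF m(1) K(2)] measurable_lebesgue_on_subset[OF m(2) K(2)]
    have "integrable (lebesgue_on K) G" using loc_integrableD[OF li(2) K] set_integrable_iff_lebesgue_on[OF K(1)] by blast
    then have fin: "Lp_mass 1 (lebesgue_on K) G < \<infinity>" by (simp add: integrable_iff_bounded)
    show "\<exists>v W. (\<forall>n::nat. has_weak_gradient \<Omega> (v n) (W n)) \<and> Lp_lim 1 (lebesgue_on K) v (\<lambda>x. F (u x)) \<and> Lp_lim 1 (lebesgue_on K) W (\<lambda>x. f (u x) *\<^sub>R G x)"
    proof (intro exI conjI allI)
      show "has_weak_gradient \<Omega> (\<lambda>x. Fm n (u x)) (\<lambda>x. fm n (u x) *\<^sub>R G x)" for n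
        by (rule has_weak_gradient_chain_C1[OF O u Fm(1,2,3)])
    qed (rule Lp_lim_lipschitz_approx[OF M zero_less_one mK fin Fm])+
  qed
qed

section \<open>Sobolev functions vanishing on the boundary\<close>

text \<open>The gradient is an explicit argument because \<open>weak_grad\<close> is a choice, known
  only up to null sets; calculations use whichever representative is at hand.\<close>

definition sobolev :: "real \<Rightarrow> 'a::euclidean_space set \<Rightarrow> ('a \<Rightarrow> real) \<Rightarrow> ('a \<Rightarrow> 'a) \<Rightarrow> bool" where
  "sobolev p \<Omega> u G \<longleftrightarrow> u \<in> Lp_space p \<Omega> \<and> G \<in> Lp_space p \<Omega> \<and> has_weak_gradient \<Omega> u G"

section \<open>Closure properties of the \<open>L^p\<close> and Sobolev classes\<close>

lemma Lp_space_iff: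
  "f \<in> Lp_space p \<Omega> \<longleftrightarrow> f \<in> borel_measurable (lebesgue_on \<Omega>) \<and> Lp_mass p (lebesgue_on \<Omega>) f < \<infinity>"
  unfolding Lp_space_def mem_Collect_eq
  by (rule conj_cong[OF refl]) (simp add: integrable_iff_bounded)

lemma Lp_space_measurable: "f \<in> Lp_space p \<Omega> \<Longrightarrow> f \<in> borel_measurable (lebesgue_on \<Omega>)"
  by (simp add: Lp_space_def)

lemma Lp_space_bound:
  fixes f g h :: "'a::euclidean_space \<Rightarrow> 'b::euclidean_space"
  assumes f: "f \<in> Lp_space p \<Omega>" and g: "g \<in> Lp_space p \<Omega>" and p: "0 < p"
    and h: "h \<in> borel_measurable (lebesgue_on \<Omega>)" and le: "\<And>x. norm (h x) \<le> norm (f x) + norm (g x)"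
  shows "h \<in> Lp_space p \<Omega>"
proof -
  have "Lp_mass p (lebesgue_on \<Omega>) h \<le>
    ennreal (3 powr p) * (Lp_mass p (lebesgue_on \<Omega>) f + Lp_mass p (lebesgue_on \<Omega>) g)"
    by (rule nn_integral_norm_powr_add_le[OF Lp_space_measurable[OF f] Lp_space_measurable[OF g] p le])
  also have "\<dots> < \<infinity>" using f g by (simp add: Lp_space_iff ennreal_mult_less_top)
  finally show ?thesis using h by (simp add: Lp_space_iff)
qed

lemma Lp_space_AE_bound:
  fixes f :: "'a::euclidean_space \<Rightarrow> 'b::euclidean_space" and g :: "'a \<Rightarrow> 'c::euclidean_space"
  assumes g: "g \<in> Lp_space p \<Omega>" and p: "0 < p"
    and f: "f \<in> borel_measurable (lebesgue_on \<Omega>)" and le: "AE x in lebesgue_on \<Omega>. norm (f x) \<le> norm (g x)"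
  shows "f \<in> Lp_space p \<Omega>"
proof -
  have "Lp_mass p (lebesgue_on \<Omega>) f \<le> Lp_mass p (lebesgue_on \<Omega>) g"
  proof (rule nn_integral_mono_AE)
    show "AE x in lebesgue_on \<Omega>. ennreal (norm (f x) powr p) \<le> ennreal (norm (g x) powr p)"
      using le by eventually_elim (use p in \<open>auto intro!: ennreal_leI powr_mono2\<close>)
  qed
  then show ?thesis using f g by (auto simp: Lp_space_iff)
qed

lemma Lp_space_add:
  fixes f g :: "'a::euclidean_space \<Rightarrow> 'b::euclidean_space"
  assumes "f \<in> Lp_space p \<Omega>" "g \<in> Lp_space p \<Omega>" "0 < p"
  shows "(\<lambda>x. f x + g x) \<in> Lp_space p \<Omega>"
  using Lp_space_bound[OF assms, of "\<lambda>x. f x + g x"] Lp_space_measurable[OF assms(1)] Lp_space_measurable[OF assms(2)]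
  by (simp add: norm_triangle_ineq borel_measurable_add)

lemma Lp_space_diff:
  fixes f g :: "'a::euclidean_space \<Rightarrow> 'b::euclidean_space"
  assumes "f \<in> Lp_space p \<Omega>" "g \<in> Lp_space p \<Omega>" "0 < p"
  shows "(\<lambda>x. f x - g x) \<in> Lp_space p \<Omega>"
  using Lp_space_bound[OF assms, of "\<lambda>x. f x - g x"] Lp_space_measurable[OF assms(1)] Lp_space_measurable[OF assms(2)]
  by (simp add: norm_triangle_ineq4 borel_measurable_diff)

lemma Lp_space_minus:
  fixes f :: "'a::euclidean_space \<Rightarrow> 'b::euclidean_space"
  assumes "f \<in> Lp_space p \<Omega>"
  shows "(\<lambda>x. - f x) \<in> Lp_space p \<Omega>"
  using assms by (auto simp: Lp_space_def)

lemma finite_measure_lebesgue_on_bounded_open: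
  fixes \<Omega> :: "'a::euclidean_space set"
  assumes "open \<Omega>" "bounded \<Omega>" shows "finite_measure (lebesgue_on \<Omega>)"
  using assms by (intro finite_measure_lebesgue_on lmeasurable_open)

lemma Lp_space_const:
  fixes c :: "'b::euclidean_space"
  assumes "open (\<Omega> :: 'a::euclidean_space set)" "bounded \<Omega>" shows "(\<lambda>x::'a. c) \<in> Lp_space p \<Omega>"
proof -
  interpret finite_measure "lebesgue_on \<Omega>" by (rule finite_measure_lebesgue_on_bounded_open[OF assms])
  show ?thesis by (simp add: Lp_space_def)
qed

lemma sobolev_measurable:
  assumes "sobolev p \<Omega> u G"
  shows "u \<in> borel_measurable (lebesgue_on \<Omega>)" "G \<in> borel_measurable (lebesgue_on \<Omega>)"
  using assms Lp_space_measurable by (auto simp: sobolev_def)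

lemma sobolev_add:
  assumes "open \<Omega>" "0 < p" "sobolev p \<Omega> u G" "sobolev p \<Omega> v H"
  shows "sobolev p \<Omega> (\<lambda>x. u x + v x) (\<lambda>x. G x + H x)"
  using assms by (auto simp: sobolev_def intro!: Lp_space_add has_weak_gradient_add)

lemma sobolev_diff:
  assumes "open \<Omega>" "0 < p" "sobolev p \<Omega> u G" "sobolev p \<Omega> v H"
  shows "sobolev p \<Omega> (\<lambda>x. u x - v x) (\<lambda>x. G x - H x)"
  using assms by (auto simp: sobolev_def intro!: Lp_space_diff has_weak_gradient_diff)

lemma sobolev_minus:
  assumes "open \<Omega>" "sobolev p \<Omega> u G"
  shows "sobolev p \<Omega> (\<lambda>x. - u x) (\<lambda>x. - G x)"
  using assms by (auto simp: sobolev_def intro!: Lp_space_minus has_weak_gradient_minus)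

lemma W1p_iff: "u \<in> W1p p \<Omega> \<longleftrightarrow> (\<exists>G. sobolev p \<Omega> u G)"
  by (auto simp: W1p_def sobolev_def)

lemma sobolev_cong:
  assumes O: "open \<Omega>" and p: "0 < p" and u: "sobolev p \<Omega> u G"
    and m: "u' \<in> borel_measurable (lebesgue_on \<Omega>)" "G' \<in> borel_measurable (lebesgue_on \<Omega>)"
    and ae: "AE x in lebesgue_on \<Omega>. u' x = u x" "AE x in lebesgue_on \<Omega>. G' x = G x"
  shows "sobolev p \<Omega> u' G'"
proof -
  have u': "u \<in> Lp_space p \<Omega>" "G \<in> Lp_space p \<Omega>" "has_weak_gradient \<Omega> u G" using u by (auto simp: sobolev_def)
  have "AE x in lebesgue_on \<Omega>. norm (u' x) \<le> norm (u x)" using ae(1) by eventually_elim simp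
  from Lp_space_AE_bound[OF u'(1) p m(1) this] have 1: "u' \<in> Lp_space p \<Omega>" .
  have "AE x in lebesgue_on \<Omega>. norm (G' x) \<le> norm (G x)" using ae(2) by eventually_elim simp
  from Lp_space_AE_bound[OF u'(2) p m(2) this] have 2: "G' \<in> Lp_space p \<Omega>" .
  show ?thesis using 1 2 has_weak_gradient_cong[OF O u'(3) m ae] by (simp add: sobolev_def)
qed

lemma has_weak_gradient_weak_grad: "has_weak_gradient \<Omega> u G \<Longrightarrow> has_weak_gradient \<Omega> u (weak_grad \<Omega> u)"
  unfolding weak_grad_def by (rule someI[of "has_weak_gradient \<Omega> u"])

lemma weak_grad_AE:
  assumes O: "open \<Omega>" and u: "has_weak_gradient \<Omega> u G"
  shows "AE x in lebesgue_on \<Omega>. weak_grad \<Omega> u x = G x"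
  by (rule has_weak_gradient_unique[OF O has_weak_gradient_weak_grad[OF u] u]) simp

text \<open>The representative fixed by choice agrees a.e. with \<open>G\<close> and inherits its
  integrability.\<close>

lemma sobolev_weak_grad:
  assumes O: "open \<Omega>" and p: "0 < p" and u: "sobolev p \<Omega> u G"
  shows "sobolev p \<Omega> u (weak_grad \<Omega> u)"
proof -
  have w: "has_weak_gradient \<Omega> u G" using u by (simp add: sobolev_def)
  have "weak_grad \<Omega> u \<in> borel_measurable (lebesgue_on \<Omega>)"
    by (rule loc_integrable_measurable[OF O has_weak_gradientD(2)[OF O has_weak_gradient_weak_grad[OF w]]])
  from sobolev_cong[OF O p u sobolev_measurable(1)[OF u] this _ weak_grad_AE[OF O w]] show ?thesis by simp
qed

section \<open>Convergence in the Sobolev norm\<close>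

lemma Lp_norm_tendsto_zero_iff:
  fixes w :: "nat \<Rightarrow> 'a::euclidean_space \<Rightarrow> 'b::euclidean_space"
  assumes p: "0 < p" and w: "\<And>n. w n \<in> Lp_space p \<Omega>"
  shows "(\<lambda>n. Lp_norm p \<Omega> (w n)) \<longlonglongrightarrow> 0 \<longleftrightarrow> Lp_lim p (lebesgue_on \<Omega>) w (\<lambda>x. 0)"
proof -
  let ?I = "\<lambda>n. LINT x|lebesgue_on \<Omega>. norm (w n x) powr p"
  have I: "Lp_mass p (lebesgue_on \<Omega>) (\<lambda>x. w n x) = ennreal (?I n)" for n
    using w[of n] by (intro nn_integral_eq_integral) (auto simp: Lp_space_def)
  have I0: "0 \<le> ?I n" for n by (rule Bochner_Integration.integral_nonneg) simp
  have "Lp_lim p (lebesgue_on \<Omega>) w (\<lambda>x. 0) \<longleftrightarrow> (\<lambda>n. ennreal (?I n)) \<longlonglongrightarrow> ennreal 0"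
    unfolding Lp_lim_def by (simp add: I)
  also have "\<dots> \<longleftrightarrow> ?I \<longlonglongrightarrow> 0" using I0 by (intro tendsto_ennreal_iff always_eventually) auto
  also have "\<dots> \<longleftrightarrow> (\<lambda>n. ?I n powr (1 / p)) \<longlonglongrightarrow> 0"
  proof
    assume "?I \<longlonglongrightarrow> 0"
    then show "(\<lambda>n. ?I n powr (1 / p)) \<longlonglongrightarrow> 0"
      by (rule tendsto_zero_powrI[OF _ tendsto_const]) (use I0 p in auto)
  next
    assume "(\<lambda>n. ?I n powr (1 / p)) \<longlonglongrightarrow> 0"
    then have "(\<lambda>n. (?I n powr (1 / p)) powr p) \<longlonglongrightarrow> 0"
      by (rule tendsto_zero_powrI[OF _ tendsto_const]) (use p in auto)
    then show "?I \<longlonglongrightarrow> 0" using p I0 by (simp add: powr_powr)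
  qed
  finally show ?thesis by (simp add: Lp_norm_def)
qed

lemma Lp_norm_nonneg: "0 \<le> Lp_norm p \<Omega> f"
  by (simp add: Lp_norm_def)

lemma W1p_norm_eq:
  assumes O: "open \<Omega>" and p: "0 < p" and u: "sobolev p \<Omega> u G"
  shows "W1p_norm p \<Omega> u = Lp_norm p \<Omega> u + Lp_norm p \<Omega> G"
proof -
  have w: "has_weak_gradient \<Omega> u G" using u by (simp add: sobolev_def)
  have [measurable]: "G \<in> borel_measurable (lebesgue_on \<Omega>)" "weak_grad \<Omega> u \<in> borel_measurable (lebesgue_on \<Omega>)"
    using sobolev_measurable(2)[OF u] sobolev_measurable(2)[OF sobolev_weak_grad[OF O p u]] .
  have "(LINT x|lebesgue_on \<Omega>. norm (weak_grad \<Omega> u x) powr p) = (LINT x|lebesgue_on \<Omega>. norm (G x) powr p)"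
  proof (rule integral_cong_AE)
    show "AE x in lebesgue_on \<Omega>. norm (weak_grad \<Omega> u x) powr p = norm (G x) powr p"
      using weak_grad_AE[OF O w] by eventually_elim simp
  qed measurable
  then show ?thesis by (simp add: W1p_norm_def Lp_norm_def)
qed

text \<open>This trades the Sobolev norm, with its roots and its chosen gradient, for two separate
  limits of masses with any representative of the gradients.\<close>

lemma W1p_norm_tendsto_zero_iff:
  assumes O: "open \<Omega>" and p: "0 < p" and w: "\<And>n. sobolev p \<Omega> (w n) (H n)"
  shows "(\<lambda>n. W1p_norm p \<Omega> (w n)) \<longlonglongrightarrow> 0 \<longleftrightarrow>
    Lp_lim p (lebesgue_on \<Omega>) w (\<lambda>x. 0) \<and> Lp_lim p (lebesgue_on \<Omega>) H (\<lambda>x. 0)"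
proof -
  have L: "w n \<in> Lp_space p \<Omega>" "H n \<in> Lp_space p \<Omega>" for n using w by (auto simp: sobolev_def)
  have "(\<lambda>n. W1p_norm p \<Omega> (w n)) = (\<lambda>n. Lp_norm p \<Omega> (w n) + Lp_norm p \<Omega> (H n))"
    by (rule ext) (rule W1p_norm_eq[OF O p w])
  moreover have "(\<lambda>n. Lp_norm p \<Omega> (w n) + Lp_norm p \<Omega> (H n)) \<longlonglongrightarrow> 0 \<longleftrightarrow>
    (\<lambda>n. Lp_norm p \<Omega> (w n)) \<longlonglongrightarrow> 0 \<and> (\<lambda>n. Lp_norm p \<Omega> (H n)) \<longlonglongrightarrow> 0"
  proof (intro iffI conjI)
    assume a: "(\<lambda>n. Lp_norm p \<Omega> (w n) + Lp_norm p \<Omega> (H n)) \<longlonglongrightarrow> 0"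
    show "(\<lambda>n. Lp_norm p \<Omega> (w n)) \<longlonglongrightarrow> 0"
      by (rule Lim_null_comparison[OF _ a]) (simp add: Lp_norm_nonneg)
    show "(\<lambda>n. Lp_norm p \<Omega> (H n)) \<longlonglongrightarrow> 0"
      by (rule Lim_null_comparison[OF _ a]) (simp add: Lp_norm_nonneg)
  qed (use tendsto_add_zero in blast)
  ultimately show ?thesis using Lp_norm_tendsto_zero_iff[OF p L(1)] Lp_norm_tendsto_zero_iff[OF p L(2)] by simp
qed

lemma Lp_lim_diff_iff: "Lp_lim p M (\<lambda>n x. X n x - f x) (\<lambda>x. 0) \<longleftrightarrow> Lp_lim p M X f"
  by (simp add: Lp_lim_def)

lemma Lp_lim_diff_swap: "Lp_lim p M (\<lambda>n x. Y n x - X n x) (\<lambda>x. 0) \<longleftrightarrow> Lp_lim p M (\<lambda>n x. X n x - Y n x) (\<lambda>x. 0)"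
proof -
  have "norm (Y n x - X n x - 0) = norm (X n x - Y n x - 0)" for n x by (simp add: norm_minus_commute)
  then show ?thesis unfolding Lp_lim_def by simp
qed

lemma W1p_norm_diff_tendsto_zero_iff:
  assumes O: "open \<Omega>" and p: "0 < p" and w: "\<And>n. sobolev p \<Omega> (w n) (H n)" and u: "sobolev p \<Omega> u G"
  shows "(\<lambda>n. W1p_norm p \<Omega> (\<lambda>x. w n x - u x)) \<longlonglongrightarrow> 0 \<longleftrightarrow>
    Lp_lim p (lebesgue_on \<Omega>) w u \<and> Lp_lim p (lebesgue_on \<Omega>) H G"
  using W1p_norm_tendsto_zero_iff[OF O p sobolev_diff[OF O p w u]] by (simp add: Lp_lim_diff_iff)

section \<open>The closure of the test functions\<close>

lemma C1_supported_in_sobolev: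
  assumes O: "open \<Omega>" and p: "0 < p" and s: "C1_supported_in K \<psi> \<psi>'" shows "sobolev p \<Omega> \<psi> \<psi>'"
proof -
  note K = C1_supported_inD[OF s]
  have Km: "K \<in> sets lebesgue" "emeasure lebesgue K < \<infinity>" using lmeasurable_compact[OF K(2)] by (auto simp: fmeasurable_def)
  obtain B where B: "0 \<le> B" "\<And>x. \<bar>\<psi> x\<bar> \<le> B" "\<And>x. norm (\<psi>' x) \<le> B" using K(7) by blast
  have L: "f \<in> Lp_space p \<Omega>" if f: "f \<in> borel_measurable lebesgue" "\<And>x. norm (f x) \<le> B" "\<And>x. x \<notin> K \<Longrightarrow> f x = 0"
    for f :: "'a \<Rightarrow> 'c::euclidean_space"
  proof -
    have [measurable]: "f \<in> borel_measurable (lebesgue_on \<Omega>)" using f(1) by (rule measurable_restrict_space1)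
    have "integrable lebesgue (\<lambda>x. B powr p * indicator K x)"
      using Km by (intro integrable_mult_right integrable_real_indicator) auto
    then have i: "integrable (lebesgue_on \<Omega>) (\<lambda>x. B powr p * indicator K x)"
      using O integrable_mult_indicator[of \<Omega> lebesgue "\<lambda>x. B powr p * indicator K x"] by (subst integrable_restrict_space) auto
    have "integrable (lebesgue_on \<Omega>) (\<lambda>x. norm (f x) powr p)"
    proof (rule Bochner_Integration.integrable_bound[OF i])
      show "AE x in lebesgue_on \<Omega>. norm (norm (f x) powr p) \<le> norm (B powr p * indicator K x)"
      proof (rule AE_I2)
        fix x show "norm (norm (f x) powr p) \<le> norm (B powr p * indicator K x)"
          using f(2)[of x] f(3)[of x] p by (cases "x \<in> K") (auto intro!: powr_mono2)
      qed
    qed measurable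
    then show ?thesis by (simp add: Lp_space_def)
  qed
  show ?thesis
    using L[OF K(5) _ K(3)] L[OF K(6) B(3) K(4)] B(2) C1_grad_has_weak_gradient[OF O K(1)] by (simp add: sobolev_def)
qed

text \<open>One test function for each member, with errors tending to zero. A constant sequence
  yields the approximation of a single function, a convergent one the diagonal sequence for
  closedness.\<close>

lemma W1p_zero_test_sequence:
  assumes "\<And>n::nat. w n \<in> W1p_zero p \<Omega>"
  obtains K \<psi> \<psi>' where "\<And>n. C1_supported_in (K n) (\<psi> n) (\<psi>' n)" "\<And>n. K n \<subseteq> \<Omega>"
    "(\<lambda>n. W1p_norm p \<Omega> (\<lambda>x. w n x - \<psi> n x)) \<longlonglongrightarrow> 0"
proof -
  have "\<exists>K \<psi> \<psi>'. C1_supported_in K \<psi> \<psi>' \<and> K \<subseteq> \<Omega> \<and> W1p_norm p \<Omega> (\<lambda>x. w n x - \<psi> x) < inverse (real (Suc n))" for n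
  proof -
    have "0 < inverse (real (Suc n))" by simp
    then obtain \<psi> where "\<psi> \<in> C1_compact_support \<Omega>" "W1p_norm p \<Omega> (\<lambda>x. w n x - \<psi> x) < inverse (real (Suc n))"
      using assms[of n] unfolding W1p_zero_def by blast
    then show ?thesis unfolding C1_compact_support_iff C1_supported_in_def by blast
  qed
  then obtain K \<psi> \<psi>' where s: "\<And>n. C1_supported_in (K n) (\<psi> n) (\<psi>' n)" "\<And>n. K n \<subseteq> \<Omega>"
    and le: "\<And>n. W1p_norm p \<Omega> (\<lambda>x. w n x - \<psi> n x) < inverse (real (Suc n))" by metis
  have nn: "0 \<le> W1p_norm p \<Omega> w" for w by (simp add: W1p_norm_def Lp_norm_nonneg)
  have "(\<lambda>n. W1p_norm p \<Omega> (\<lambda>x. w n x - \<psi> n x)) \<longlonglongrightarrow> 0"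
    by (rule Lim_null_comparison[OF _ LIMSEQ_inverse_real_of_nat]) (use le nn in \<open>auto intro: always_eventually less_imp_le\<close>)
  then show ?thesis by (rule that[OF s])
qed

lemma W1p_zero_approx:
  assumes O: "open \<Omega>" and p: "0 < p" and v: "v \<in> W1p_zero p \<Omega>" "sobolev p \<Omega> v G"
  obtains K \<psi> \<psi>' where "\<And>n::nat. C1_supported_in (K n) (\<psi> n) (\<psi>' n)" "\<And>n. K n \<subseteq> \<Omega>"
    "Lp_lim p (lebesgue_on \<Omega>) \<psi> v" "Lp_lim p (lebesgue_on \<Omega>) \<psi>' G"
proof -
  obtain K \<psi> \<psi>' where s: "\<And>n. C1_supported_in (K n) (\<psi> n) (\<psi>' n)" "\<And>n. K n \<subseteq> \<Omega>"
    and lim0: "(\<lambda>n. W1p_norm p \<Omega> (\<lambda>x. v x - \<psi> n x)) \<longlonglongrightarrow> 0"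
    by (rule W1p_zero_test_sequence[OF v(1)]) (rule that)
  from lim0 have "Lp_lim p (lebesgue_on \<Omega>) (\<lambda>n x. v x - \<psi> n x) (\<lambda>x. 0) \<and> Lp_lim p (lebesgue_on \<Omega>) (\<lambda>n x. G x - \<psi>' n x) (\<lambda>x. 0)"
    using W1p_norm_tendsto_zero_iff[OF O p, of "\<lambda>n x. v x - \<psi> n x" "\<lambda>n x. G x - \<psi>' n x"] sobolev_diff[OF O p v(2) C1_supported_in_sobolev[OF O p s(1)]] by simp
  then show ?thesis using that[of K \<psi> \<psi>', OF s] Lp_lim_diff_swap[of p "lebesgue_on \<Omega>" "\<lambda>n. v" \<psi>] Lp_lim_diff_swap[of p "lebesgue_on \<Omega>" "\<lambda>n. G" \<psi>']
    by (simp add: Lp_lim_diff_iff)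
qed

lemma W1p_zeroI_C1_supported_in:
  assumes O: "open \<Omega>" and p: "0 < p" and v: "sobolev p \<Omega> v G"
    and s: "\<And>n::nat. C1_supported_in (K n) (\<psi> n) (\<psi>' n)" "\<And>n. K n \<subseteq> \<Omega>"
    and lim: "Lp_lim p (lebesgue_on \<Omega>) \<psi> v" "Lp_lim p (lebesgue_on \<Omega>) \<psi>' G"
  shows "v \<in> W1p_zero p \<Omega>"
  unfolding W1p_zero_def mem_Collect_eq
proof (intro conjI allI impI)
  show "v \<in> W1p p \<Omega>" using v by (auto simp: W1p_iff)
  fix \<epsilon> :: real assume \<epsilon>: "0 < \<epsilon>"
  have "Lp_lim p (lebesgue_on \<Omega>) (\<lambda>n x. v x - \<psi> n x) (\<lambda>x. 0) \<and> Lp_lim p (lebesgue_on \<Omega>) (\<lambda>n x. G x - \<psi>' n x) (\<lambda>x. 0)"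
    using lim Lp_lim_diff_swap[of p "lebesgue_on \<Omega>" "\<lambda>n. v" \<psi>] Lp_lim_diff_swap[of p "lebesgue_on \<Omega>" "\<lambda>n. G" \<psi>']
    by (simp add: Lp_lim_diff_iff)
  then have "(\<lambda>n. W1p_norm p \<Omega> (\<lambda>x. v x - \<psi> n x)) \<longlonglongrightarrow> 0"
    using W1p_norm_tendsto_zero_iff[OF O p, of "\<lambda>n x. v x - \<psi> n x" "\<lambda>n x. G x - \<psi>' n x"] sobolev_diff[OF O p v C1_supported_in_sobolev[OF O p s(1)]] by simp
  from order_tendstoD(2)[OF this \<epsilon>] obtain n where "W1p_norm p \<Omega> (\<lambda>x. v x - \<psi> n x) < \<epsilon>"
    by (auto simp: eventually_sequentially)
  moreover have "\<psi> n \<in> C1_compact_support \<Omega>" using s[of n] unfolding C1_compact_support_iff C1_supported_in_def by blast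
  ultimately show "\<exists>\<psi>\<in>C1_compact_support \<Omega>. W1p_norm p \<Omega> (\<lambda>x. v x - \<psi> x) < \<epsilon>" by blast
qed

text \<open>The diagonal sequence of test functions converges to \<open>v\<close>, since both its
  distance to \<open>w n\<close> and the distance of \<open>w n\<close> to \<open>v\<close> tend to
  zero.\<close>

lemma W1p_zero_closed:
  assumes O: "open \<Omega>" and p: "0 < p" and v: "sobolev p \<Omega> v G"
    and vn: "\<And>n::nat. w n \<in> W1p_zero p \<Omega>" "\<And>n. sobolev p \<Omega> (w n) (H n)"
    and lim: "Lp_lim p (lebesgue_on \<Omega>) w v" "Lp_lim p (lebesgue_on \<Omega>) H G"
  shows "v \<in> W1p_zero p \<Omega>"
proof -
  obtain K \<psi> \<psi>' where s: "\<And>n. C1_supported_in (K n) (\<psi> n) (\<psi>' n)" "\<And>n. K n \<subseteq> \<Omega>"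
    and lim0: "(\<lambda>n. W1p_norm p \<Omega> (\<lambda>x. w n x - \<psi> n x)) \<longlonglongrightarrow> 0"
    by (rule W1p_zero_test_sequence[OF vn(1)]) (rule that)
  note sobs = C1_supported_in_sobolev[OF O p s(1)]
  note d = sobolev_diff[OF O p vn(2) sobs]
  from lim0 have "Lp_lim p (lebesgue_on \<Omega>) (\<lambda>n x. w n x - \<psi> n x) (\<lambda>x. 0) \<and> Lp_lim p (lebesgue_on \<Omega>) (\<lambda>n x. H n x - \<psi>' n x) (\<lambda>x. 0)"
    using W1p_norm_tendsto_zero_iff[OF O p, of "\<lambda>n x. w n x - \<psi> n x" "\<lambda>n x. H n x - \<psi>' n x"] d by simp
  then have l0: "Lp_lim p (lebesgue_on \<Omega>) (\<lambda>n x. \<psi> n x - w n x) (\<lambda>x. 0)" "Lp_lim p (lebesgue_on \<Omega>) (\<lambda>n x. \<psi>' n x - H n x) (\<lambda>x. 0)"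
    by (simp_all only: Lp_lim_diff_swap[of _ _ \<psi> w] Lp_lim_diff_swap[of _ _ \<psi>' H])
  note d' = sobolev_diff[OF O p sobs vn(2)]
  have "Lp_lim p (lebesgue_on \<Omega>) (\<lambda>n x. (\<psi> n x - w n x) + w n x) (\<lambda>x. 0 + v x)"
    by (rule Lp_lim_add[OF l0(1) lim(1) p sobolev_measurable(1)[OF d'] _ sobolev_measurable(1)[OF vn(2)] sobolev_measurable(1)[OF v]]) simp
  moreover have "Lp_lim p (lebesgue_on \<Omega>) (\<lambda>n x. (\<psi>' n x - H n x) + H n x) (\<lambda>x. 0 + G x)"
    by (rule Lp_lim_add[OF l0(2) lim(2) p sobolev_measurable(2)[OF d'] _ sobolev_measurable(2)[OF vn(2)] sobolev_measurable(2)[OF v]]) simp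
  ultimately show ?thesis
    by (intro W1p_zeroI_C1_supported_in[OF O p v s]) simp_all
qed

text \<open>Mollification with radius at most \<open>r/2\<close> keeps the support inside the
  compact set \<open>K1\<close>, and cutting off at \<open>K2\<close> creates no jump because
  \<open>u\<close> already vanishes off \<open>K\<close>. The mollified functions are therefore test
  functions, and they converge with their gradients.\<close>

lemma W1p_zero_compact_support:
  fixes u :: "'a::euclidean_space \<Rightarrow> real"
  assumes O: "open \<Omega>" and p: "1 \<le> p" and u: "sobolev p \<Omega> u G"
    and K: "compact K" "K \<subseteq> \<Omega>" and z: "\<And>x. x \<notin> K \<Longrightarrow> u x = 0" "\<And>x. x \<notin> K \<Longrightarrow> G x = 0"
  shows "u \<in> W1p_zero p \<Omega>"
proof -
  have S: "\<Omega> \<in> sets lebesgue" using O by auto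
  obtain r where r: "0 < r" "compact (\<Union>x\<in>K. cball x r)" "(\<Union>x\<in>K. cball x r) \<subseteq> \<Omega>" using compact_cball_nbhd[OF K(1) O K(2)] .
  define K2 where "K2 = (\<Union>x\<in>K. cball x r)"
  define K1 where "K1 = (\<Union>x\<in>K. cball x (r/2))"
  have K2: "compact K2" "K2 \<subseteq> \<Omega>" using r by (auto simp: K2_def)
  have K1: "compact K1" unfolding K1_def by (rule compact_UN_cball[OF K(1)])
  have K12: "K1 \<subseteq> K2" unfolding K1_def K2_def using r(1) by (intro UN_mono subset_cball) auto
  have KK2: "K \<subseteq> K2" unfolding K2_def using r(1) by force
  have wg: "has_weak_gradient \<Omega> u G" using u by (simp add: sobolev_def)
  have si: "set_integrable lebesgue K2 u" "set_integrable lebesgue K2 G" using has_weak_gradientD(1,2)[OF O wg] loc_integrableD K2 by blast+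
  obtain U where U: "U \<in> borel_measurable borel" "AE x in lebesgue. indicator K2 x *\<^sub>R u x = U x" using borel_representative[OF si(1)] .
  obtain H where H: "H \<in> borel_measurable borel" "AE x in lebesgue. indicator K2 x *\<^sub>R G x = H x" using borel_representative[OF si(2)] .
  have uU: "AE x in lebesgue. u x = U x" using U(2)
  proof eventually_elim
    case (elim x) then show ?case using z(1)[of x] KK2 by (cases "x \<in> K2") auto
  qed
  have GH: "AE x in lebesgue. G x = H x" using H(2)
  proof eventually_elim
    case (elim x) then show ?case using z(2)[of x] KK2 by (cases "x \<in> K2") auto
  qed
  have U0: "AE y in lborel. y \<notin> K \<longrightarrow> U y = 0"
    using uU unfolding AE_completion_iff by eventually_elim (use z in auto)
  have H0: "AE y in lborel. y \<notin> K \<longrightarrow> H y = 0"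
    using GH unfolding AE_completion_iff by eventually_elim (use z in auto)
  have pw: "set_integrable lebesgue K2 (\<lambda>x. norm (f x) powr p)" if "f \<in> Lp_space p \<Omega>" for f :: "'a \<Rightarrow> 'c::euclidean_space"
  proof -
    have "set_integrable lebesgue \<Omega> (\<lambda>x. norm (f x) powr p)"
      using that S unfolding Lp_space_def set_integrable_def by (simp add: integrable_restrict_space)
    moreover have "K2 \<in> sets lebesgue" using lmeasurable_compact K2(1) by blast
    ultimately show ?thesis using K2(2) by (rule set_integrable_subset)
  qed
  have uL: "u \<in> Lp_space p \<Omega>" "G \<in> Lp_space p \<Omega>" using u by (auto simp: sobolev_def)
  define P where "P n \<psi> \<psi>' \<longleftrightarrow> C1_supported_in K1 \<psi> \<psi>' \<and> Lp_mass p (lebesgue_on \<Omega>) (\<lambda>x. \<psi> x - u x) \<le> ennreal (inverse (real (Suc n)))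
    \<and> Lp_mass p (lebesgue_on \<Omega>) (\<lambda>x. \<psi>' x - G x) \<le> ennreal (inverse (real (Suc n)))" for n \<psi> \<psi>'
  have "\<exists>\<psi> \<psi>'. P n \<psi> \<psi>'" for n
  proof -
    have pos: "0 < inverse (real (Suc n))" "0 < r/2" using r(1) by auto
    obtain e W where e: "0 < e" "e \<le> r/2" "C1_grad (mollify e U) W" "\<And>x. cball x e \<subseteq> K2 \<Longrightarrow> W x = mollify e H x"
      "Lp_mass p lborel (\<lambda>x. mollify e U x - U x) \<le> ennreal (inverse (real (Suc n)))"
      "Lp_mass p lborel (\<lambda>x. mollify e H x - H x) \<le> ennreal (inverse (real (Suc n)))"
      by (rule weak_gradient_mollify[OF O wg K2 U H p representative_integrable_powr[OF pw[OF uL(1)] U] representative_integrable_powr[OF pw[OF uL(2)] H] pos]) (rule that)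
    have far: "e \<le> dist x y" if "x \<notin> K1" "y \<in> K" for x y
    proof -
      have "x \<notin> cball y (r/2)" using that unfolding K1_def by blast
      then show ?thesis using e(2) by (simp add: dist_commute)
    qed
    have z1: "mollify e U x = 0" if "x \<notin> K1" for x
      by (rule mollify_eq_0[OF U0 far[OF that]]) (use e(1) in auto)
    have z2: "mollify e H x = 0" if "x \<notin> K1" for x
      by (rule mollify_eq_0[OF H0 far[OF that]]) (use e(1) in auto)
    have z3: "W x = 0" if "x \<notin> K1" for x
      by (rule GDERIV_locally_zero[OF compact_imp_closed[OF K1] z1 _ that]) (use e(3) in \<open>auto simp: C1_grad_def\<close>)
    \<comment> \<open>On \<open>K1\<close> the \<open>e\<close>-ball fits into \<open>K2\<close> and
      the local identity applies; off \<open>K1\<close> both sides vanish.\<close>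
    have W: "W x = mollify e H x" for x
    proof (cases "x \<in> K1")
      case True
      then obtain y where y: "y \<in> K" "dist y x \<le> r/2" by (auto simp: K1_def)
      have "cball x e \<subseteq> cball y r"
      proof
        fix a assume "a \<in> cball x e"
        then show "a \<in> cball y r" using dist_triangle[of y a x] y(2) e(2) by simp
      qed
      then have "cball x e \<subseteq> K2" using y(1) by (auto simp: K2_def)
      then show ?thesis by (rule e(4))
    qed (simp add: z2 z3)
    have "P n (mollify e U) W"
      unfolding P_def
    proof (intro conjI)
      show "C1_supported_in K1 (mollify e U) W" using e(3) K1 z1 z3 by (simp add: C1_supported_in_def)
      have "Lp_mass p (lebesgue_on \<Omega>) (\<lambda>x. mollify e U x - u x) \<le> Lp_mass p lborel (\<lambda>x. mollify e U x - U x)"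
        by (rule nn_integral_lebesgue_on_le[OF S]) (use uU in \<open>eventually_elim, simp\<close>)
      then show "Lp_mass p (lebesgue_on \<Omega>) (\<lambda>x. mollify e U x - u x) \<le> ennreal (inverse (real (Suc n)))"
        using e(5) by (rule order_trans)
      have "Lp_mass p (lebesgue_on \<Omega>) (\<lambda>x. W x - G x) \<le> Lp_mass p lborel (\<lambda>x. mollify e H x - H x)"
        unfolding W by (rule nn_integral_lebesgue_on_le[OF S]) (use GH in \<open>eventually_elim, simp\<close>)
      then show "Lp_mass p (lebesgue_on \<Omega>) (\<lambda>x. W x - G x) \<le> ennreal (inverse (real (Suc n)))"
        using e(6) by (rule order_trans)
    qed
    then show ?thesis by blast
  qed
  then obtain \<psi> \<psi>' where "\<And>n. P n (\<psi> n) (\<psi>' n)" by metis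
  then have s: "\<And>n. C1_supported_in K1 (\<psi> n) (\<psi>' n)"
    "\<And>n. Lp_mass p (lebesgue_on \<Omega>) (\<lambda>x. \<psi> n x - u x) \<le> ennreal (inverse (real (Suc n)))"
    "\<And>n. Lp_mass p (lebesgue_on \<Omega>) (\<lambda>x. \<psi>' n x - G x) \<le> ennreal (inverse (real (Suc n)))" unfolding P_def by blast+
  have lim: "(\<lambda>n. ennreal (inverse (real (Suc n)))) \<longlonglongrightarrow> 0"
    using tendsto_ennrealI[OF LIMSEQ_inverse_real_of_nat] by simp
  have p0: "0 < p" using p by simp
  show ?thesis
    by (rule W1p_zeroI_C1_supported_in[OF O p0 u s(1) _ Lp_lim_le[OF lim s(2)] Lp_lim_le[OF lim s(3)]]) (use K12 K2(2) in blast)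
qed

section \<open>Composition with Lipschitz functions\<close>

lemma sobolev_chain_general:
  assumes O: "open \<Omega>" "bounded \<Omega>" and p: "0 < p" and u: "sobolev p \<Omega> u G"
    and w: "has_weak_gradient \<Omega> (\<lambda>x. F (u x)) (\<lambda>x. f (u x) *\<^sub>R G x)"
    and lip: "\<And>s t. \<bar>F s - F t\<bar> \<le> \<bar>s - t\<bar>" and f: "\<And>t. \<bar>f t\<bar> \<le> 1"
  shows "sobolev p \<Omega> (\<lambda>x. F (u x)) (\<lambda>x. f (u x) *\<^sub>R G x)"
  unfolding sobolev_def
proof (intro conjI w)
  have uL: "u \<in> Lp_space p \<Omega>" "G \<in> Lp_space p \<Omega>" using u by (auto simp: sobolev_def)
  note m = loc_integrable_measurable[OF O(1) has_weak_gradientD(1)[OF O(1) w]] loc_integrable_measurable[OF O(1) has_weak_gradientD(2)[OF O(1) w]]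
  show "(\<lambda>x. F (u x)) \<in> Lp_space p \<Omega>"
  proof (rule Lp_space_bound[OF Lp_space_const[OF O, of "F 0"] uL(1) p m(1)])
    show "norm (F (u x)) \<le> norm (F 0) + norm (u x)" for x using lip[of "u x" 0] by simp
  qed
  show "(\<lambda>x. f (u x) *\<^sub>R G x) \<in> Lp_space p \<Omega>"
  proof (rule Lp_space_AE_bound[OF uL(2) p m(2)])
    show "AE x in lebesgue_on \<Omega>. norm (f (u x) *\<^sub>R G x) \<le> norm (G x)"
      using f by (intro AE_I2) (simp add: mult_left_le_one_le)
  qed
qed

lemma DERIV_bounded_lipschitz:
  fixes F :: "real \<Rightarrow> real"
  assumes "\<And>t. (F has_real_derivative F' t) (at t)" "\<And>t. \<bar>F' t\<bar> \<le> 1"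
  shows "\<bar>F s - F t\<bar> \<le> \<bar>s - t\<bar>"
  using field_differentiable_bound[of UNIV F F' 1 s t] assms by (auto intro: has_field_derivative_at_within)

text \<open>
  For \<open>v \<in> C\<^sup>1\<close> with compact support the difference vanishes outside the support of \<open>v\<close>; the general case
  follows by passing to the limit.
\<close>

lemma W1p_zero_chain_C1:
  assumes O: "open \<Omega>" "bounded \<Omega>" and p: "1 \<le> p" and q: "sobolev p \<Omega> q Gq"
    and v: "v \<in> W1p_zero p \<Omega>" "sobolev p \<Omega> v Gv"
    and F: "\<And>t. (F has_real_derivative F' t) (at t)" "continuous_on UNIV F'" "\<And>t. \<bar>F' t\<bar> \<le> 1"
  shows "(\<lambda>x. F (q x + v x) - F (q x)) \<in> W1p_zero p \<Omega>"
proof -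
  have p0: "0 < p" using p by simp
  note lip = DERIV_bounded_lipschitz[OF F(1,3)]
  have chain: "sobolev p \<Omega> (\<lambda>x. F (u x)) (\<lambda>x. F' (u x) *\<^sub>R G x)" if "sobolev p \<Omega> u G" for u G
    using that by (intro sobolev_chain_general[OF O p0 that has_weak_gradient_chain_C1[OF O(1) _ F] lip F(3)]) (simp add: sobolev_def)
  obtain K \<psi> \<psi>' where s: "\<And>n::nat. C1_supported_in (K n) (\<psi> n) (\<psi>' n)" "\<And>n. K n \<subseteq> \<Omega>"
    and lim: "Lp_lim p (lebesgue_on \<Omega>) \<psi> v" "Lp_lim p (lebesgue_on \<Omega>) \<psi>' Gv" by (rule W1p_zero_approx[OF O(1) p0 v]) (rule that)
  note yn = sobolev_add[OF O(1) p0 q C1_supported_in_sobolev[OF O(1) p0 s(1)]] and y = sobolev_add[OF O(1) p0 q v(2)]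
  note mq = sobolev_measurable[OF q] and myn = sobolev_measurable[OF yn] and my = sobolev_measurable[OF y]
  have ly: "Lp_lim p (lebesgue_on \<Omega>) (\<lambda>n x. q x + \<psi> n x) (\<lambda>x. q x + v x)"
    "Lp_lim p (lebesgue_on \<Omega>) (\<lambda>n x. Gq x + \<psi>' n x) (\<lambda>x. Gq x + Gv x)" using lim by (simp_all add: Lp_lim_def)
  have fin: "Lp_mass p (lebesgue_on \<Omega>) (\<lambda>x. Gq x + Gv x) < \<infinity>" using y by (simp add: sobolev_def Lp_space_iff)
  obtain r where r: "strict_mono r"
    "Lp_lim p (lebesgue_on \<Omega>) (\<lambda>n x. F' (q x + \<psi> (r n) x) *\<^sub>R (Gq x + \<psi>' (r n) x)) (\<lambda>x. F' (q x + v x) *\<^sub>R (Gq x + Gv x))"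
    using Lp_lim_scaleR_continuous[OF ly p0 myn(1) my(1) myn(2) my(2) fin F(2,3)] by auto
  have l1: "Lp_lim p (lebesgue_on \<Omega>) (\<lambda>n x. F (q x + \<psi> (r n) x)) (\<lambda>x. F (q x + v x))"
  proof (rule Lp_lim_comparison[OF Lp_lim_subseq[OF ly(1) r(1)] myn(1) my(1) zero_le_one p0])
    show "AE x in lebesgue_on \<Omega>. norm (F (q x + \<psi> (r n) x) - F (q x + v x)) \<le> 1 * norm (q x + \<psi> (r n) x - (q x + v x))" for n
    proof (rule AE_I2)
      fix x show "norm (F (q x + \<psi> (r n) x) - F (q x + v x)) \<le> 1 * norm (q x + \<psi> (r n) x - (q x + v x))"
        using lip[of "q x + \<psi> (r n) x" "q x + v x"] by simp
    qed
  qed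
  note d = sobolev_diff[OF O(1) p0 chain[OF yn] chain[OF q]]
  show ?thesis
  proof (rule W1p_zero_closed[OF O(1) p0 sobolev_diff[OF O(1) p0 chain[OF y] chain[OF q]] _ d])
    show "(\<lambda>x. F (q x + \<psi> (r n) x) - F (q x)) \<in> W1p_zero p \<Omega>" for n
    proof (rule W1p_zero_compact_support[OF O(1) p d])
      show "compact (K (r n))" "K (r n) \<subseteq> \<Omega>" using s C1_supported_inD(2) by blast+
    qed (use C1_supported_inD(3,4)[OF s(1)] in auto)
    show "Lp_lim p (lebesgue_on \<Omega>) (\<lambda>n x. F (q x + \<psi> (r n) x) - F (q x)) (\<lambda>x. F (q x + v x) - F (q x))"
      using l1 by (simp add: Lp_lim_def)
    show "Lp_lim p (lebesgue_on \<Omega>) (\<lambda>n x. F' (q x + \<psi> (r n) x) *\<^sub>R (Gq x + \<psi>' (r n) x) - F' (q x) *\<^sub>R Gq x)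
       (\<lambda>x. F' (q x + v x) *\<^sub>R (Gq x + Gv x) - F' (q x) *\<^sub>R Gq x)"
      using r(2) by (simp add: Lp_lim_def)
  qed
qed

lemma right_derivative_bounded:
  fixes F :: "real \<Rightarrow> real"
  assumes lip: "\<And>s t. \<bar>F s - F t\<bar> \<le> \<bar>s - t\<bar>" and f: "(F has_real_derivative D) (at_right t)"
  shows "\<bar>D\<bar> \<le> 1"
proof (rule tendsto_upperbound)
  show "((\<lambda>s. \<bar>(F s - F t) / (s - t)\<bar>) \<longlongrightarrow> \<bar>D\<bar>) (at_right t)"
    using f by (intro tendsto_rabs) (simp add: has_field_derivative_iff)
  show "eventually (\<lambda>s. \<bar>(F s - F t) / (s - t)\<bar> \<le> 1) (at_right t)"
    using lip by (intro always_eventually) (auto simp: abs_divide divide_le_eq)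
qed simp

lemma sobolev_chain:
  assumes O: "open \<Omega>" "bounded \<Omega>" and p: "0 < p" and u: "sobolev p \<Omega> u G"
    and lip: "\<And>s t. \<bar>F s - F t\<bar> \<le> \<bar>s - t\<bar>" and f: "\<And>t. (F has_real_derivative f t) (at_right t)"
  shows "sobolev p \<Omega> (\<lambda>x. F (u x)) (\<lambda>x. f (u x) *\<^sub>R G x)"
  using u by (intro sobolev_chain_general[OF O p u has_weak_gradient_chain[OF O(1) _ lip f] lip right_derivative_bounded[OF lip f]]) (simp add: sobolev_def)

text \<open>Here \<open>q\<close> is the boundary datum and \<open>v\<close> the deviation from it;
  later \<open>q = \<phi> - b\<close> and \<open>v = u - \<phi>\<close>. The \<open>C^1\<close>
  approximants of \<open>F\<close> give members of the class that converge together with their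
  gradients, and the class is closed.\<close>

lemma W1p_zero_chain:
  assumes O: "open \<Omega>" "bounded \<Omega>" and p: "1 \<le> p" and q: "sobolev p \<Omega> q Gq"
    and v: "v \<in> W1p_zero p \<Omega>" "sobolev p \<Omega> v Gv"
    and lip: "\<And>s t. \<bar>F s - F t\<bar> \<le> \<bar>s - t\<bar>" and f: "\<And>t. (F has_real_derivative f t) (at_right t)"
  shows "(\<lambda>x. F (q x + v x) - F (q x)) \<in> W1p_zero p \<Omega>"
proof -
  have p0: "0 < p" using p by simp
  obtain Fm fm :: "nat \<Rightarrow> real \<Rightarrow> real" where Fm: "\<And>m t. (Fm m has_real_derivative fm m t) (at t)"
    "\<And>m. continuous_on UNIV (fm m)" "\<And>m t. \<bar>fm m t\<bar> \<le> 1" "\<And>m t. \<bar>Fm m t - F t\<bar> \<le> inverse (real (Suc m))"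
    "\<And>t. (\<lambda>m. fm m t) \<longlonglongrightarrow> f t" using lipschitz_C1_approx[OF lip f] by blast
  have cm: "sobolev p \<Omega> (\<lambda>x. Fm m (u x)) (\<lambda>x. fm m (u x) *\<^sub>R G x)" if "sobolev p \<Omega> u G" for u G m
    using that by (intro sobolev_chain_general[OF O p0 that has_weak_gradient_chain_C1[OF O(1) _ Fm(1,2,3)] DERIV_bounded_lipschitz[OF Fm(1,3)] Fm(3)]) (simp add: sobolev_def)
  note c = sobolev_chain[OF O p0 _ lip f]
  have l1: "Lp_lim p (lebesgue_on \<Omega>) (\<lambda>m x. Fm m (u x)) (\<lambda>x. F (u x))"
    and l2: "Lp_lim p (lebesgue_on \<Omega>) (\<lambda>m x. fm m (u x) *\<^sub>R G x) (\<lambda>x. f (u x) *\<^sub>R G x)" if u: "sobolev p \<Omega> u G" for u G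
  proof -
    have fin: "Lp_mass p (lebesgue_on \<Omega>) G < \<infinity>" using u Lp_space_iff by (auto simp: sobolev_def)
    note l = Lp_lim_lipschitz_approx[OF finite_measure_lebesgue_on_bounded_open[OF O] p0 sobolev_measurable[OF u] fin Fm]
    show "Lp_lim p (lebesgue_on \<Omega>) (\<lambda>m x. Fm m (u x)) (\<lambda>x. F (u x))" by (rule l(1))
    show "Lp_lim p (lebesgue_on \<Omega>) (\<lambda>m x. fm m (u x) *\<^sub>R G x) (\<lambda>x. f (u x) *\<^sub>R G x)" by (rule l(2))
  qed
  note y = sobolev_add[OF O(1) p0 q v(2)]
  have ld: "Lp_lim p (lebesgue_on \<Omega>) (\<lambda>n x. X n x - Y n x) (\<lambda>x. a x - b x)"
    if "Lp_lim p (lebesgue_on \<Omega>) X a" "Lp_lim p (lebesgue_on \<Omega>) Y b"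
      "\<And>n. X n \<in> borel_measurable (lebesgue_on \<Omega>)" "a \<in> borel_measurable (lebesgue_on \<Omega>)"
      "\<And>n. Y n \<in> borel_measurable (lebesgue_on \<Omega>)" "b \<in> borel_measurable (lebesgue_on \<Omega>)"
    for X Y :: "nat \<Rightarrow> 'a \<Rightarrow> 'c::euclidean_space" and a b
  proof -
    have "norm (- Y n x - - b x) = norm (Y n x - b x)" for n x
      by (metis minus_diff_minus norm_minus_cancel)
    then have "Lp_lim p (lebesgue_on \<Omega>) (\<lambda>n x. - Y n x) (\<lambda>x. - b x)"
      using that(2) unfolding Lp_lim_def by simp
    from Lp_lim_add[OF that(1) this p0 that(3,4) borel_measurable_uminus[OF that(5)] borel_measurable_uminus[OF that(6)]]
    show ?thesis by simp
  qed
  show ?thesis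
    by (rule W1p_zero_closed[OF O(1) p0 sobolev_diff[OF O(1) p0 c[OF y] c[OF q]] W1p_zero_chain_C1[OF O p q v Fm(1,2,3)] sobolev_diff[OF O(1) p0 cm[OF y] cm[OF q]]
        ld[OF l1[OF y] l1[OF q] sobolev_measurable(1)[OF cm[OF y]] sobolev_measurable(1)[OF c[OF y]] sobolev_measurable(1)[OF cm[OF q]] sobolev_measurable(1)[OF c[OF q]]]
        ld[OF l2[OF y] l2[OF q] sobolev_measurable(2)[OF cm[OF y]] sobolev_measurable(2)[OF c[OF y]] sobolev_measurable(2)[OF cm[OF q]] sobolev_measurable(2)[OF c[OF q]]]])
qed

section \<open>Approximation by functions bounded above\<close>

lemma lebesgue_on_measurable_AE:
  fixes f g :: "'a::euclidean_space \<Rightarrow> 'b::euclidean_space"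
  assumes S: "S \<in> sets lebesgue" and f: "f \<in> borel_measurable (lebesgue_on S)" and ae: "AE x in lebesgue_on S. f x = g x"
  shows "g \<in> borel_measurable (lebesgue_on S)"
proof -
  have "(\<lambda>x. if x \<in> S then f x else 0) \<in> borel_measurable lebesgue" using f S by (simp add: borel_measurable_if)
  moreover have "AE x in lebesgue. (if x \<in> S then f x else 0) = (if x \<in> S then g x else 0)"
    using ae S by (auto simp: AE_restrict_space_iff elim!: eventually_mono)
  ultimately have "(\<lambda>x. if x \<in> S then g x else 0) \<in> borel_measurable lebesgue" by (rule borel_measurable_AE)
  then show ?thesis using S by (simp add: borel_measurable_if)
qed

text \<open>Along a simple function the composition is measurable piece by piece, and continuity of
  \<open>g x\<close> gives pointwise convergence outside a null set \<open>N\<close>. Sequence and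
  limit are set to 0 on \<open>N\<close>; completeness of Lebesgue measure undoes this
  change.\<close>

lemma Caratheodory_measurable:
  fixes G :: "'a::euclidean_space \<Rightarrow> 'a"
  assumes S: "\<Omega> \<in> sets lebesgue" and g: "Caratheodory \<Omega> g" and G: "G \<in> borel_measurable (lebesgue_on \<Omega>)"
  shows "(\<lambda>x. g x (G x)) \<in> borel_measurable (lebesgue_on \<Omega>)"
proof -
  let ?M = "lebesgue_on \<Omega>"
  obtain s where s: "\<And>i. simple_function ?M (s i)" "\<And>x. x \<in> space ?M \<Longrightarrow> (\<lambda>i. s i x) \<longlonglongrightarrow> G x"
    using borel_measurable_implies_sequence_metric[OF G, of 0] by blast
  have gm: "(\<lambda>x. g x \<xi>) \<in> borel_measurable ?M" for \<xi> using g by (simp add: Caratheodory_def)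
  have ms: "(\<lambda>x. g x (s i x)) \<in> borel_measurable ?M" for i
  proof (rule measurable_compose_countable'[where f = "\<lambda>\<xi> x. g x \<xi>" and I = "s i ` space ?M"])
    show "s i \<in> measurable ?M (count_space (s i ` space ?M))"
      using simple_functionD[OF s(1)[of i]] by (subst measurable_count_space_eq2) auto
    show "countable (s i ` space ?M)" using simple_functionD(1)[OF s(1)[of i]] by (rule countable_finite)
  qed (rule gm)
  have "AE x in ?M. continuous_on UNIV (g x)" using g by (simp add: Caratheodory_def)
  then have "AE x in lebesgue. x \<in> \<Omega> \<longrightarrow> continuous_on UNIV (g x)" using S by (auto simp: AE_restrict_space_iff)
  then obtain N where N: "{x. \<not> (x \<in> \<Omega> \<longrightarrow> continuous_on UNIV (g x))} \<subseteq> N" "emeasure lebesgue N = 0" "N \<in> sets lebesgue"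
    by (rule AE_E) simp
  have Nn: "N \<in> null_sets lebesgue" using N(2,3) by auto
  have Ns: "N \<inter> space ?M \<in> sets ?M" using N(3) by (auto simp: sets_restrict_space)
  have "(\<lambda>x. if x \<in> N then 0 else g x (G x)) \<in> borel_measurable ?M"
  proof (rule borel_measurable_LIMSEQ_metric)
    show "(\<lambda>x. if x \<in> N then 0 else g x (s i x)) \<in> borel_measurable ?M" for i
      using ms[of i] Ns by (intro measurable_If_set) auto
    fix x assume x: "x \<in> space ?M"
    show "(\<lambda>i. if x \<in> N then 0 else g x (s i x)) \<longlonglongrightarrow> (if x \<in> N then 0 else g x (G x))"
    proof (cases "x \<in> N")
      case False
      then have "continuous_on UNIV (g x)" using N(1) x by auto
      then have "isCont (g x) (G x)" by (simp add: continuous_on_eq_continuous_at)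
      from isCont_tendsto_compose[OF this s(2)[OF x]] show ?thesis using False by simp
    qed simp
  qed
  moreover have "AE x in ?M. (if x \<in> N then 0 else g x (G x)) = g x (G x)"
    using AE_not_in[OF Nn] S by (auto simp: AE_restrict_space_iff elim!: eventually_mono)
  ultimately show ?thesis by (rule lebesgue_on_measurable_AE[OF S])
qed

lemma W1p_zero_cong:
  assumes O: "open \<Omega>" and p: "0 < p" and v: "v \<in> W1p_zero p \<Omega>"
    and m: "v' \<in> borel_measurable (lebesgue_on \<Omega>)" and ae: "AE x in lebesgue_on \<Omega>. v' x = v x"
  shows "v' \<in> W1p_zero p \<Omega>"
proof -
  obtain G where G: "sobolev p \<Omega> v G" using v by (auto simp: W1p_zero_def W1p_iff)
  obtain K \<psi> \<psi>' where s: "\<And>n::nat. C1_supported_in (K n) (\<psi> n) (\<psi>' n)" "\<And>n. K n \<subseteq> \<Omega>"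
    and lim: "Lp_lim p (lebesgue_on \<Omega>) \<psi> v" "Lp_lim p (lebesgue_on \<Omega>) \<psi>' G" by (rule W1p_zero_approx[OF O p v G]) (rule that)
  have "Lp_mass p (lebesgue_on \<Omega>) (\<lambda>x. \<psi> n x - v' x) = Lp_mass p (lebesgue_on \<Omega>) (\<lambda>x. \<psi> n x - v x)" for n
    by (rule nn_integral_cong_AE) (use ae in \<open>eventually_elim, simp\<close>)
  then have "Lp_lim p (lebesgue_on \<Omega>) \<psi> v'" using lim(1) unfolding Lp_lim_def by simp
  then show ?thesis
    using W1p_zeroI_C1_supported_in[OF O p sobolev_cong[OF O p G m sobolev_measurable(2)[OF G] ae] s _ lim(2)] by simp
qed

lemma W1p_zero_minus:
  assumes O: "open \<Omega>" and p: "0 < p" and v: "v \<in> W1p_zero p \<Omega>"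
  shows "(\<lambda>x. - v x) \<in> W1p_zero p \<Omega>"
proof -
  obtain G where G: "sobolev p \<Omega> v G" using v by (auto simp: W1p_zero_def W1p_iff)
  obtain K \<psi> \<psi>' where s: "\<And>n::nat. C1_supported_in (K n) (\<psi> n) (\<psi>' n)" "\<And>n. K n \<subseteq> \<Omega>"
    and lim: "Lp_lim p (lebesgue_on \<Omega>) \<psi> v" "Lp_lim p (lebesgue_on \<Omega>) \<psi>' G" by (rule W1p_zero_approx[OF O p v G]) (rule that)
  have s': "C1_supported_in (K n) (\<lambda>x. - \<psi> n x) (\<lambda>x. - \<psi>' n x)" for n
    using s(1)[of n] unfolding C1_supported_in_def C1_grad_def by (simp add: continuous_on_minus GDERIV_minus)
  have n: "norm (- a - - b) = norm (a - b)" for a b :: "'c::euclidean_space"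
    by (metis minus_diff_minus norm_minus_cancel)
  have "Lp_lim p (lebesgue_on \<Omega>) (\<lambda>n x. - \<psi> n x) (\<lambda>x. - v x)" "Lp_lim p (lebesgue_on \<Omega>) (\<lambda>n x. - \<psi>' n x) (\<lambda>x. - G x)"
    using lim unfolding Lp_lim_def n .
  then show ?thesis using W1p_zeroI_C1_supported_in[OF O p sobolev_minus[OF O G], of K "\<lambda>n x. - \<psi> n x" "\<lambda>n x. - \<psi>' n x"] s' s(2) by blast
qed

text \<open>\<open>f\<close> is the right derivative, defined at every point as the chain rule
  requires. The bounds above \<open>t\<close> have two uses: they give
  \<open>\<bar>F s - s\<bar> \<le> \<bar>s\<bar>\<close> for \<open>s \<ge> t\<close>, the
  domination for \<open>L^p\<close> convergence, and their sign keeps the new function from dropping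
  far where the old one is large.\<close>

definition upper_cutoff :: "real \<Rightarrow> (real \<Rightarrow> real) \<Rightarrow> (real \<Rightarrow> real) \<Rightarrow> bool" where
  "upper_cutoff t F f \<longleftrightarrow> (\<forall>s s'. \<bar>F s - F s'\<bar> \<le> \<bar>s - s'\<bar>) \<and> (\<forall>s. (F has_real_derivative f s) (at_right s)) \<and>
     (\<forall>s\<le>t. F s = s) \<and> (\<forall>s\<ge>t. 0 \<le> F s \<and> F s \<le> t)"

section \<open>Truncations and zigzags\<close>

lemma has_right_derivativeI:
  fixes F :: "real \<Rightarrow> real"
  assumes "0 < d" "\<And>s'. s < s' \<Longrightarrow> s' < s + d \<Longrightarrow> F s' = F s + D * (s' - s)"
  shows "(F has_real_derivative D) (at_right s)"
proof -
  have "eventually (\<lambda>s'. (F s' - F s) / (s' - s) = D) (at_right s)"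
    unfolding eventually_at_right_field by (intro exI[of _ "s + d"]) (use assms in \<open>auto simp: field_simps\<close>)
  then show ?thesis unfolding has_field_derivative_iff by (rule tendsto_eventually)
qed

lemma has_right_derivative_unique:
  fixes F :: "real \<Rightarrow> real"
  assumes "(F has_real_derivative D) (at_right s)" "(F has_real_derivative E) (at_right s)"
  shows "D = E"
  using assms unfolding has_field_derivative_iff by (rule tendsto_unique[rotated]) simp

lemma upper_cutoff_derivative:
  assumes "upper_cutoff t F f" "s < t" shows "f s = 1"
proof -
  have "(F has_real_derivative 1) (at_right s)"
    by (rule has_right_derivativeI[of "t - s"]) (use assms in \<open>auto simp: upper_cutoff_def\<close>)
  moreover have "(F has_real_derivative f s) (at_right s)" using assms(1) by (simp add: upper_cutoff_def)
  ultimately show ?thesis using has_right_derivative_unique by blast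
qed

lemma upper_cutoff_min:
  assumes "0 \<le> t" shows "upper_cutoff t (\<lambda>s. min s t) (\<lambda>s. if s < t then 1 else 0)"
  unfolding upper_cutoff_def
proof (intro conjI allI impI)
  show "((\<lambda>s. min s t) has_real_derivative (if s < t then 1 else 0)) (at_right s)" for s
    by (rule has_right_derivativeI[of "if s < t then t - s else 1"]) (auto split: if_splits)
qed (use assms in auto)

text \<open>Above \<open>t\<close>, \<open>F s\<close> is \<open>t\<close> minus the distance from
  \<open>s\<close> to the lattice \<open>t + 2 * d * \<int>\<close> with \<open>d = t - h\<close>:
  it descends to \<open>h\<close> with slope -1, climbs back to \<open>t\<close> with slope 1, and
  repeats.\<close>

lemma upper_cutoff_zigzag:
  assumes h: "0 \<le> h" "h < t"
  obtains F f where "upper_cutoff t F f" "\<And>s. f s = 1 \<or> f s = - 1" "\<And>s. t \<le> s \<Longrightarrow> h \<le> F s \<and> F s \<le> t"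
proof -
  define d where "d = t - h"
  have d: "0 < d" using h by (simp add: d_def)
  \<comment> \<open>The distance to the nearest integer: 1-Lipschitz, with values in
    \<open>[0, 1/2]\<close> and right derivatives 1 or -1.\<close>
  define tri :: "real \<Rightarrow> real" where "tri z = \<bar>z - of_int (round z)\<bar>" for z
  have tri_lip: "\<bar>tri z - tri w\<bar> \<le> \<bar>z - w\<bar>" for z w
    using round_diff_minimal[of z "round w"] round_diff_minimal[of w "round z"] unfolding tri_def by linarith
  have tri01: "0 \<le> tri z" "tri z \<le> 1/2" for z
    using of_int_round_abs_le[of z] unfolding tri_def by (auto simp: abs_minus_commute)
  have tri_der: "\<exists>e>0. \<exists>D. (D = 1 \<or> D = - 1) \<and> (\<forall>w. z < w \<and> w < z + e \<longrightarrow> tri w = tri z + D * (w - z))" for z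
  proof -
    define n where "n = \<lfloor>z\<rfloor>"
    have n: "of_int n \<le> z" "z < of_int n + 1" by (auto simp: n_def)
    show ?thesis
    proof (cases "z < of_int n + 1/2")
      case True
      have r: "round w = n" if "of_int n \<le> w" "w < of_int n + 1/2" for w
        unfolding round_def using that by (intro floor_unique) auto
      show ?thesis
      proof (rule exI[of _ "of_int n + 1/2 - z"], rule conjI)
        show "\<exists>D. (D = 1 \<or> D = - 1) \<and> (\<forall>w. z < w \<and> w < z + (of_int n + 1/2 - z) \<longrightarrow> tri w = tri z + D * (w - z))"
          by (rule exI[of _ 1]) (use n True in \<open>auto simp: tri_def r\<close>)
      qed (use True in simp)
    next
      case False
      have r: "round w = n + 1" if "of_int n + 1/2 \<le> w" "w < of_int n + 1" for w
        unfolding round_def using that by (intro floor_unique) auto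
      show ?thesis
      proof (rule exI[of _ "of_int n + 1 - z"], rule conjI)
        show "\<exists>D. (D = 1 \<or> D = - 1) \<and> (\<forall>w. z < w \<and> w < z + (of_int n + 1 - z) \<longrightarrow> tri w = tri z + D * (w - z))"
          by (rule exI[of _ "- 1"]) (use n False in \<open>auto simp: tri_def r\<close>)
      qed (use n in simp)
    qed
  qed
  \<comment> \<open>The factor \<open>2 * d\<close> scales height and period alike: slopes remain 1
    and -1, while the range \<open>[0, 1/2]\<close> of \<open>tri\<close> is carried onto the
    interval from \<open>h\<close> to \<open>t\<close>.\<close>
  define F where "F s = (if s \<le> t then s else t - 2 * d * tri ((s - t) / (2 * d)))" for s
  have F2: "F s = t - 2 * d * tri ((s - t) / (2 * d))" if "t \<le> s" for s
    using that by (auto simp: F_def tri_def)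
  have lip2: "\<bar>F s - F s'\<bar> \<le> \<bar>s - s'\<bar>" if "t \<le> s" "t \<le> s'" for s s'
  proof -
    have "F s - F s' = 2 * d * (tri ((s' - t) / (2 * d)) - tri ((s - t) / (2 * d)))" using that by (simp add: F2 algebra_simps)
    then have "\<bar>F s - F s'\<bar> = 2 * d * \<bar>tri ((s' - t) / (2 * d)) - tri ((s - t) / (2 * d))\<bar>" using d by (simp add: abs_mult)
    also have "\<dots> \<le> 2 * d * \<bar>(s' - t) / (2 * d) - (s - t) / (2 * d)\<bar>" using d by (intro mult_left_mono tri_lip) auto
    also have "\<dots> = \<bar>s - s'\<bar>" using d by (simp add: diff_divide_distrib[symmetric] abs_divide abs_minus_commute)
    finally show ?thesis .
  qed
  have lip: "\<bar>F s - F s'\<bar> \<le> \<bar>s - s'\<bar>" for s s'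
  proof -
    have mixed: "\<bar>F s - F s'\<bar> \<le> \<bar>s - s'\<bar>" if "s \<le> t" "t \<le> s'" for s s'
      using lip2[OF order_refl that(2)] that(1,2) by (simp add: F_def split: if_splits)
    consider "s \<le> t" "s' \<le> t" | "s \<le> t" "t \<le> s'" | "t \<le> s" "s' \<le> t" | "t \<le> s" "t \<le> s'" by linarith
    then show ?thesis
    proof cases
      case 1 then show ?thesis by (simp add: F_def)
    next
      case 2 then show ?thesis by (rule mixed)
    next
      case 3 then show ?thesis using mixed[of s' s] by (simp add: abs_minus_commute)
    next
      case 4 then show ?thesis by (rule lip2)
    qed
  qed
  have "\<exists>D. (D = 1 \<or> D = - 1) \<and> (F has_real_derivative D) (at_right s)" for s
  proof (cases "s < t")
    case True
    have "(F has_real_derivative 1) (at_right s)"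
      by (rule has_right_derivativeI[of "t - s"]) (use True in \<open>auto simp: F_def\<close>)
    then show ?thesis by blast
  next
    case False
    define z where "z = (s - t) / (2 * d)"
    obtain e D where e: "0 < e" "D = 1 \<or> D = - 1" "\<And>w. z < w \<Longrightarrow> w < z + e \<Longrightarrow> tri w = tri z + D * (w - z)"
      using tri_der[of z] by blast
    have "(F has_real_derivative (- D)) (at_right s)"
    proof (rule has_right_derivativeI[of "2 * d * e"])
      fix s' assume s': "s < s'" "s' < s + 2 * d * e"
      define w where "w = (s' - t) / (2 * d)"
      have w: "w - z = (s' - s) / (2 * d)" by (simp add: w_def z_def diff_divide_distrib[symmetric])
      have "0 < w - z" "w - z < e" unfolding w using d s' by (auto simp: pos_divide_less_eq algebra_simps)
      then have "tri w = tri z + D * (w - z)" using e(3)[of w] by simp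
      moreover have "F s' = t - 2 * d * tri w" "F s = t - 2 * d * tri z" using False s' by (auto simp: F2 w_def z_def)
      moreover have "2 * d * (D * (w - z)) = D * (s' - s)" unfolding w using d by simp
      ultimately show "F s' = F s + - D * (s' - s)" by (simp add: distrib_left)
    qed (use d e in auto)
    then show ?thesis using e(2) by (intro exI[of _ "- D"]) auto
  qed
  then obtain f where f: "\<And>s. f s = 1 \<or> f s = - 1" "\<And>s. (F has_real_derivative f s) (at_right s)" by metis
  have range: "h \<le> F s \<and> F s \<le> t" if "t \<le> s" for s
  proof -
    have "2 * d * tri ((s - t) / (2 * d)) \<le> 2 * d * (1/2)" "0 \<le> 2 * d * tri ((s - t) / (2 * d))"
      using d tri01[of "(s - t) / (2 * d)"] by (intro mult_left_mono mult_nonneg_nonneg; simp)+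
    then show ?thesis using that by (simp add: F2 d_def)
  qed
  show ?thesis
  proof (rule that[of F f])
    have "0 \<le> F s \<and> F s \<le> t" if "t \<le> s" for s using range[OF that] h(1) by linarith
    moreover have "F s = s" if "s \<le> t" for s using that by (simp add: F_def)
    ultimately show "upper_cutoff t F f" unfolding upper_cutoff_def using lip f(2) by blast
  qed (use f(1) range in auto)
qed

text \<open>The last clause records that a lower bound of \<open>u\<close> survives up to the
  constant \<open>B\<close>. Applied to the negative of a function bounded above, it prevents the
  second pass from destroying what the first achieved. The upper bound \<open>C\<close> may depend
  on \<epsilon>; \<open>B\<close> may not.\<close>

definition approx_from_below :: "real \<Rightarrow> 'a::euclidean_space set \<Rightarrow> ('a \<Rightarrow> real) \<Rightarrow> ('a \<Rightarrow> real \<Rightarrow> 'a \<Rightarrow> real) \<Rightarrow> ('a \<Rightarrow> real) \<Rightarrow> bool" where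
  "approx_from_below p \<Omega> \<phi> L u \<longleftrightarrow> (\<exists>B. \<forall>\<epsilon>>0. \<exists>w\<in>admissible p \<Omega> \<phi> L. W1p_norm p \<Omega> (\<lambda>x. w x - u x) < \<epsilon> \<and>
     (LINT x|lebesgue_on \<Omega>. \<bar>along \<Omega> L w x - along \<Omega> L u x\<bar>) < \<epsilon> \<and>
     (\<exists>C. AE x in lebesgue_on \<Omega>. w x \<le> C) \<and> (AE x in lebesgue_on \<Omega>. min (u x) (- B) \<le> w x))"

section \<open>One-sided approximation from a family of cutoffs\<close>

lemma W1p_boundary_sobolev:
  assumes O: "open \<Omega>" and p: "0 < p" and \<phi>: "sobolev p \<Omega> \<phi> G\<phi>" and u: "u \<in> W1p_boundary p \<Omega> \<phi>"
  shows "sobolev p \<Omega> u (weak_grad \<Omega> u)" and "(\<lambda>x. u x - \<phi> x) \<in> W1p_zero p \<Omega>"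
proof -
  obtain v where v: "v \<in> W1p_zero p \<Omega>" "u = (\<lambda>x. \<phi> x + v x)" using u by (auto simp: W1p_boundary_def)
  obtain G where "sobolev p \<Omega> v G" using v by (auto simp: W1p_zero_def W1p_iff)
  from sobolev_add[OF O p \<phi> this] have "sobolev p \<Omega> u (\<lambda>x. G\<phi> x + G x)" by (simp add: v(2))
  then show "sobolev p \<Omega> u (weak_grad \<Omega> u)" by (rule sobolev_weak_grad[OF O p])
  show "(\<lambda>x. u x - \<phi> x) \<in> W1p_zero p \<Omega>" using v by simp
qed

lemma W1p_boundaryI: "(\<lambda>x. u x - \<phi> x) \<in> W1p_zero p \<Omega> \<Longrightarrow> u \<in> W1p_boundary p \<Omega> \<phi>"
  unfolding W1p_boundary_def by (auto intro!: exI[of _ "\<lambda>x. u x - \<phi> x"])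

lemma along_measurable:
  assumes O: "open \<Omega>" and p: "0 < p" and a: "continuous_on UNIV a" and g: "Caratheodory \<Omega> g" and w: "sobolev p \<Omega> w W"
  shows "along \<Omega> (\<lambda>x t \<xi>. a t * g x \<xi>) w \<in> borel_measurable (lebesgue_on \<Omega>)"
proof -
  have S: "\<Omega> \<in> sets lebesgue" using O by auto
  have am: "a \<in> borel_measurable borel" using a by (rule borel_measurable_continuous_onI)
  have "(\<lambda>x. a (w x)) \<in> borel_measurable (lebesgue_on \<Omega>)" by (rule measurable_compose[OF sobolev_measurable(1)[OF w] am])
  moreover have "(\<lambda>x. g x (weak_grad \<Omega> w x)) \<in> borel_measurable (lebesgue_on \<Omega>)"
    by (rule Caratheodory_measurable[OF S g sobolev_measurable(2)[OF sobolev_weak_grad[OF O p w]]])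
  ultimately have "(\<lambda>x. a (w x) * g x (weak_grad \<Omega> w x)) \<in> borel_measurable (lebesgue_on \<Omega>)" by (rule borel_measurable_times)
  then show ?thesis unfolding along_def .
qed

text \<open>With \<open>y = u - b\<close>, the integrands along \<open>w k\<close> and along
  \<open>u\<close> differ a.e. only where \<open>t k \<le> y\<close>, and each point leaves these
  sets since \<open>t k \<ge> k\<close>. As \<open>h\<close> does not depend on \<open>k\<close>,
  dominated convergence gives the \<open>L^1\<close> limit. The hypothesis asks for some levels
  beyond every \<open>k\<close>, which leaves the freedom to choose good ones.\<close>

lemma approx_from_below_cutoff:
  fixes g :: "'a::euclidean_space \<Rightarrow> 'a \<Rightarrow> real"
  defines "L \<equiv> \<lambda>a g x t \<xi>. a t * g x \<xi>"
  assumes O: "open \<Omega>" "bounded \<Omega>" and p: "1 \<le> p" and \<phi>: "sobolev p \<Omega> \<phi> G\<phi>" "AE x in lebesgue_on \<Omega>. \<bar>\<phi> x\<bar> \<le> C\<phi>"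
    and a: "continuous_on UNIV a" and g: "Caratheodory \<Omega> g"
    and b: "sobolev p \<Omega> b Gb" "AE x in lebesgue_on \<Omega>. \<bar>b x\<bar> \<le> B"
    and h: "integrable (lebesgue_on \<Omega>) h"
    and u: "u \<in> admissible p \<Omega> \<phi> (L a g)"
    and cut: "\<And>k::nat. \<exists>F f t. real k \<le> t \<and> upper_cutoff t F f \<and>
       (AE x in lebesgue_on \<Omega>. t \<le> u x - b x \<longrightarrow> \<bar>a (F (u x - b x) + b x) * g x (f (u x - b x) *\<^sub>R (weak_grad \<Omega> u x - Gb x) + Gb x)\<bar> \<le> h x)"
  shows "approx_from_below p \<Omega> \<phi> (L a g) u"
proof -
  let ?M = "lebesgue_on \<Omega>"
  have p0: "0 < p" using p by simp
  define P where "P k F f t \<longleftrightarrow> real k \<le> t \<and> upper_cutoff t F f \<and>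
       (AE x in ?M. t \<le> u x - b x \<longrightarrow> \<bar>a (F (u x - b x) + b x) * g x (f (u x - b x) *\<^sub>R (weak_grad \<Omega> u x - Gb x) + Gb x)\<bar> \<le> h x)" for k :: nat and F f t
  have "\<exists>F f t. P k F f t" for k unfolding P_def by (rule cut)
  then obtain F f t where "\<And>k. P k (F k) (f k) (t k)" by metis
  then have kt: "\<And>k::nat. real k \<le> t k" and Ff: "\<And>k. upper_cutoff (t k) (F k) (f k)"
    and dom: "\<And>k. AE x in ?M. t k \<le> u x - b x \<longrightarrow> \<bar>a (F k (u x - b x) + b x) * g x (f k (u x - b x) *\<^sub>R (weak_grad \<Omega> u x - Gb x) + Gb x)\<bar> \<le> h x"
    unfolding P_def by blast+
  have lip: "\<bar>F k s - F k s'\<bar> \<le> \<bar>s - s'\<bar>" and der: "(F k has_real_derivative f k s) (at_right s)"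
    and Fid: "s \<le> t k \<Longrightarrow> F k s = s" and Fr: "t k \<le> s \<Longrightarrow> 0 \<le> F k s" "t k \<le> s \<Longrightarrow> F k s \<le> t k" for k s s'
    using Ff[of k] by (auto simp: upper_cutoff_def)
  have f1: "s < t k \<Longrightarrow> f k s = 1" for k s using upper_cutoff_derivative[OF Ff] .
  have fb: "\<bar>f k s\<bar> \<le> 1" for k s by (rule right_derivative_bounded[OF lip der])
  have ub: "u \<in> W1p_boundary p \<Omega> \<phi>" and ui: "integrable ?M (along \<Omega> (L a g) u)" using u by (auto simp: admissible_def)
  note us = W1p_boundary_sobolev(1)[OF O(1) p0 \<phi>(1) ub] and uz = W1p_boundary_sobolev(2)[OF O(1) p0 \<phi>(1) ub]
  define y where "y x = u x - b x" for x
  define Gy where "Gy x = weak_grad \<Omega> u x - Gb x" for x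
  have ys: "sobolev p \<Omega> y Gy" unfolding y_def Gy_def by (rule sobolev_diff[OF O(1) p0 us b(1)])
  define w where "w k x = F k (y x) + b x" for k x
  define W where "W k x = f k (y x) *\<^sub>R Gy x + Gb x" for k x
  note Fs = sobolev_chain[OF O p0 ys lip der]
  have ws: "sobolev p \<Omega> (w k) (W k)" for k unfolding w_def W_def by (rule sobolev_add[OF O(1) p0 Fs b(1)])
  have wg: "AE x in ?M. weak_grad \<Omega> (w k) x = W k x" for k using weak_grad_AE[OF O(1)] ws by (simp add: sobolev_def)
  have yL: "y \<in> Lp_space p \<Omega>" "Gy \<in> Lp_space p \<Omega>" using ys by (auto simp: sobolev_def)

  have bdry: "w k \<in> W1p_boundary p \<Omega> \<phi>" if k: "C\<phi> + B \<le> real k" for k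
  proof (rule W1p_boundaryI)
    have qs: "sobolev p \<Omega> (\<lambda>x. \<phi> x - b x) (\<lambda>x. G\<phi> x - Gb x)" by (rule sobolev_diff[OF O(1) p0 \<phi>(1) b(1)])
    have vs: "sobolev p \<Omega> (\<lambda>x. u x - \<phi> x) (\<lambda>x. weak_grad \<Omega> u x - G\<phi> x)" by (rule sobolev_diff[OF O(1) p0 us \<phi>(1)])
    have "(\<lambda>x. F k ((\<phi> x - b x) + (u x - \<phi> x)) - F k (\<phi> x - b x)) \<in> W1p_zero p \<Omega>"
      by (rule W1p_zero_chain[OF O p qs uz vs lip der])
    moreover have "(\<lambda>x. w k x - \<phi> x) \<in> borel_measurable ?M"
      using sobolev_measurable(1)[OF ws] sobolev_measurable(1)[OF \<phi>(1)] by (rule borel_measurable_diff)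
    moreover have "AE x in ?M. w k x - \<phi> x = F k ((\<phi> x - b x) + (u x - \<phi> x)) - F k (\<phi> x - b x)"
      using \<phi>(2) b(2)
    proof eventually_elim
      case (elim x)
      \<comment> \<open>Boundedness of \<phi> and \<open>b\<close> keeps \<open>\<phi> - b\<close>
        below the level, so \<open>F k\<close> does not move the boundary datum.\<close>
      have "F k (\<phi> x - b x) = \<phi> x - b x" using elim k kt[of k] by (intro Fid) linarith
      then show ?case by (simp add: w_def y_def)
    qed
    ultimately show "(\<lambda>x. w k x - \<phi> x) \<in> W1p_zero p \<Omega>" by (rule W1p_zero_cong[OF O(1) p0])
  qed

  have awm: "along \<Omega> (L a g) (w k) \<in> borel_measurable ?M" for k
    unfolding L_def by (rule along_measurable[OF O(1) p0 a g ws])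
  have diff_le: "AE x in ?M. \<bar>along \<Omega> (L a g) (w k) x - along \<Omega> (L a g) u x\<bar> \<le>
      (\<bar>h x\<bar> + \<bar>along \<Omega> (L a g) u x\<bar>) * indicator {x. t k \<le> y x} x" for k
    using wg[of k] dom[of k]
  proof eventually_elim
    case (elim x)
    show ?case
    proof (cases "t k \<le> y x")
      case True
      have "\<bar>along \<Omega> (L a g) (w k) x\<bar> \<le> h x"
        using elim True by (simp add: along_def L_def w_def W_def y_def Gy_def)
      then show ?thesis using True by simp
    next
      case False
      \<comment> \<open>Strictly below the level the right derivative is 1. At the level itself it
        may differ, so \<open>y x = t k\<close> is counted in the tail.\<close>
      then have "w k x = u x" "W k x = weak_grad \<Omega> u x" by (simp_all add: w_def W_def Fid f1 y_def Gy_def)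
      then show ?thesis using elim False by (simp add: along_def L_def)
    qed
  qed
  have ind: "(\<lambda>x. indicator {x. t k \<le> y x} x :: real) \<in> borel_measurable ?M" for k
    using sobolev_measurable(1)[OF ys] by measurable
  let ?D = "\<lambda>k x. \<bar>along \<Omega> (L a g) (w k) x - along \<Omega> (L a g) u x\<bar>"
  have hi: "integrable ?M (\<lambda>x. \<bar>h x\<bar> + \<bar>along \<Omega> (L a g) u x\<bar>)" using h ui by auto
  have Dm: "?D k \<in> borel_measurable ?M" for k
    using awm[of k] borel_measurable_integrable[OF ui] by measurable
  have Ddom: "AE x in ?M. norm (?D k x) \<le> \<bar>h x\<bar> + \<bar>along \<Omega> (L a g) u x\<bar>" for k
    using diff_le[of k]
  proof eventually_elim
    case (elim x) then show ?case by (cases "t k \<le> y x") simp_all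
  qed
  have Di: "integrable ?M (?D k)" for k
    by (rule Bochner_Integration.integrable_bound[OF hi Dm]) (use Ddom[of k] in \<open>eventually_elim, simp\<close>)
  have tail: "eventually (\<lambda>k. \<not> t k \<le> y x) sequentially" for x
  proof -
    obtain m where "y x < real m" using reals_Archimedean2 by blast
    then have "\<not> t k \<le> y x" if "m \<le> k" for k using kt[of k] that by simp
    then show ?thesis by (auto simp: eventually_sequentially)
  qed
  have "(\<lambda>k. LINT x|?M. ?D k x) \<longlonglongrightarrow> (LINT x|?M. 0)"
  proof (rule integral_dominated_convergence[OF _ Dm hi _ Ddom])
    have "AE x in ?M. \<forall>k. ?D k x \<le> (\<bar>h x\<bar> + \<bar>along \<Omega> (L a g) u x\<bar>) * indicator {x. t k \<le> y x} x"
      using diff_le by (subst AE_all_countable) blast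
    then show "AE x in ?M. (\<lambda>k. ?D k x) \<longlonglongrightarrow> 0"
    proof eventually_elim
      case (elim x)
      have "eventually (\<lambda>k. ?D k x = 0) sequentially"
        using tail[of x]
      proof eventually_elim
        case (elim k) then show ?case using \<open>\<forall>k. ?D k x \<le> _ k\<close>[rule_format, of k] by simp
      qed
      then show ?case by (rule tendsto_eventually)
    qed
  qed simp
  then have Dlim: "(\<lambda>k. LINT x|?M. ?D k x) \<longlonglongrightarrow> 0" by simp

  have wu: "Lp_lim p ?M w u"
  proof (rule Lp_lim_dominated[OF sobolev_measurable(1)[OF ws] sobolev_measurable(1)[OF us] _ p0])
    show "(\<lambda>x. norm (y x)) \<in> borel_measurable ?M" using sobolev_measurable(1)[OF ys] by measurable
    show "AE x in ?M. norm (w n x - u x) \<le> norm (y x)" for n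
    proof (rule AE_I2)
      fix x
      show "norm (w n x - u x) \<le> norm (y x)"
      proof (cases "t n \<le> y x")
        case True
        have "w n x - u x = F n (y x) - y x" by (simp add: w_def y_def)
        then show ?thesis using Fr[OF True] True kt[of n] by simp
      next
        case False
        then show ?thesis by (simp add: w_def Fid) (simp add: y_def)
      qed
    qed
    show "Lp_mass p ?M y < \<infinity>" using yL by (simp add: Lp_space_iff)
    show "AE x in ?M. (\<lambda>n. w n x) \<longlonglongrightarrow> u x"
    proof (rule AE_I2, rule tendsto_eventually)
      fix x show "eventually (\<lambda>n. w n x = u x) sequentially"
        using tail[of x] by eventually_elim (simp add: w_def Fid, simp add: y_def)
    qed
  qed
  have Wu: "Lp_lim p ?M W (weak_grad \<Omega> u)"
  proof (rule Lp_lim_dominated[OF sobolev_measurable(2)[OF ws] sobolev_measurable(2)[OF us] _ p0])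
    show "(\<lambda>x. norm (Gy x + Gy x)) \<in> borel_measurable ?M" using sobolev_measurable(2)[OF ys] by measurable
    show "AE x in ?M. norm (W n x - weak_grad \<Omega> u x) \<le> norm (Gy x + Gy x)" for n
    proof (rule AE_I2)
      fix x
      have "W n x - weak_grad \<Omega> u x = (f n (y x) - 1) *\<^sub>R Gy x" by (simp add: W_def Gy_def algebra_simps)
      then have "norm (W n x - weak_grad \<Omega> u x) = \<bar>f n (y x) - 1\<bar> * norm (Gy x)" by simp
      also have "\<dots> \<le> 2 * norm (Gy x)" using fb[of n "y x"] by (intro mult_right_mono) auto
      also have "\<dots> = norm (Gy x + Gy x)" by (simp add: scaleR_2[symmetric])
      finally show "norm (W n x - weak_grad \<Omega> u x) \<le> norm (Gy x + Gy x)" .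
    qed
    show "Lp_mass p ?M (\<lambda>x. Gy x + Gy x) < \<infinity>" using Lp_space_add[OF yL(2) yL(2) p0] by (simp add: Lp_space_iff)
    show "AE x in ?M. (\<lambda>n. W n x) \<longlonglongrightarrow> weak_grad \<Omega> u x"
    proof (rule AE_I2, rule tendsto_eventually)
      fix x show "eventually (\<lambda>n. W n x = weak_grad \<Omega> u x) sequentially"
        using tail[of x] by eventually_elim (simp add: W_def f1, simp add: Gy_def)
    qed
  qed
  have Wlim: "(\<lambda>k. W1p_norm p \<Omega> (\<lambda>x. w k x - u x)) \<longlonglongrightarrow> 0"
    using W1p_norm_diff_tendsto_zero_iff[OF O(1) p0, of w W u "weak_grad \<Omega> u"] ws us wu Wu by simp
  show ?thesis
    unfolding approx_from_below_def
  proof (intro exI[of _ B] allI impI)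
    fix \<epsilon> :: real assume \<epsilon>: "0 < \<epsilon>"
    \<comment> \<open>For smaller \<open>k\<close> the function \<open>w k\<close> need not have the
      boundary values of \<phi>.\<close>
    have "eventually (\<lambda>k. C\<phi> + B \<le> real k) sequentially"
      using filterlim_real_sequentially unfolding filterlim_at_top by blast
    then have "eventually (\<lambda>k. C\<phi> + B \<le> real k \<and> W1p_norm p \<Omega> (\<lambda>x. w k x - u x) < \<epsilon> \<and> (LINT x|?M. ?D k x) < \<epsilon>) sequentially"
      using order_tendstoD(2)[OF Wlim \<epsilon>] order_tendstoD(2)[OF Dlim \<epsilon>] by eventually_elim simp
    then obtain k where k: "C\<phi> + B \<le> real k" "W1p_norm p \<Omega> (\<lambda>x. w k x - u x) < \<epsilon>" "(LINT x|?M. ?D k x) < \<epsilon>"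
      by (auto simp: eventually_sequentially)
    have "integrable ?M (along \<Omega> (L a g) (w k))"
    proof (rule Bochner_Integration.integrable_bound[OF Bochner_Integration.integrable_add[OF Di[of k] integrable_abs[OF ui]] awm])
      show "AE x in ?M. norm (along \<Omega> (L a g) (w k) x) \<le> norm (?D k x + \<bar>along \<Omega> (L a g) u x\<bar>)"
        by (rule AE_I2) simp
    qed
    then have adm: "w k \<in> admissible p \<Omega> \<phi> (L a g)" using bdry[OF k(1)] by (simp add: admissible_def)
    have "AE x in ?M. w k x \<le> t k + B"
      using b(2)
    proof eventually_elim
      case (elim x)
      have "F k (y x) \<le> t k" using Fr(2)[of k "y x"] Fid[of "y x" k] by (cases "t k \<le> y x") auto
      then show ?case using elim by (simp add: w_def)
    qed
    \<comment> \<open>From the level on, \<open>F k\<close> is nonnegative, so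
      \<open>w k \<ge> b \<ge> - B\<close>; below it \<open>w k\<close> equals
      \<open>u\<close>.\<close>
    moreover have "AE x in ?M. min (u x) (- B) \<le> w k x"
      using b(2)
    proof eventually_elim
      case (elim x)
      show ?case
      proof (cases "t k \<le> y x")
        case True
        have "- B \<le> F k (y x) + b x" using Fr(1)[OF True] elim by linarith
        then show ?thesis by (simp add: w_def min_le_iff_disj)
      next
        case False then show ?thesis using Fid[of "y x" k] by (simp add: w_def y_def)
      qed
    qed
    ultimately show "\<exists>w\<in>admissible p \<Omega> \<phi> (L a g). W1p_norm p \<Omega> (\<lambda>x. w x - u x) < \<epsilon> \<and>
       (LINT x|?M. \<bar>along \<Omega> (L a g) w x - along \<Omega> (L a g) u x\<bar>) < \<epsilon> \<and>
       (\<exists>C. AE x in ?M. w x \<le> C) \<and> (AE x in ?M. min (u x) (- B) \<le> w x)"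
      using adm k(2,3) by blast
  qed
qed

section \<open>Choice of levels under the four assumptions\<close>

definition growth_condition :: "real \<Rightarrow> 'a::euclidean_space set \<Rightarrow> (real \<Rightarrow> real) \<Rightarrow> ('a \<Rightarrow> 'a \<Rightarrow> real) \<Rightarrow> bool" where
  "growth_condition p \<Omega> a g \<longleftrightarrow>
     ((\<lambda>x. g x 0) \<in> Linfty_space \<Omega> \<and> (\<exists>\<alpha>>0. AE x in lebesgue_on \<Omega>. \<forall>\<xi>. \<bar>g x \<xi>\<bar> \<ge> \<alpha>))
     \<or> (\<exists>\<xi>\<^sub>0. AE x in lebesgue_on \<Omega>. g x \<xi>\<^sub>0 = 0)
     \<or> ((\<forall>t. a t = 1) \<and>
         (\<exists>b \<in> W1p p \<Omega> \<inter> Linfty_space \<Omega>. integrable (lebesgue_on \<Omega>) (\<lambda>x. g x (weak_grad \<Omega> b x))))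
     \<or> (integrable (lebesgue_on \<Omega>) (\<lambda>x. g x 0) \<and>
         (\<exists>c>0. AE x in lebesgue_on \<Omega>. \<forall>\<xi>. \<bar>g x (- \<xi>)\<bar> \<le> c * \<bar>g x \<xi>\<bar>))"

text \<open>The infimum of \<open>\<bar>a\<bar>\<close> on the half-line need not be attained, so a
  slack of 1 is left. It is absorbed by the finite measure of \<Omega> under (i) and by
  \<open>\<bar>a\<bar> > 1\<close> under (iv).\<close>

lemma near_minimizer_at_infinity:
  fixes a :: "real \<Rightarrow> real"
  shows "\<exists>t\<ge>k. \<forall>s\<ge>k. \<bar>a t\<bar> \<le> 1 + \<bar>a s\<bar>"
proof -
  let ?S = "(\<lambda>s. \<bar>a s\<bar>) ` {k..}"
  have b: "bdd_below ?S" by (rule bdd_belowI[of _ 0]) auto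
  have "?S \<noteq> {}" by auto
  then obtain m where m: "m \<in> ?S" "m < Inf ?S + 1" using cInf_lessD[of ?S "Inf ?S + 1"] by auto
  then obtain t where t: "k \<le> t" "m = \<bar>a t\<bar>" by auto
  have "\<bar>a t\<bar> \<le> 1 + \<bar>a s\<bar>" if "k \<le> s" for s
    using cInf_lower[OF _ b, of "\<bar>a s\<bar>"] that m(2) t(2) by auto
  then show ?thesis using t(1) by blast
qed

lemma sobolev_zero: "open \<Omega> \<Longrightarrow> 0 < p \<Longrightarrow> sobolev p \<Omega> (\<lambda>x. 0) (\<lambda>x. 0)"
  by (rule C1_supported_in_sobolev[where K = "{}"]) (auto simp: C1_supported_in_def C1_grad_def intro: GDERIV_const)

text \<open>The comparison function for (ii): it has constant gradient \<xi>, to be taken where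
  \<open>g\<close> vanishes, and is bounded because \<Omega> is.\<close>

lemma sobolev_linear:
  fixes \<xi> :: "'a::euclidean_space"
  assumes O: "open \<Omega>" "bounded \<Omega>" and p: "0 < p"
  shows "sobolev p \<Omega> (\<lambda>x. \<xi> \<bullet> x) (\<lambda>x. \<xi>)" and "\<exists>B. \<forall>x\<in>\<Omega>. \<bar>\<xi> \<bullet> x\<bar> \<le> B"
proof -
  obtain R where R: "\<And>x. x \<in> \<Omega> \<Longrightarrow> norm x \<le> R" using O(2) bounded_iff by metis
  have B: "\<bar>\<xi> \<bullet> x\<bar> \<le> norm \<xi> * R" if "x \<in> \<Omega>" for x
    using Cauchy_Schwarz_ineq2[of \<xi> x] mult_left_mono[OF R[OF that], of "norm \<xi>"] by simp
  then show "\<exists>B. \<forall>x\<in>\<Omega>. \<bar>\<xi> \<bullet> x\<bar> \<le> B" by blast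
  have c: "C1_grad (\<lambda>x. \<xi> \<bullet> x) (\<lambda>x. \<xi>)"
    unfolding C1_grad_def gderiv_def by (auto intro!: derivative_eq_intros simp: inner_commute)
  have "(\<lambda>x. \<xi> \<bullet> x) \<in> Lp_space p \<Omega>"
  proof (rule Lp_space_AE_bound[OF Lp_space_const[OF O, of "norm \<xi> * R"] p])
    show "(\<lambda>x. \<xi> \<bullet> x) \<in> borel_measurable (lebesgue_on \<Omega>)"
      using borel_imp_lebesgue[OF C1_grad_borel(1)[OF c]] by (rule measurable_restrict_space1)
    show "AE x in lebesgue_on \<Omega>. norm (\<xi> \<bullet> x) \<le> norm (norm \<xi> * R)"
    proof (rule AE_I2)
      fix x assume "x \<in> space (lebesgue_on \<Omega>)"
      then show "norm (\<xi> \<bullet> x) \<le> norm (norm \<xi> * R)" using order_trans[OF B abs_ge_self, of x] by simp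
    qed
  qed
  then show "sobolev p \<Omega> (\<lambda>x. \<xi> \<bullet> x) (\<lambda>x. \<xi>)"
    using Lp_space_const[OF O, of \<xi>] C1_grad_has_weak_gradient[OF O(1) c] by (simp add: sobolev_def)
qed

text \<open>Truncation flattens \<open>u - b\<close> above \<open>t\<close>, so there
  \<open>w = t + b\<close> and \<open>\<nabla>w = \<nabla>b\<close>. The gradient of
  \<open>u\<close> disappears from the domination condition, which then concerns the level and
  \<open>b\<close> only.\<close>

lemma approx_from_below_truncation:
  fixes g :: "'a::euclidean_space \<Rightarrow> 'a \<Rightarrow> real"
  assumes O: "open \<Omega>" "bounded \<Omega>" and p: "1 \<le> p" and \<phi>: "sobolev p \<Omega> \<phi> G\<phi>" "AE x in lebesgue_on \<Omega>. \<bar>\<phi> x\<bar> \<le> C\<phi>"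
    and a: "continuous_on UNIV a" and g: "Caratheodory \<Omega> g"
    and b: "sobolev p \<Omega> b Gb" "AE x in lebesgue_on \<Omega>. \<bar>b x\<bar> \<le> B"
    and h: "integrable (lebesgue_on \<Omega>) h"
    and u: "u \<in> admissible p \<Omega> \<phi> (\<lambda>x t \<xi>. a t * g x \<xi>)"
    and level: "\<And>k::nat. \<exists>t\<ge>real k. AE x in lebesgue_on \<Omega>. t \<le> u x - b x \<longrightarrow> \<bar>a (t + b x) * g x (Gb x)\<bar> \<le> h x"
  shows "approx_from_below p \<Omega> \<phi> (\<lambda>x t \<xi>. a t * g x \<xi>) u"
proof (rule approx_from_below_cutoff[OF O p \<phi> a g b h u])
  fix k :: nat
  obtain t where t: "real k \<le> t" "AE x in lebesgue_on \<Omega>. t \<le> u x - b x \<longrightarrow> \<bar>a (t + b x) * g x (Gb x)\<bar> \<le> h x"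
    using level by blast
  let ?F = "\<lambda>s. min s t" and ?f = "\<lambda>s. if s < t then 1 else (0::real)"
  have "upper_cutoff t ?F ?f" using t(1) by (intro upper_cutoff_min) simp
  moreover have "AE x in lebesgue_on \<Omega>. t \<le> u x - b x \<longrightarrow>
      \<bar>a (?F (u x - b x) + b x) * g x (?f (u x - b x) *\<^sub>R (weak_grad \<Omega> u x - Gb x) + Gb x)\<bar> \<le> h x"
    using t(2) by eventually_elim (simp add: min_absorb2)
  ultimately show "\<exists>F f t. real k \<le> t \<and> upper_cutoff t F f \<and> (AE x in lebesgue_on \<Omega>. t \<le> u x - b x \<longrightarrow>
      \<bar>a (F (u x - b x) + b x) * g x (f (u x - b x) *\<^sub>R (weak_grad \<Omega> u x - Gb x) + Gb x)\<bar> \<le> h x)"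
    using t(1) by blast
qed

lemma approx_from_below_growth:
  fixes g :: "'a::euclidean_space \<Rightarrow> 'a \<Rightarrow> real"
  assumes O: "open \<Omega>" "bounded \<Omega>" and p: "1 \<le> p" and \<phi>: "sobolev p \<Omega> \<phi> G\<phi>" "AE x in lebesgue_on \<Omega>. \<bar>\<phi> x\<bar> \<le> C\<phi>"
    and a: "continuous_on UNIV a" and g: "Caratheodory \<Omega> g" and gr: "growth_condition p \<Omega> a g"
    and u: "u \<in> admissible p \<Omega> \<phi> (\<lambda>x t \<xi>. a t * g x \<xi>)"
  shows "approx_from_below p \<Omega> \<phi> (\<lambda>x t \<xi>. a t * g x \<xi>) u"
proof -
  let ?M = "lebesgue_on \<Omega>" and ?L = "\<lambda>x t \<xi>. a t * g x \<xi>"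
  have p0: "0 < p" using p by simp
  have ui: "integrable ?M (along \<Omega> ?L u)" using u by (auto simp: admissible_def)
  note z = sobolev_zero[OF O(1) p0]
  have zb: "AE x in ?M. \<bar>0::real\<bar> \<le> 0" by simp
  note cut = approx_from_below_cutoff[OF O p \<phi> a g] and trunc = approx_from_below_truncation[OF O p \<phi> a g]
  from gr consider
    (i) "(\<lambda>x. g x 0) \<in> Linfty_space \<Omega>" "\<exists>\<alpha>>0. AE x in ?M. \<forall>\<xi>. \<bar>g x \<xi>\<bar> \<ge> \<alpha>"
    | (ii) "\<exists>\<xi>\<^sub>0. AE x in ?M. g x \<xi>\<^sub>0 = 0"
    | (iii) "\<forall>t. a t = 1" "\<exists>b \<in> W1p p \<Omega> \<inter> Linfty_space \<Omega>. integrable ?M (\<lambda>x. g x (weak_grad \<Omega> b x))"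
    | (iv) "integrable ?M (\<lambda>x. g x 0)" "\<exists>c>0. AE x in ?M. \<forall>\<xi>. \<bar>g x (- \<xi>)\<bar> \<le> c * \<bar>g x \<xi>\<bar>"
    unfolding growth_condition_def by blast
  then show ?thesis
  proof cases
    case i
    obtain \<alpha> where \<alpha>: "0 < \<alpha>" "AE x in ?M. \<forall>\<xi>. \<bar>g x \<xi>\<bar> \<ge> \<alpha>" using i(2) by blast
    obtain C where C: "AE x in ?M. \<bar>g x 0\<bar> \<le> C" using i(1) by (auto simp: Linfty_space_def)
    interpret finite_measure ?M by (rule finite_measure_lebesgue_on_bounded_open[OF O])
    show ?thesis
    proof (rule trunc[OF z zb _ u])
      \<comment> \<open>On the tail \<open>\<bar>a t\<bar> \<le> 1 + \<bar>a (u x)\<bar>\<close> by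
        the choice of \<open>t\<close>, the lower bound on \<open>g\<close> gives \<open>\<bar>a (u
        x)\<bar> \<le> \<bar>along \<Omega> ?L u x\<bar> / \<alpha>\<close>, and \<open>C\<close>
        bounds \<open>g x 0\<close>. The constant part is integrable because \<Omega> has finite
        measure.\<close>
      show "integrable ?M (\<lambda>x. (1 + \<bar>along \<Omega> ?L u x\<bar> / \<alpha>) * \<bar>C\<bar>)" using ui by auto
      fix k :: nat
      obtain t where t: "real k \<le> t" "\<And>s. real k \<le> s \<Longrightarrow> \<bar>a t\<bar> \<le> 1 + \<bar>a s\<bar>"
        using near_minimizer_at_infinity[of "real k" a] by blast
      have "AE x in ?M. t \<le> u x - 0 \<longrightarrow> \<bar>a (t + 0) * g x 0\<bar> \<le> (1 + \<bar>along \<Omega> ?L u x\<bar> / \<alpha>) * \<bar>C\<bar>"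
        using \<alpha>(2) C
      proof eventually_elim
        case (elim x)
        show ?case
        proof
          assume tu: "t \<le> u x - 0"
          have "\<bar>a (u x)\<bar> * \<alpha> \<le> \<bar>a (u x)\<bar> * \<bar>g x (weak_grad \<Omega> u x)\<bar>" using elim by (intro mult_left_mono) auto
          then have "\<bar>a (u x)\<bar> \<le> \<bar>along \<Omega> ?L u x\<bar> / \<alpha>" using \<alpha>(1) by (simp add: along_def abs_mult pos_le_divide_eq)
          moreover have "\<bar>a t\<bar> \<le> 1 + \<bar>a (u x)\<bar>" using t tu by simp
          ultimately have "\<bar>a t\<bar> \<le> 1 + \<bar>along \<Omega> ?L u x\<bar> / \<alpha>" by linarith
          moreover have "\<bar>g x 0\<bar> \<le> \<bar>C\<bar>" using elim by linarith
          ultimately have "\<bar>a t\<bar> * \<bar>g x 0\<bar> \<le> (1 + \<bar>along \<Omega> ?L u x\<bar> / \<alpha>) * \<bar>C\<bar>" by (intro mult_mono) auto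
          then show "\<bar>a (t + 0) * g x 0\<bar> \<le> (1 + \<bar>along \<Omega> ?L u x\<bar> / \<alpha>) * \<bar>C\<bar>" by (simp add: abs_mult)
        qed
      qed
      with t(1) show "\<exists>t\<ge>real k. AE x in ?M. t \<le> u x - 0 \<longrightarrow> \<bar>a (t + 0) * g x 0\<bar> \<le> (1 + \<bar>along \<Omega> ?L u x\<bar> / \<alpha>) * \<bar>C\<bar>" by blast
    qed
  next
    case ii
    then obtain \<xi> where \<xi>: "AE x in ?M. g x \<xi> = 0" by blast
    obtain B where B: "\<And>x. x \<in> \<Omega> \<Longrightarrow> \<bar>\<xi> \<bullet> x\<bar> \<le> B" using sobolev_linear(2)[OF O p0] by blast
    show ?thesis
    proof (rule trunc[OF sobolev_linear(1)[OF O p0, of \<xi>] _ _ u])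
      show "AE x in ?M. \<bar>\<xi> \<bullet> x\<bar> \<le> B" by (rule AE_I2) (simp add: B)
      show "integrable ?M (\<lambda>x. 0 :: real)" by simp
      show "\<exists>t\<ge>real k. AE x in ?M. t \<le> u x - \<xi> \<bullet> x \<longrightarrow> \<bar>a (t + \<xi> \<bullet> x) * g x \<xi>\<bar> \<le> 0" for k
        by (intro exI[of _ "real k"] conjI order_refl) (use \<xi> in \<open>eventually_elim, simp\<close>)
    qed
  next
    case iii
    then obtain b where b: "b \<in> W1p p \<Omega>" "b \<in> Linfty_space \<Omega>" "integrable ?M (\<lambda>x. g x (weak_grad \<Omega> b x))" by blast
    obtain Gb where "sobolev p \<Omega> b Gb" using b(1) by (auto simp: W1p_iff)
    then have bs: "sobolev p \<Omega> b (weak_grad \<Omega> b)" by (rule sobolev_weak_grad[OF O(1) p0])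
    obtain B where B: "AE x in ?M. \<bar>b x\<bar> \<le> B" using b(2) by (auto simp: Linfty_space_def)
    show ?thesis
    proof (rule trunc[OF bs B integrable_abs[OF b(3)] u])
      show "\<exists>t\<ge>real k. AE x in ?M. t \<le> u x - b x \<longrightarrow> \<bar>a (t + b x) * g x (weak_grad \<Omega> b x)\<bar> \<le> \<bar>g x (weak_grad \<Omega> b x)\<bar>" for k
        using iii(1) by (intro exI[of _ "real k"] conjI order_refl AE_I2) simp
    qed
  next
    case iv
    obtain c where c: "0 < c" "AE x in ?M. \<forall>\<xi>. \<bar>g x (- \<xi>)\<bar> \<le> c * \<bar>g x \<xi>\<bar>" using iv(2) by blast
    \<comment> \<open>The dichotomy: either bounded values of \<open>a\<close> recur at arbitrarily
      high levels, or \<open>\<bar>a\<bar>\<close> tends to infinity.\<close>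
    show ?thesis
    proof (cases "\<exists>C. \<forall>k::nat. \<exists>t\<ge>real k. \<bar>a t\<bar> \<le> C")
      case True
      then obtain C where C: "\<And>k::nat. \<exists>t\<ge>real k. \<bar>a t\<bar> \<le> C" by blast
      show ?thesis
      proof (rule trunc[OF z zb _ u])
        show "integrable ?M (\<lambda>x. C * \<bar>g x 0\<bar>)" using iv(1) by auto
        fix k :: nat
        obtain t where t: "real k \<le> t" "\<bar>a t\<bar> \<le> C" using C by blast
        then show "\<exists>t\<ge>real k. AE x in ?M. t \<le> u x - 0 \<longrightarrow> \<bar>a (t + 0) * g x 0\<bar> \<le> C * \<bar>g x 0\<bar>"
          by (intro exI[of _ t] conjI AE_I2) (simp_all add: abs_mult mult_right_mono)
      qed
    next
      case False
      \<comment> \<open>Absence of recurrence is used with the constant 1: beyond \<open>k0\<close>,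
        additive constants can be absorbed into \<open>\<bar>a\<bar>\<close>.\<close>
      then obtain k0 :: nat where k0: "\<And>t. real k0 \<le> t \<Longrightarrow> 1 < \<bar>a t\<bar>" by (metis not_le)
      show ?thesis
      proof (rule cut[OF z zb _ u])
        \<comment> \<open>The 3 compares \<open>a\<close> on the zigzag interval with
          \<open>a (u x)\<close>; \<open>max 1 c\<close> covers both slopes, factor 1 for slope 1
          and factor \<open>c\<close> for slope -1.\<close>
        show "integrable ?M (\<lambda>x. 3 * max 1 c * \<bar>along \<Omega> ?L u x\<bar>)" using ui by auto
        fix k :: nat
        obtain s0 where s0: "real (max k k0) \<le> s0" "\<And>s. real (max k k0) \<le> s \<Longrightarrow> \<bar>a s0\<bar> \<le> 1 + \<bar>a s\<bar>"
          using near_minimizer_at_infinity[of "real (max k k0)" a] by blast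
        have "isCont a s0" using a by (simp add: continuous_on_eq_continuous_at)
        then obtain d where d: "0 < d" "\<And>s. dist s s0 < d \<Longrightarrow> dist (a s) (a s0) < 1"
          unfolding continuous_at_eps_delta dist_real_def using zero_less_one by (metis)
        \<comment> \<open>Half of \<open>d\<close> keeps the closed interval from \<open>s0\<close>
          to \<open>t\<close> inside the open neighbourhood on which \<open>a\<close> differs from
          \<open>a s0\<close> by less than 1.\<close>
        define t where "t = s0 + d / 2"
        \<comment> \<open>The chain is \<open>\<bar>a s\<bar> \<le> 1 + \<bar>a s0\<bar> \<le> 2 +
          \<bar>a s'\<bar>\<close>, and \<open>1 < \<bar>a s'\<bar>\<close> turns it into the factor
          3.\<close>
        have near: "\<bar>a s\<bar> \<le> 3 * \<bar>a s'\<bar>" if "s0 \<le> s" "s \<le> t" "t \<le> s'" for s s'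
        proof -
          have "dist (a s) (a s0) < 1" using that(1,2) d(1) by (intro d(2)) (simp add: t_def dist_real_def)
          then have "\<bar>a s\<bar> \<le> 1 + \<bar>a s0\<bar>" by (simp add: dist_real_def)
          moreover have "real (max k k0) \<le> s'" using that s0(1) by linarith
          then have "\<bar>a s0\<bar> \<le> 1 + \<bar>a s'\<bar>" "1 < \<bar>a s'\<bar>" using s0(2) k0 by auto
          ultimately show ?thesis by linarith
        qed
        have h: "0 \<le> s0" "s0 < t" using s0(1) d(1) by (auto simp: t_def)
        obtain F f where Ff: "upper_cutoff t F f" "\<And>s. f s = 1 \<or> f s = - 1" "\<And>s. t \<le> s \<Longrightarrow> s0 \<le> F s \<and> F s \<le> t"
          by (rule upper_cutoff_zigzag[OF h]) (rule that)
        show "\<exists>F f t. real k \<le> t \<and> upper_cutoff t F f \<and> (AE x in ?M. t \<le> u x - 0 \<longrightarrow>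
          \<bar>a (F (u x - 0) + 0) * g x (f (u x - 0) *\<^sub>R (weak_grad \<Omega> u x - 0) + 0)\<bar> \<le> 3 * max 1 c * \<bar>along \<Omega> ?L u x\<bar>)"
        proof (intro exI conjI)
          show "real k \<le> t" using s0(1) h(2) by simp
          show "upper_cutoff t F f" by (rule Ff(1))
          show "AE x in ?M. t \<le> u x - 0 \<longrightarrow>
            \<bar>a (F (u x - 0) + 0) * g x (f (u x - 0) *\<^sub>R (weak_grad \<Omega> u x - 0) + 0)\<bar> \<le> 3 * max 1 c * \<bar>along \<Omega> ?L u x\<bar>"
            using c(2)
          proof eventually_elim
            case (elim x)
            show ?case
            proof
              assume tu: "t \<le> u x - 0"
              let ?G = "weak_grad \<Omega> u x"
              have A: "\<bar>a (F (u x))\<bar> \<le> 3 * \<bar>a (u x)\<bar>" using Ff(3)[of "u x"] tu by (intro near) auto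
              have "\<bar>g x ?G\<bar> \<le> max 1 c * \<bar>g x ?G\<bar>" using mult_right_mono[of 1 "max 1 c" "\<bar>g x ?G\<bar>"] by simp
              moreover have "\<bar>g x (- ?G)\<bar> \<le> max 1 c * \<bar>g x ?G\<bar>"
                using elim[rule_format, of ?G] mult_right_mono[of c "max 1 c" "\<bar>g x ?G\<bar>"] by simp
              ultimately have "\<bar>g x (f (u x) *\<^sub>R ?G)\<bar> \<le> max 1 c * \<bar>g x ?G\<bar>" using Ff(2)[of "u x"] by auto
              then have "\<bar>a (F (u x))\<bar> * \<bar>g x (f (u x) *\<^sub>R ?G)\<bar> \<le> (3 * \<bar>a (u x)\<bar>) * (max 1 c * \<bar>g x ?G\<bar>)"
                using A by (intro mult_mono) auto
              then show "\<bar>a (F (u x - 0) + 0) * g x (f (u x - 0) *\<^sub>R (?G - 0) + 0)\<bar> \<le> 3 * max 1 c * \<bar>along \<Omega> ?L u x\<bar>"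
                by (simp add: along_def abs_mult mult_ac)
            qed
          qed
        qed
      qed
    qed
  qed
qed

section \<open>Reflection and the main theorem\<close>

lemma Caratheodory_reflect:
  assumes "Caratheodory \<Omega> g" shows "Caratheodory \<Omega> (\<lambda>x \<xi>. g x (- \<xi>))"
proof -
  have "continuous_on UNIV (\<lambda>\<xi>. g x (- \<xi>))" if "continuous_on UNIV (g x)" for x
    by (rule continuous_on_compose2[OF that continuous_on_minus[OF continuous_on_id]]) simp
  then show ?thesis using assms unfolding Caratheodory_def by (auto elim!: eventually_mono)
qed

lemma weak_grad_minus_AE:
  assumes O: "open \<Omega>" and p: "0 < p" and u: "sobolev p \<Omega> u G"
  shows "AE x in lebesgue_on \<Omega>. weak_grad \<Omega> (\<lambda>x. - u x) x = - weak_grad \<Omega> u x"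
  using weak_grad_AE[OF O, of "\<lambda>x. - u x"] sobolev_minus[OF O sobolev_weak_grad[OF O p u]] by (simp add: sobolev_def)

text \<open>In (i) and (iv) the quantifier over \<xi> is symmetric; (ii) passes to
  \<open>- \<xi>\<close> and (iii) to \<open>- b\<close>. In (iii) the gradient chosen for
  \<open>- b\<close> is minus that of \<open>b\<close> only a.e., so integrability is transferred
  through measurability of the new integrand.\<close>

lemma growth_condition_reflect:
  assumes O: "open \<Omega>" and p: "0 < p" and g: "Caratheodory \<Omega> g" and gr: "growth_condition p \<Omega> a g"
  shows "growth_condition p \<Omega> (\<lambda>t. a (- t)) (\<lambda>x \<xi>. g x (- \<xi>))"
proof -
  let ?M = "lebesgue_on \<Omega>"
  have S: "\<Omega> \<in> sets lebesgue" using O by auto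
  from gr consider
    (i) "(\<lambda>x. g x 0) \<in> Linfty_space \<Omega>" "\<exists>\<alpha>>0. AE x in ?M. \<forall>\<xi>. \<bar>g x \<xi>\<bar> \<ge> \<alpha>"
    | (ii) "\<exists>\<xi>\<^sub>0. AE x in ?M. g x \<xi>\<^sub>0 = 0"
    | (iii) "\<forall>t. a t = 1" "\<exists>b \<in> W1p p \<Omega> \<inter> Linfty_space \<Omega>. integrable ?M (\<lambda>x. g x (weak_grad \<Omega> b x))"
    | (iv) "integrable ?M (\<lambda>x. g x 0)" "\<exists>c>0. AE x in ?M. \<forall>\<xi>. \<bar>g x (- \<xi>)\<bar> \<le> c * \<bar>g x \<xi>\<bar>"
    unfolding growth_condition_def by blast
  then show ?thesis
  proof cases
    case i
    then show ?thesis unfolding growth_condition_def by (intro disjI1) (auto elim!: eventually_mono)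
  next
    case ii
    then obtain \<xi> where "AE x in ?M. g x (- (- \<xi>)) = 0" by auto
    then show ?thesis unfolding growth_condition_def by blast
  next
    case iii
    then obtain b where b: "b \<in> W1p p \<Omega>" "b \<in> Linfty_space \<Omega>" "integrable ?M (\<lambda>x. g x (weak_grad \<Omega> b x))" by blast
    obtain Gb where bs: "sobolev p \<Omega> b Gb" using b(1) by (auto simp: W1p_iff)
    note bm = sobolev_minus[OF O bs]
    have 1: "(\<lambda>x. - b x) \<in> W1p p \<Omega> \<inter> Linfty_space \<Omega>" using bm b(2) by (auto simp: W1p_iff Linfty_space_def)
    have m: "(\<lambda>x. g x (- weak_grad \<Omega> (\<lambda>x. - b x) x)) \<in> borel_measurable ?M"
      by (rule Caratheodory_measurable[OF S Caratheodory_reflect[OF g] sobolev_measurable(2)[OF sobolev_weak_grad[OF O p bm]]])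
    have "AE x in ?M. g x (weak_grad \<Omega> b x) = g x (- weak_grad \<Omega> (\<lambda>x. - b x) x)"
      using weak_grad_minus_AE[OF O p bs] by eventually_elim simp
    from integrable_cong_AE[OF borel_measurable_integrable[OF b(3)] m this] b(3)
    have "integrable ?M (\<lambda>x. g x (- weak_grad \<Omega> (\<lambda>x. - b x) x))" by simp
    with 1 iii(1) show ?thesis unfolding growth_condition_def by blast
  next
    case iv
    obtain c where c: "0 < c" "AE x in ?M. \<forall>\<xi>. \<bar>g x (- \<xi>)\<bar> \<le> c * \<bar>g x \<xi>\<bar>" using iv(2) by blast
    have "AE x in ?M. \<forall>\<xi>. \<bar>g x (- (- \<xi>))\<bar> \<le> c * \<bar>g x (- \<xi>)\<bar>"
      using c(2) by eventually_elim blast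
    then show ?thesis using c(1) iv(1) unfolding growth_condition_def by auto
  qed
qed

text \<open>The two sign changes cancel in the integrand, but the choice inside
  \<open>weak_grad\<close> makes this an a.e. identity; measurability of the reflected integrand
  then transfers integrability.\<close>

lemma admissible_reflect:
  assumes O: "open \<Omega>" and p: "0 < p" and \<phi>: "sobolev p \<Omega> \<phi> G\<phi>" and a: "continuous_on UNIV a" and g: "Caratheodory \<Omega> g"
    and u: "u \<in> admissible p \<Omega> \<phi> (\<lambda>x t \<xi>. a t * g x \<xi>)"
  shows "(\<lambda>x. - u x) \<in> admissible p \<Omega> (\<lambda>x. - \<phi> x) (\<lambda>x t \<xi>. a (- t) * g x (- \<xi>))"
    and "AE x in lebesgue_on \<Omega>. along \<Omega> (\<lambda>x t \<xi>. a (- t) * g x (- \<xi>)) (\<lambda>x. - u x) x = along \<Omega> (\<lambda>x t \<xi>. a t * g x \<xi>) u x"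
proof -
  have ub: "u \<in> W1p_boundary p \<Omega> \<phi>" and ui: "integrable (lebesgue_on \<Omega>) (along \<Omega> (\<lambda>x t \<xi>. a t * g x \<xi>) u)" using u by (auto simp: admissible_def)
  note us = W1p_boundary_sobolev(1)[OF O p \<phi> ub] and uz = W1p_boundary_sobolev(2)[OF O p \<phi> ub]
  show ae: "AE x in lebesgue_on \<Omega>. along \<Omega> (\<lambda>x t \<xi>. a (- t) * g x (- \<xi>)) (\<lambda>x. - u x) x = along \<Omega> (\<lambda>x t \<xi>. a t * g x \<xi>) u x"
    using weak_grad_minus_AE[OF O p us] by eventually_elim (simp add: along_def)
  have a': "continuous_on UNIV (\<lambda>t. a (- t))" by (rule continuous_on_compose2[OF a]) (auto intro: continuous_intros)
  have m: "along \<Omega> (\<lambda>x t \<xi>. a (- t) * g x (- \<xi>)) (\<lambda>x. - u x) \<in> borel_measurable (lebesgue_on \<Omega>)"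
    by (rule along_measurable[OF O p a' Caratheodory_reflect[OF g] sobolev_minus[OF O us]])
  have "integrable (lebesgue_on \<Omega>) (along \<Omega> (\<lambda>x t \<xi>. a (- t) * g x (- \<xi>)) (\<lambda>x. - u x))"
    using integrable_cong_AE[OF m borel_measurable_integrable[OF ui] ae] ui by blast
  moreover have "(\<lambda>x. - u x) \<in> W1p_boundary p \<Omega> (\<lambda>x. - \<phi> x)"
    by (rule W1p_boundaryI) (use W1p_zero_minus[OF O p uz] in simp)
  ultimately show "(\<lambda>x. - u x) \<in> admissible p \<Omega> (\<lambda>x. - \<phi> x) (\<lambda>x t \<xi>. a (- t) * g x (- \<xi>))" by (simp add: admissible_def)
qed

lemma W1p_norm_minus:
  assumes O: "open \<Omega>" and p: "0 < p" and u: "sobolev p \<Omega> u G"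
  shows "W1p_norm p \<Omega> (\<lambda>x. - u x) = W1p_norm p \<Omega> u"
  using W1p_norm_eq[OF O p u] W1p_norm_eq[OF O p sobolev_minus[OF O u]] by (simp add: Lp_norm_def)

text \<open>For each \<open>n\<close>, the first pass gives \<open>w\<close> bounded above and the
  second is applied to \<open>- w\<close>. Its result \<open>v\<close> is bounded above and
  satisfies \<open>v \<ge> min (- w) (- B)\<close>, so \<open>w' = - v\<close> gains a lower bound
  and keeps an upper one.\<close>

lemma Linfty_regular_growth:
  fixes g :: "'a::euclidean_space \<Rightarrow> 'a \<Rightarrow> real"
  assumes O: "open \<Omega>" "bounded \<Omega>" and p: "1 \<le> p" and \<phi>: "sobolev p \<Omega> \<phi> G\<phi>" "AE x in lebesgue_on \<Omega>. \<bar>\<phi> x\<bar> \<le> C\<phi>"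
    and a: "continuous_on UNIV a" and g: "Caratheodory \<Omega> g" and gr: "growth_condition p \<Omega> a g"
    and u: "u \<in> admissible p \<Omega> \<phi> (\<lambda>x t \<xi>. a t * g x \<xi>)"
  shows "Linfty_regular_at p \<Omega> \<phi> (\<lambda>x t \<xi>. a t * g x \<xi>) u"
proof -
  let ?M = "lebesgue_on \<Omega>" and ?L = "\<lambda>x t \<xi>. a t * g x \<xi>" and ?L' = "\<lambda>x t \<xi>. a (- t) * g x (- \<xi>)"
  let ?A = "admissible p \<Omega> \<phi> ?L"
  have p0: "0 < p" using p by simp
  have a': "continuous_on UNIV (\<lambda>t. a (- t))" by (rule continuous_on_compose2[OF a]) (auto intro: continuous_intros)
  note g' = Caratheodory_reflect[OF g]
  note \<phi>' = sobolev_minus[OF O(1) \<phi>(1)]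
  have \<phi>b: "AE x in ?M. \<bar>- \<phi> x\<bar> \<le> C\<phi>" using \<phi>(2) by simp
  have sobA: "sobolev p \<Omega> w (weak_grad \<Omega> w)" if "w \<in> ?A" for w
    using W1p_boundary_sobolev(1)[OF O(1) p0 \<phi>(1)] that by (simp add: admissible_def)
  have intA: "integrable ?M (along \<Omega> ?L w)" if "w \<in> ?A" for w using that by (simp add: admissible_def)
  note us = sobA[OF u]
  define D where "D w v = (LINT x|?M. \<bar>along \<Omega> ?L w x - along \<Omega> ?L v x\<bar>)" for w v
  \<comment> \<open>The Sobolev distances from \<open>w'\<close> to \<open>w\<close> and from
    \<open>w\<close> to \<open>u\<close> are kept apart and combined only in the limit, which avoids
    Minkowski's inequality. The \<open>L^1\<close> distances \<open>D\<close> are added at once,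
    whence the factor 2.\<close>
  define P where "P n w w' \<longleftrightarrow> w \<in> ?A \<and> w' \<in> ?A \<inter> Linfty_space \<Omega> \<and> W1p_norm p \<Omega> (\<lambda>x. w x - u x) < inverse (real (Suc n))
    \<and> W1p_norm p \<Omega> (\<lambda>x. w' x - w x) < inverse (real (Suc n)) \<and> D w' u < 2 * inverse (real (Suc n))" for n w w'
  have "\<exists>w w'. P n w w'" for n
  proof -
    have pos: "0 < inverse (real (Suc n))" by simp
    obtain w C where w: "w \<in> ?A" "W1p_norm p \<Omega> (\<lambda>x. w x - u x) < inverse (real (Suc n))" "D w u < inverse (real (Suc n))"
      "AE x in ?M. w x \<le> C"
      using approx_from_below_growth[OF O p \<phi> a g gr u] pos unfolding approx_from_below_def D_def by meson
    have mw: "(\<lambda>x. - w x) \<in> admissible p \<Omega> (\<lambda>x. - \<phi> x) ?L'" by (rule admissible_reflect(1)[OF O(1) p0 \<phi>(1) a g w(1)])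
    obtain B v C' where v: "v \<in> admissible p \<Omega> (\<lambda>x. - \<phi> x) ?L'" "W1p_norm p \<Omega> (\<lambda>x. v x - - w x) < inverse (real (Suc n))"
      "(LINT x|?M. \<bar>along \<Omega> ?L' v x - along \<Omega> ?L' (\<lambda>x. - w x) x\<bar>) < inverse (real (Suc n))"
      "AE x in ?M. v x \<le> C'" "AE x in ?M. min (- w x) (- B) \<le> v x"
      using approx_from_below_growth[OF O p \<phi>' \<phi>b a' g' growth_condition_reflect[OF O(1) p0 g gr] mw] pos unfolding approx_from_below_def by meson
    define w' where "w' x = - v x" for x
    \<comment> \<open>Reflecting twice restores \<phi>, \<open>a\<close> and
      \<open>g\<close>.\<close>
    have "(\<lambda>x. - v x) \<in> admissible p \<Omega> (\<lambda>x. - (- \<phi> x)) (\<lambda>x t \<xi>. a (- (- t)) * g x (- (- \<xi>)))"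
      by (rule admissible_reflect(1)[OF O(1) p0 \<phi>' a' g' v(1)])
    then have w'A: "w' \<in> ?A" by (simp add: w'_def[abs_def])
    have ae1: "AE x in ?M. along \<Omega> ?L w' x = along \<Omega> ?L' v x"
      using admissible_reflect(2)[OF O(1) p0 \<phi>' a' g' v(1)] by (simp add: w'_def[abs_def])
    note ae2 = admissible_reflect(2)[OF O(1) p0 \<phi>(1) a g w(1)]
    have vi: "integrable ?M (along \<Omega> ?L' v)" "integrable ?M (along \<Omega> ?L' (\<lambda>x. - w x))" using v(1) mw by (auto simp: admissible_def)
    have "D w' w = (LINT x|?M. \<bar>along \<Omega> ?L' v x - along \<Omega> ?L' (\<lambda>x. - w x) x\<bar>)"
      unfolding D_def
    proof (rule integral_cong_AE)
      show "AE x in ?M. \<bar>along \<Omega> ?L w' x - along \<Omega> ?L w x\<bar> = \<bar>along \<Omega> ?L' v x - along \<Omega> ?L' (\<lambda>x. - w x) x\<bar>"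
        using ae1 ae2 by eventually_elim simp
      show "(\<lambda>x. \<bar>along \<Omega> ?L w' x - along \<Omega> ?L w x\<bar>) \<in> borel_measurable ?M"
        by (rule borel_measurable_integrable[OF integrable_abs[OF Bochner_Integration.integrable_diff[OF intA[OF w'A] intA[OF w(1)]]]])
      show "(\<lambda>x. \<bar>along \<Omega> ?L' v x - along \<Omega> ?L' (\<lambda>x. - w x) x\<bar>) \<in> borel_measurable ?M"
        by (rule borel_measurable_integrable[OF integrable_abs[OF Bochner_Integration.integrable_diff[OF vi]]])
    qed
    then have Dw: "D w' w < inverse (real (Suc n))" using v(3) by simp
    have "D w' u \<le> (LINT x|?M. \<bar>along \<Omega> ?L w' x - along \<Omega> ?L w x\<bar> + \<bar>along \<Omega> ?L w x - along \<Omega> ?L u x\<bar>)"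
      unfolding D_def using intA[OF w'A] intA[OF w(1)] intA[OF u] by (intro integral_mono) auto
    also have "\<dots> = D w' w + D w u"
      unfolding D_def using intA[OF w'A] intA[OF w(1)] intA[OF u] by (intro Bochner_Integration.integral_add) auto
    finally have Du: "D w' u < 2 * inverse (real (Suc n))" using Dw w(3) by simp
    have vw: "sobolev p \<Omega> (\<lambda>x. w' x - w x) (\<lambda>x. weak_grad \<Omega> w' x - weak_grad \<Omega> w x)" by (rule sobolev_diff[OF O(1) p0 sobA[OF w'A] sobA[OF w(1)]])
    have "(\<lambda>x. v x - - w x) = (\<lambda>x. - (w' x - w x))" by (auto simp: w'_def)
    then have nw: "W1p_norm p \<Omega> (\<lambda>x. w' x - w x) < inverse (real (Suc n))" using v(2) W1p_norm_minus[OF O(1) p0 vw] by simp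
    \<comment> \<open>\<open>w' x\<close> is at least \<open>- C'\<close> and at most the larger of
      \<open>w x\<close> and \<open>B\<close>, where \<open>w x \<le> C\<close>.\<close>
    have "AE x in ?M. \<bar>w' x\<bar> \<le> \<bar>C'\<bar> + \<bar>B\<bar> + \<bar>C\<bar>"
      using v(4,5) w(4)
    proof eventually_elim
      case (elim x)
      then show ?case unfolding w'_def by (auto simp: min_def split: if_splits)
    qed
    then have "w' \<in> Linfty_space \<Omega>" using sobolev_measurable(1)[OF sobA[OF w'A]] by (auto simp: Linfty_space_def)
    then show ?thesis unfolding P_def using w(1,2) w'A nw Du by blast
  qed
  then obtain w w' where "\<And>n. P n (w n) (w' n)" by metis
  then have P: "\<And>n. w n \<in> ?A" "\<And>n. w' n \<in> ?A \<inter> Linfty_space \<Omega>" "\<And>n. W1p_norm p \<Omega> (\<lambda>x. w n x - u x) < inverse (real (Suc n))"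
    "\<And>n. W1p_norm p \<Omega> (\<lambda>x. w' n x - w n x) < inverse (real (Suc n))" "\<And>n. D (w' n) u < 2 * inverse (real (Suc n))" unfolding P_def by blast+
  have w'A: "w' n \<in> ?A" for n using P(2) by blast
  have nn: "0 \<le> W1p_norm p \<Omega> f" for f by (simp add: W1p_norm_def Lp_norm_nonneg)
  have l1: "(\<lambda>n. W1p_norm p \<Omega> (\<lambda>x. w n x - u x)) \<longlonglongrightarrow> 0"
    by (rule Lim_null_comparison[OF _ LIMSEQ_inverse_real_of_nat]) (use P(3) nn in \<open>auto intro: always_eventually less_imp_le\<close>)
  have l2: "(\<lambda>n. W1p_norm p \<Omega> (\<lambda>x. w' n x - w n x)) \<longlonglongrightarrow> 0"
    by (rule Lim_null_comparison[OF _ LIMSEQ_inverse_real_of_nat]) (use P(4) nn in \<open>auto intro: always_eventually less_imp_le\<close>)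
  have s1: "sobolev p \<Omega> (\<lambda>x. w n x - u x) (\<lambda>x. weak_grad \<Omega> (w n) x - weak_grad \<Omega> u x)" for n by (rule sobolev_diff[OF O(1) p0 sobA[OF P(1)] us])
  have s2: "sobolev p \<Omega> (\<lambda>x. w' n x - w n x) (\<lambda>x. weak_grad \<Omega> (w' n) x - weak_grad \<Omega> (w n) x)" for n by (rule sobolev_diff[OF O(1) p0 sobA[OF w'A] sobA[OF P(1)]])
  have s3: "sobolev p \<Omega> (\<lambda>x. w' n x - u x) (\<lambda>x. weak_grad \<Omega> (w' n) x - weak_grad \<Omega> u x)" for n by (rule sobolev_diff[OF O(1) p0 sobA[OF w'A] us])
  have t1: "Lp_lim p ?M (\<lambda>n x. w n x - u x) (\<lambda>x. 0) \<and> Lp_lim p ?M (\<lambda>n x. weak_grad \<Omega> (w n) x - weak_grad \<Omega> u x) (\<lambda>x. 0)"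
    using W1p_norm_tendsto_zero_iff[OF O(1) p0, of "\<lambda>n x. w n x - u x" "\<lambda>n x. weak_grad \<Omega> (w n) x - weak_grad \<Omega> u x"] s1 l1 by simp
  have t2: "Lp_lim p ?M (\<lambda>n x. w' n x - w n x) (\<lambda>x. 0) \<and> Lp_lim p ?M (\<lambda>n x. weak_grad \<Omega> (w' n) x - weak_grad \<Omega> (w n) x) (\<lambda>x. 0)"
    using W1p_norm_tendsto_zero_iff[OF O(1) p0, of "\<lambda>n x. w' n x - w n x" "\<lambda>n x. weak_grad \<Omega> (w' n) x - weak_grad \<Omega> (w n) x"] s2 l2 by simp
  have "Lp_lim p ?M (\<lambda>n x. (w' n x - w n x) + (w n x - u x)) (\<lambda>x. 0 + 0)"
    by (rule Lp_lim_add[OF conjunct1[OF t2] conjunct1[OF t1] p0 sobolev_measurable(1)[OF s2] _ sobolev_measurable(1)[OF s1]]) simp_all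
  moreover have "Lp_lim p ?M (\<lambda>n x. (weak_grad \<Omega> (w' n) x - weak_grad \<Omega> (w n) x) + (weak_grad \<Omega> (w n) x - weak_grad \<Omega> u x)) (\<lambda>x. 0 + 0)"
    by (rule Lp_lim_add[OF conjunct2[OF t2] conjunct2[OF t1] p0 sobolev_measurable(2)[OF s2] _ sobolev_measurable(2)[OF s1]]) simp_all
  ultimately have "(\<lambda>n. W1p_norm p \<Omega> (\<lambda>x. w' n x - u x)) \<longlonglongrightarrow> 0"
    using W1p_norm_tendsto_zero_iff[OF O(1) p0, of "\<lambda>n x. w' n x - u x" "\<lambda>n x. weak_grad \<Omega> (w' n) x - weak_grad \<Omega> u x"] s3 by simp
  moreover have "(\<lambda>n. D (w' n) u) \<longlonglongrightarrow> 0"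
  proof (rule Lim_null_comparison)
    show "(\<lambda>n. 2 * inverse (real (Suc n))) \<longlonglongrightarrow> 0" using tendsto_mult_left[OF LIMSEQ_inverse_real_of_nat, of 2] by simp
    have "0 \<le> D v w" for v w unfolding D_def by (rule Bochner_Integration.integral_nonneg) simp
    then show "eventually (\<lambda>n. norm (D (w' n) u) \<le> 2 * inverse (real (Suc n))) sequentially"
      using P(5) by (intro always_eventually) (auto intro: less_imp_le)
  qed
  ultimately show ?thesis unfolding Linfty_regular_at_def D_def using P(2) by blast
qed

theorem theorem1p5:
  fixes \<Omega> :: "'a::euclidean_space set"
    and p :: real
    and \<phi> :: "'a \<Rightarrow> real"
    and a :: "real \<Rightarrow> real"
    and g :: "'a \<Rightarrow> 'a \<Rightarrow> real"
    and L :: "'a \<Rightarrow> real \<Rightarrow> 'a \<Rightarrow> real"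
  assumes "bounded \<Omega>" and "open \<Omega>"
    and "1 \<le> p" and "p \<le> real DIM('a)"
    and "\<phi> \<in> W1p p UNIV \<inter> Linfty_space UNIV"
    and "continuous_on UNIV a"
    and "Caratheodory \<Omega> g"
    and "\<And>x t \<xi>. x \<in> \<Omega> \<Longrightarrow> L x t \<xi> = a t * g x \<xi>"
    and "((\<lambda>x. g x 0) \<in> Linfty_space \<Omega> \<and>
           (\<exists>\<alpha>>0. AE x in lebesgue_on \<Omega>. \<forall>\<xi>. \<bar>g x \<xi>\<bar> \<ge> \<alpha>))
       \<or> (\<exists>\<xi>\<^sub>0. AE x in lebesgue_on \<Omega>. g x \<xi>\<^sub>0 = 0)
       \<or> ((\<forall>t. a t = 1) \<and>
           (\<exists>b \<in> W1p p \<Omega> \<inter> Linfty_space \<Omega>.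
              integrable (lebesgue_on \<Omega>) (\<lambda>x. g x (weak_grad \<Omega> b x))))
       \<or> (integrable (lebesgue_on \<Omega>) (\<lambda>x. g x 0) \<and>
           (\<exists>c>0. AE x in lebesgue_on \<Omega>. \<forall>\<xi>. \<bar>g x (- \<xi>)\<bar> \<le> c * \<bar>g x \<xi>\<bar>))"
  shows "\<forall>u \<in> admissible p \<Omega> \<phi> L. Linfty_regular_at p \<Omega> \<phi> L u"
proof
  fix u assume u: "u \<in> admissible p \<Omega> \<phi> L"
  let ?M = "lebesgue_on \<Omega>" and ?L = "\<lambda>x t \<xi>. a t * g x \<xi>"
  have p0: "0 < p" using assms(3) by simp
  have S: "\<Omega> \<in> sets lebesgue" using assms(2) by auto
  \<comment> \<open>\<open>L\<close> is known to be a product only for \<open>x\<close> in \<Omega>,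
    and integrals over \<Omega> see nothing else.\<close>
  have al: "along \<Omega> L w x = along \<Omega> ?L w x" if "x \<in> \<Omega>" for w x using assms(8)[OF that] by (simp add: along_def)
  have "integrable ?M (along \<Omega> L w) \<longleftrightarrow> integrable ?M (along \<Omega> ?L w)" for w
    by (rule Bochner_Integration.integrable_cong) (simp_all add: al)
  then have adm: "admissible p \<Omega> \<phi> L = admissible p \<Omega> \<phi> ?L" by (simp add: admissible_def)
  have D: "(LINT x|?M. \<bar>along \<Omega> L w x - along \<Omega> L u x\<bar>) = (LINT x|?M. \<bar>along \<Omega> ?L w x - along \<Omega> ?L u x\<bar>)" for w
    by (rule Bochner_Integration.integral_cong) (simp_all add: al)
  obtain G where G: "\<phi> \<in> Lp_space p UNIV" "G \<in> Lp_space p UNIV" "has_weak_gradient UNIV \<phi> G"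
    using assms(5) by (auto simp: W1p_def)
  \<comment> \<open>The boundary datum is given on the whole space; its restriction to \<Omega>,
    with the same gradient, enters the approximation.\<close>
  have restrict: "f \<in> Lp_space p \<Omega>" if f: "f \<in> Lp_space p UNIV" for f :: "'a \<Rightarrow> 'c::euclidean_space"
  proof -
    have "integrable lebesgue (\<lambda>x. norm (f x) powr p)" "f \<in> borel_measurable lebesgue"
      using f by (simp_all add: Lp_space_def lebesgue_on_UNIV_eq)
    then show ?thesis using S integrable_mult_indicator[OF S, of "\<lambda>x. norm (f x) powr p"]
      by (simp add: Lp_space_def measurable_restrict_space1 integrable_restrict_space)
  qed
  have \<phi>s: "sobolev p \<Omega> \<phi> G"
    unfolding sobolev_def using restrict[OF G(1)] restrict[OF G(2)] has_weak_gradient_subset[OF assms(2) open_UNIV _ G(3)] by simp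
  obtain C where "AE x in lebesgue_on UNIV. \<bar>\<phi> x\<bar> \<le> C" using assms(5) by (auto simp: Linfty_space_def)
  then have "AE x in lebesgue. \<bar>\<phi> x\<bar> \<le> C" unfolding lebesgue_on_UNIV_eq .
  then have \<phi>b: "AE x in ?M. \<bar>\<phi> x\<bar> \<le> C" using S by (auto simp: AE_restrict_space_iff elim!: eventually_mono)
  have "Linfty_regular_at p \<Omega> \<phi> ?L u"
    using Linfty_regular_growth[OF assms(2,1,3) \<phi>s \<phi>b assms(6,7)] assms(9) u unfolding growth_condition_def adm by blast
  then show "Linfty_regular_at p \<Omega> \<phi> L u" unfolding Linfty_regular_at_def adm D .
qed

end
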